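(* Let $\omega$ be a weight function and let $T:\mathcal{S}_\omega(\mathbb{R}^d)\to\mathcal{S}_\omega(\mathbb{R}^d)$ be a pseudodifferential operator (associated to some amplitude in $\mathrm{GA}^{m,\omega}_\rho$, $m\in\mathbb{R}$, $0<\rho\le1$). The following assertions are equivalent: (1) $T$ has a linear and continuous extension $\widetilde T:\mathcal{S}'_\omega(\mathbb{R}^d)\to\mathcal{S}_\omega(\mathbb{R}^d)$; (2) there exists $K(x,y)\in\mathcal{S}_\omega(\mathbb{R}^{2d})$ such that $$(T\varphi)(x)=\int_{\mathbb{R}^d}K(x,y)\varphi(y)\,dy,\qquad \varphi\in\mathcal{S}_\omega(\mathbb{R}^d).$$
   Context: Notation: $\mathbb{N}=\{1,2,\dots\}$, $\mathbb{N}_0=\mathbb{N}\cup\{0\}$; $D_{x_j}=-i\,\partial/\partial x_j$; $\langle x\rangle=(1+|x|^2)^{1/2}$ with $|x|$ the Euclidean norm. Weight functions: a weight function is a continuous increasing (non-decreasing) $\omega:[0,\infty)\to[0,\infty)$ such that ($\alpha$) there is $L\ge1$ with $\omega(2t)\le L(\omega(t)+1)$ for all $t\ge0$; ($\beta$) $\int_1^\infty \omega(t)t^{-2}\,dt<\infty$; ($\gamma$) $\log t=o(\omega(t))$ as $t\to\infty$; ($\delta$) $\varphi_\omega:t\mapsto\omega(e^t)$ is convex. Throughout, $\omega|_{[0,1]}\equiv0$, and $\omega$ is extended radially by $\omega(\xi)=\omega(|\xi|)$. The Young conjugate is $\varphi_\omega^*(t)=\sup_{s\ge0}\{st-\varphi_\omega(s)\}$,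 $t\ge0$. $\mathcal{S}_\omega(\mathbb{R}^d)$ is the set of $u\in L^1(\mathbb{R}^d)$ such that $u$ and $\widehat u(\xi)=\int u(x)e^{-ix\cdot\xi}dx$ are $C^\infty$ and, for all $\lambda>0$, $\alpha\in\mathbb{N}_0^d$, $\sup_x e^{\lambda\omega(x)}|D^\alpha u(x)|<\infty$ and $\sup_\xi e^{\lambda\omega(\xi)}|D^\alpha\widehat u(\xi)|<\infty$. It is a Fréchet space with the seminorms $|f|_\lambda=\sup_{\alpha}\sup_x|D^\alpha f(x)|e^{-\lambda\varphi_\omega^*(|\alpha|/\lambda)}e^{\lambda\omega(x)}$, $\lambda>0$. Its dual $\mathcal{S}'_\omega(\mathbb{R}^d)$ carries the usual strong dual topology, and $\mathcal{S}_\omega(\mathbb{R}^d)\subset\mathcal{S}'_\omega(\mathbb{R}^d)$ via $f\mapsto\int f\,\cdot\,dx$. An amplitude in $\mathrm{GA}^{m,\omega}_\rho$ is $a(x,y,\xi)\in C^\infty(\mathbb{R}^{3d})$ such that for all $n\in\mathbb{N}$ there is $C_n>0$ with $|D_x^\alpha D_y^\beta D_\xi^\gamma a(x,y,\xi)|\le C_n\big(\langle x-y\rangle/\langle(x,y,\xi)\rangle\big)^{\rho|\alpha+\beta+\gamma|}e^{n\rho\varphi_\omega^*(|\alpha+\beta+\gamma|/n)}e^{m(\omega(x)+\omega(y)+\omega(\xi))}$ for all $(x,y,\xi)\in\mathbb{R}^{3d}$, $(\alpha,\beta,\gamma)\in\mathbb{N}_0^{3d}$. The associated pseudodifferential operator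 is the continuous linear operator $Tf(x)=\int\big(\int e^{i(x-y)\cdot\xi}a(x,y,\xi)f(y)\,dy\big)d\xi$ on $\mathcal{S}_\omega(\mathbb{R}^d)$. *)

theory Defs
  imports "HOL-Analysis.Analysis" "HOL-Library.Landau_Symbols"
begin

section \<open>Derivatives and smooth functions\<close>

definition D_dir :: "'a::euclidean_space \<Rightarrow> ('a \<Rightarrow> complex) \<Rightarrow> 'a \<Rightarrow> complex" where
  "D_dir b f = (\<lambda>x. - \<i> * vector_derivative (\<lambda>t::real. f (x + t *\<^sub>R b)) (at 0))"

primrec Ck :: "nat \<Rightarrow> ('a::euclidean_space \<Rightarrow> complex) \<Rightarrow> bool" where
  "Ck 0 f \<longleftrightarrow> continuous_on UNIV f"
| "Ck (Suc k) f \<longleftrightarrow> continuous_on UNIV f \<and>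
     (\<forall>b\<in>Basis. (\<forall>x. (\<lambda>t::real. f (x + t *\<^sub>R b)) differentiable (at 0)) \<and> Ck k (D_dir b f))"

definition smooth :: "('a::euclidean_space \<Rightarrow> complex) \<Rightarrow> bool" where
  "smooth f \<longleftrightarrow> (\<forall>k. Ck k f)"

text \<open>
  A multi-index on a Euclidean space is a function \<open>\<alpha>\<close> on its canonical basis; values of \<open>\<alpha>\<close>
  off \<open>Basis\<close> are irrelevant.  On a product space \<open>Basis\<close> consists of the basis vectors
  of the factors, so a multi-index on \<open>'a \<times> 'a \<times> 'a\<close> is a triple \<open>(\<alpha>, \<beta>, \<gamma>)\<close> of multi-indices.
  The order of differentiation fixed by \<open>basis_enum\<close> is immaterial for smooth functions, and
  \<open>D_multi\<close> is only applied to those.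
\<close>

definition basis_enum :: "'a::euclidean_space list" where
  "basis_enum = (SOME bs. distinct bs \<and> set bs = Basis)"

definition mi_length :: "('a::euclidean_space \<Rightarrow> nat) \<Rightarrow> nat" where
  "mi_length \<alpha> = (\<Sum>b\<in>Basis. \<alpha> b)"

definition D_multi :: "('a::euclidean_space \<Rightarrow> nat) \<Rightarrow> ('a \<Rightarrow> complex) \<Rightarrow> 'a \<Rightarrow> complex" where
  "D_multi \<alpha> f = foldr (\<lambda>b. D_dir b ^^ \<alpha> b) basis_enum f"

section \<open>Weight functions\<close>

definition weight_function :: "(real \<Rightarrow> real) \<Rightarrow> bool" where
  "weight_function \<omega> \<longleftrightarrow>
     continuous_on {0..} \<omega> \<and> mono_on {0..} \<omega> \<and> (\<forall>t\<ge>0. 0 \<le> \<omega> t) \<and>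
     (\<exists>L\<ge>1. \<forall>t\<ge>0. \<omega> (2 * t) \<le> L * (\<omega> t + 1)) \<and>
     set_integrable lborel {1..} (\<lambda>t. \<omega> t / t\<^sup>2) \<and>
     ln \<in> o(\<omega>) \<and>
     convex_on UNIV (\<lambda>t. \<omega> (exp t)) \<and>
     (\<forall>t\<in>{0..1}. \<omega> t = 0)"

definition young_conj :: "(real \<Rightarrow> real) \<Rightarrow> real \<Rightarrow> real" where
  "young_conj \<omega> t = (SUP s\<in>{0..}. s * t - \<omega> (exp s))"

section \<open>Topologies given by seminorms\<close>

definition seminorm_topology ::
  "('b \<Rightarrow> complex) set \<Rightarrow> (('b \<Rightarrow> complex) \<Rightarrow> real) set \<Rightarrow> ('b \<Rightarrow> complex) topology" where
  "seminorm_topology V P =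
     topology_generated_by {{g \<in> V. p (\<lambda>x. g x - f x) < e} | p f e. p \<in> P \<and> f \<in> V \<and> 0 < e}"

lemma topspace_seminorm_topology:
  assumes "P \<noteq> {}"
  shows "topspace (seminorm_topology V P) = V"
proof
  show "topspace (seminorm_topology V P) \<subseteq> V"
    by (auto simp: seminorm_topology_def)
  show "V \<subseteq> topspace (seminorm_topology V P)"
  proof
    fix f assume f: "f \<in> V"
    obtain p where p: "p \<in> P" using assms by auto
    define e where "e = \<bar>p (\<lambda>x. f x - f x)\<bar> + 1"
    have "f \<in> {g \<in> V. p (\<lambda>x. g x - f x) < e}" "0 < e"
      using f by (auto simp: e_def)
    then show "f \<in> topspace (seminorm_topology V P)"
      using f p unfolding seminorm_topology_def topology_generated_by_topspace by blast
  qed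
qed

section \<open>The space \<open>S\<^sub>\<omega>\<close> and its strong dual\<close>

definition fourier :: "('a::euclidean_space \<Rightarrow> complex) \<Rightarrow> 'a \<Rightarrow> complex" where
  "fourier u \<xi> = (LINT x|lborel. u x * exp (- \<i> * of_real (x \<bullet> \<xi>)))"

definition S_space :: "(real \<Rightarrow> real) \<Rightarrow> ('a::euclidean_space \<Rightarrow> complex) set" where
  "S_space \<omega> = {u. integrable lborel u \<and> smooth u \<and> smooth (fourier u) \<and>
     (\<forall>lam>0. \<forall>\<alpha>.
        bdd_above (range (\<lambda>x. exp (lam * \<omega> (norm x)) * cmod (D_multi \<alpha> u x))) \<and>
        bdd_above (range (\<lambda>\<xi>. exp (lam * \<omega> (norm \<xi>)) * cmod (D_multi \<alpha> (fourier u) \<xi>))))}"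

text \<open>For a weight function \<open>\<omega>\<close> the supremum below is finite on \<open>S_space \<omega>\<close>.\<close>

definition S_seminorm :: "(real \<Rightarrow> real) \<Rightarrow> real \<Rightarrow> ('a::euclidean_space \<Rightarrow> complex) \<Rightarrow> real" where
  "S_seminorm \<omega> lam f =
     (SUP (\<alpha>, x)\<in>UNIV. cmod (D_multi \<alpha> f x)
        * exp (- lam * young_conj \<omega> (real (mi_length \<alpha>) / lam)) * exp (lam * \<omega> (norm x)))"

definition S_topology :: "(real \<Rightarrow> real) \<Rightarrow> ('a::euclidean_space \<Rightarrow> complex) topology" where
  "S_topology \<omega> = seminorm_topology (S_space \<omega>) {S_seminorm \<omega> lam | lam. 0 < lam}"

definition S_bounded :: "(real \<Rightarrow> real) \<Rightarrow> ('a::euclidean_space \<Rightarrow> complex) set \<Rightarrow> bool" where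
  "S_bounded \<omega> B \<longleftrightarrow> B \<subseteq> S_space \<omega> \<and> (\<forall>lam>0. bdd_above (S_seminorm \<omega> lam ` B))"

text \<open>
  Functionals on \<open>S_space \<omega>\<close> are total functions in HOL; normalising them to \<open>0\<close> off the space
  makes equality of functionals the equality of functions.
\<close>

definition S_dual :: "(real \<Rightarrow> real) \<Rightarrow> (('a::euclidean_space \<Rightarrow> complex) \<Rightarrow> complex) set" where
  "S_dual \<omega> = {u.
     (\<forall>f\<in>S_space \<omega>. \<forall>g\<in>S_space \<omega>. \<forall>c d. u (\<lambda>x. c * f x + d * g x) = c * u f + d * u g) \<and>
     continuous_map (S_topology \<omega>) euclidean u \<and>
     (\<forall>f. f \<notin> S_space \<omega> \<longrightarrow> u f = 0)}"

definition S_dual_topology ::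
  "(real \<Rightarrow> real) \<Rightarrow> (('a::euclidean_space \<Rightarrow> complex) \<Rightarrow> complex) topology" where
  "S_dual_topology \<omega> =
     seminorm_topology (S_dual \<omega>) {\<lambda>u. SUP f\<in>B. cmod (u f) | B. S_bounded \<omega> B \<and> B \<noteq> {}}"

definition S_embed ::
  "(real \<Rightarrow> real) \<Rightarrow> ('a::euclidean_space \<Rightarrow> complex) \<Rightarrow> ('a \<Rightarrow> complex) \<Rightarrow> complex" where
  "S_embed \<omega> f = (\<lambda>\<phi>. if \<phi> \<in> S_space \<omega> then LINT x|lborel. f x * \<phi> x else 0)"

definition linear_op_on ::
  "('b \<Rightarrow> complex) set \<Rightarrow> (('b \<Rightarrow> complex) \<Rightarrow> 'c \<Rightarrow> complex) \<Rightarrow> bool" where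
  "linear_op_on V A \<longleftrightarrow>
     (\<forall>u\<in>V. \<forall>v\<in>V. \<forall>c d. A (\<lambda>z. c * u z + d * v z) = (\<lambda>x. c * A u x + d * A v x))"

section \<open>Amplitudes and pseudodifferential operators\<close>

definition jap :: "'a::real_normed_vector \<Rightarrow> real" where
  "jap x = sqrt (1 + (norm x)\<^sup>2)"

definition GA ::
  "real \<Rightarrow> (real \<Rightarrow> real) \<Rightarrow> real \<Rightarrow> ('a::euclidean_space \<times> 'a \<times> 'a \<Rightarrow> complex) set" where
  "GA m \<omega> \<rho> = {a. smooth a \<and>
     (\<forall>n::nat. n \<ge> 1 \<longrightarrow> (\<exists>C>0. \<forall>x y \<xi> \<alpha>.
        cmod (D_multi \<alpha> a (x, y, \<xi>)) \<le>
          C * (jap (x - y) / jap (x, y, \<xi>)) powr (\<rho> * real (mi_length \<alpha>))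
            * exp (real n * \<rho> * young_conj \<omega> (real (mi_length \<alpha>) / real n))
            * exp (m * (\<omega> (norm x) + \<omega> (norm y) + \<omega> (norm \<xi>)))))}"

definition pseudo_op ::
  "('a::euclidean_space \<times> 'a \<times> 'a \<Rightarrow> complex) \<Rightarrow> ('a \<Rightarrow> complex) \<Rightarrow> 'a \<Rightarrow> complex" where
  "pseudo_op a f x =
     (LINT \<xi>|lborel. (LINT y|lborel. exp (\<i> * of_real ((x - y) \<bullet> \<xi>)) * a (x, y, \<xi>) * f y))"

end

(* The space S is described by seminorms alone: f belongs to S iff for every lambda all derivatives satisfy
   |D^alpha f(x)| <= C m(lambda, |alpha|) exp (- lambda omega(x)), where m(lambda, k) is the supremum over t >= 1 of
   t^k exp (- lambda omega(t)). The bound without decay comes from the decay of the Fourier transform. Integrating by parts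
   in the integral of x_b^(2k) |D^alpha f|^2 adds the decay; a Lipschitz function is comparable to its value on a small ball,
   so the L2 bound is also a pointwise one.

   Given an extension T', the kernel is K(x, y) = T'(delta_y)(x). Continuity on the strong dual bounds T' by a supremum over
   one bounded set, so derivatives of delta_y yield joint bounds on the derivatives of K, and approximating phi dx by finite
   combinations of point masses yields the integral representation. Conversely, a kernel K acts on functionals by
   (T' u)(x) = u(K(x, .)), and the normalised derivatives of the slices K(x, .) form a bounded set. *)
theory Submission
  imports Defs "HOL-Probability.Characteristic_Functions" "HOL-Probability.Sinc_Integral"
begin

section \<open>Partial derivatives along words of basis vectors\<close>

text \<open>The obstacle is uniformity. Membership in \<open>S_space\<close> bounds each derivative
  separately, with a constant depending on the multi-index, whereas a seminorm asks for one constant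
  for all of them. Fourier inversion gives uniform constants but no decay. In the L2 pairing the
  derivatives are therefore pushed one at a time from one factor onto the other until
  \<open>u\<close> itself is left there: only the decay of this single function enters, and each
  commutator with x_b^m costs a factor m that the moments absorb. The ball argument controls
  |D^alpha u(x)|^(d+2), so decay is requested with d+2 times the target exponent and a root is taken
  at the end. Powers of x_b are kept even to make the integrand nonnegative. Exponential decay is
  recovered from the even moments by convexity of t -> omega(e^t), in effect a Young biconjugate.
  For the operators, differentiability always comes from a second order Taylor remainder: of a point
  mass, uniformly on a bounded set, or of a slice of the kernel, in a seminorm.\<close>

definition has_D :: "'a::euclidean_space \<Rightarrow> ('a \<Rightarrow> complex) \<Rightarrow> ('a \<Rightarrow> complex) \<Rightarrow> bool" where
  "has_D b f g \<longleftrightarrow> (\<forall>x. ((\<lambda>t. f (x + t *\<^sub>R b)) has_vector_derivative \<i> * g x) (at 0))"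

lemma has_D_at:
  assumes "has_D b f g"
  shows "((\<lambda>t. f (x + t *\<^sub>R b)) has_vector_derivative \<i> * g (x + s *\<^sub>R b)) (at s within S)"
proof -
  have "((\<lambda>t. f ((x + s *\<^sub>R b) + t *\<^sub>R b)) has_vector_derivative \<i> * g (x + s *\<^sub>R b)) (at (s - s))"
    using assms unfolding has_D_def by simp
  then have "(((\<lambda>t. f ((x + s *\<^sub>R b) + t *\<^sub>R b)) \<circ> (\<lambda>t. t - s)) has_vector_derivative
      1 *\<^sub>R (\<i> * g (x + s *\<^sub>R b))) (at s)"
    by (intro vector_diff_chain_at) (auto intro!: derivative_eq_intros)
  then show ?thesis
    by (auto simp: o_def algebra_simps intro: has_vector_derivative_at_within)
qed

lemma has_D_D_dir: "has_D b f g \<Longrightarrow> D_dir b f = g"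
proof
  fix x assume "has_D b f g"
  then have "vector_derivative (\<lambda>t. f (x + t *\<^sub>R b)) (at 0) = \<i> * g x"
    unfolding has_D_def by (intro vector_derivative_at) auto
  then show "D_dir b f x = g x" unfolding D_dir_def by simp
qed

lemma has_D_cong: "has_D b f g \<Longrightarrow> g = g' \<Longrightarrow> has_D b f g'"
  by simp

lemma smooth_continuous: "smooth f \<Longrightarrow> continuous_on UNIV f"
  unfolding smooth_def using Ck.simps(1) by blast

lemma smooth_D_dir: "smooth f \<Longrightarrow> b \<in> Basis \<Longrightarrow> smooth (D_dir b f)"
  unfolding smooth_def using Ck.simps(2) by blast

lemma smooth_has_D: 
  assumes "smooth f" "b \<in> Basis" 
  shows "has_D b f (D_dir b f)"
proof -
  have "Ck (Suc 0) f" using assms unfolding smooth_def by blast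
  then show ?thesis
    using assms(2) unfolding has_D_def D_dir_def by (auto simp: vector_derivative_works)
qed

text \<open>Coinduction: a class of continuous functions that contains a partial derivative of each
  member in every basis direction consists of smooth functions. Each use supplies an explicit family
  as \<open>P\<close>, which spares an induction over \<open>Ck\<close>.\<close>

lemma smooth_coinduct:
  assumes "P f"
    and step: "\<And>f. P f \<Longrightarrow> continuous_on UNIV f \<and> (\<forall>b\<in>Basis. \<exists>g. has_D b f g \<and> P g)"
  shows "smooth f"
proof -
  have c: "continuous_on UNIV f" if "P f" for f
    by (rule conjunct1[OF step[OF that]])
  have d: "\<exists>g. has_D b f g \<and> P g" if "P f" "b \<in> Basis" for f b
    by (rule bspec[OF conjunct2[OF step[OF that(1)]] that(2)])
  have "\<forall>f. P f \<longrightarrow> Ck k f" for k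
  proof (induction k)
    case 0
    show ?case using c by simp
  next
    case (Suc k)
    show ?case
    proof (intro allI impI)
      fix f assume f: "P f"
      have "(\<forall>x. (\<lambda>t::real. f (x + t *\<^sub>R b)) differentiable (at 0)) \<and> Ck k (D_dir b f)" if b: "b \<in> Basis" for b
      proof -
        obtain g where g: "has_D b f g" "P g" using d[OF f b] by (elim exE conjE)
        have "(\<lambda>t::real. f (x + t *\<^sub>R b)) differentiable (at 0)" for x
          by (rule differentiableI_vector[OF g(1)[unfolded has_D_def, rule_format]])
        moreover have "Ck k (D_dir b f)" unfolding has_D_D_dir[OF g(1)] using Suc g(2) by simp
        ultimately show ?thesis by simp
      qed
      then show "Ck (Suc k) f" using c[OF f] by simp
    qed
  qed
  then show ?thesis using assms(1) unfolding smooth_def by simp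
qed

section \<open>Rules of differentiation\<close>

lemma has_D_lin:
  assumes "has_D b f f'" "has_D b g g'"
  shows "has_D b (\<lambda>x. c * f x + d * g x) (\<lambda>x. c * f' x + d * g' x)"
  unfolding has_D_def
proof
  fix x
  have "((\<lambda>t. c * f (x + t *\<^sub>R b) + d * g (x + t *\<^sub>R b)) has_vector_derivative 
      c * (\<i> * f' x) + d * (\<i> * g' x)) (at 0)"
    using assms unfolding has_D_def
    by (intro has_vector_derivative_add has_vector_derivative_mult_right) auto
  then show "((\<lambda>t. c * f (x + t *\<^sub>R b) + d * g (x + t *\<^sub>R b)) has_vector_derivative 
      \<i> * (c * f' x + d * g' x)) (at 0)" 
    by (simp add: algebra_simps)
qed

lemma has_D_mult:
  assumes "has_D b f f'" "has_D b g g'"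
  shows "has_D b (\<lambda>x. f x * g x) (\<lambda>x. f' x * g x + f x * g' x)"
  unfolding has_D_def
proof
  fix x
  show "((\<lambda>t. f (x + t *\<^sub>R b) * g (x + t *\<^sub>R b)) has_vector_derivative \<i> * (f' x * g x + f x * g' x)) (at 0)"
    using has_vector_derivative_mult[of "\<lambda>t. f (x + t *\<^sub>R b)" "\<i> * f' x" 0 UNIV "\<lambda>t. g (x + t *\<^sub>R b)" "\<i> * g' x"] 
      assms unfolding has_D_def by (simp add: algebra_simps)
qed

text \<open>D carries the factor -i, so conjugation turns D into -D. This sign cancels the one from
  integration by parts: D moves across an L2 pairing unchanged.\<close>

lemma has_D_cnj:
  assumes "has_D b f f'"
  shows "has_D b (\<lambda>x. cnj (f x)) (\<lambda>x. - cnj (f' x))"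
  unfolding has_D_def
proof
  fix x
  have "((\<lambda>t. cnj (f (x + t *\<^sub>R b))) has_vector_derivative cnj (\<i> * f' x)) (at 0)"
    using assms bounded_linear.has_vector_derivative[OF bounded_linear_cnj] unfolding has_D_def by blast
  then show "((\<lambda>t. cnj (f (x + t *\<^sub>R b))) has_vector_derivative \<i> * - cnj (f' x)) (at 0)"
    by simp
qed

lemma has_D_coord:
  assumes "b \<in> Basis" "e \<in> Basis"
  shows "has_D e (\<lambda>x. complex_of_real (x \<bullet> b)) (\<lambda>x. if e = b then - \<i> else 0)"
  unfolding has_D_def
proof
  fix x :: 'a
  have "((\<lambda>t. x \<bullet> b + t * (e \<bullet> b)) has_vector_derivative (e \<bullet> b)) (at 0)"
    unfolding has_real_derivative_iff_has_vector_derivative[symmetric] by (auto intro!: derivative_eq_intros)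
  then have "((\<lambda>t. complex_of_real (x \<bullet> b + t * (e \<bullet> b))) has_vector_derivative of_real (e \<bullet> b)) (at 0)"
    by (rule bounded_linear.has_vector_derivative[OF bounded_linear_of_real])
  then show "((\<lambda>t. complex_of_real ((x + t *\<^sub>R e) \<bullet> b)) has_vector_derivative \<i> * (if e = b then - \<i> else 0)) (at 0)"
    using assms by (auto simp: inner_simps inner_Basis)
qed

lemma smooth_lin:
  assumes "smooth f" "smooth g"
  shows "smooth (\<lambda>x. c * f x + d * g x)"
proof (rule smooth_coinduct[where P="\<lambda>h. \<exists>f g. smooth f \<and> smooth g \<and> h = (\<lambda>x. c * f x + d * g x)"])
  show "\<exists>f' g'. smooth f' \<and> smooth g' \<and> (\<lambda>x. c * f x + d * g x) = (\<lambda>x. c * f' x + d * g' x)"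
    using assms by blast
  fix h :: "'a \<Rightarrow> complex"
  assume "\<exists>f g. smooth f \<and> smooth g \<and> h = (\<lambda>x. c * f x + d * g x)"
  then obtain f g where h: "smooth f" "smooth g" "h = (\<lambda>x. c * f x + d * g x)" by blast
  show "continuous_on UNIV h \<and> (\<forall>b\<in>Basis. \<exists>g. has_D b h g \<and> 
      (\<exists>f f'. smooth f \<and> smooth f' \<and> g = (\<lambda>x. c * f x + d * f' x)))"
  proof (intro conjI ballI)
    show "continuous_on UNIV h" unfolding h(3) using smooth_continuous h by (intro continuous_intros) auto
    fix b :: 'a assume "b \<in> Basis"
    then show "\<exists>g. has_D b h g \<and> (\<exists>f f'. smooth f \<and> smooth f' \<and> g = (\<lambda>x. c * f x + d * f' x))"
      unfolding h(3)
      by (intro exI[of _ "\<lambda>x. c * D_dir b f x + d * D_dir b g x"] conjI has_D_lin smooth_has_D h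
          exI[of _ "D_dir b f"] exI[of _ "D_dir b g"] smooth_D_dir refl)
  qed
qed

text \<open>Words of basis vectors stand in for multi-indices: a further derivative is a further
  letter, and proofs go by induction on the list. The head is the derivative applied last.\<close>

abbreviation Dw :: "'a::euclidean_space list \<Rightarrow> ('a \<Rightarrow> complex) \<Rightarrow> 'a \<Rightarrow> complex" where
  "Dw w f \<equiv> foldr D_dir w f"

lemma smooth_Dw: "smooth f \<Longrightarrow> set w \<subseteq> Basis \<Longrightarrow> smooth (Dw w f)"
  by (induction w) (auto intro: smooth_D_dir)

lemma Dw_lin:
  assumes "smooth f" "smooth g" "set w \<subseteq> Basis"
  shows "Dw w (\<lambda>x. c * f x + d * g x) = (\<lambda>x. c * Dw w f x + d * Dw w g x)"
  using assms(3)
proof (induction w)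
  case (Cons b w)
  then have "has_D b (\<lambda>x. c * Dw w f x + d * Dw w g x) (\<lambda>x. c * D_dir b (Dw w f) x + d * D_dir b (Dw w g) x)"
    by (intro has_D_lin smooth_has_D smooth_Dw assms) auto
  from has_D_D_dir[OF this] show ?case using Cons by simp
qed simp

text \<open>The increment of \<open>D_dir b f\<close> along \<open>a\<close> is an integral of \<open>D_dir b (D_dir a f)\<close>, by differentiating under the
  integral sign; its derivative at the end point is the other mixed derivative.\<close>

lemma D_dir_commute:
  fixes f :: "'a::euclidean_space \<Rightarrow> complex"
  assumes f: "smooth f" and ab: "a \<in> Basis" "b \<in> Basis"
  shows "D_dir a (D_dir b f) = D_dir b (D_dir a f)"
proof
  fix x
  define p where "p = (\<lambda>y. \<i> * D_dir a f y)"
  define q where "q = (\<lambda>y. \<i> * (\<i> * D_dir b (D_dir a f) y))"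
  note sa = smooth_D_dir[OF f ab(1)] and sb = smooth_D_dir[OF f ab(2)]
  have cf: "continuous_on S f" for S using smooth_continuous[OF f] continuous_on_subset by blast
  have cp: "continuous_on S p" for S unfolding p_def
    using smooth_continuous[OF sa] continuous_on_subset by (intro continuous_intros) blast
  have cq: "continuous_on S q" for S unfolding q_def
    using smooth_continuous[OF smooth_D_dir[OF sa ab(2)]] continuous_on_subset by (intro continuous_intros) blast
  have 1: "((\<lambda>t. p (y + t *\<^sub>R b)) has_vector_derivative q (y + s *\<^sub>R b)) (at s within S)" for y s S
    unfolding p_def q_def by (intro has_vector_derivative_mult_right has_D_at[OF smooth_has_D[OF sa ab(2)]])
  have 2: "\<i> * D_dir b f (x + s *\<^sub>R a) - \<i> * D_dir b f x = integral {0..s} (\<lambda>r. q (x + r *\<^sub>R a))"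
    if s: "s \<in> {0..1}" for s
  proof -
    have I: "integral {0..s} (\<lambda>r. p (x + r *\<^sub>R a + t *\<^sub>R b)) = f (x + s *\<^sub>R a + t *\<^sub>R b) - f (x + t *\<^sub>R b)" for t
    proof (rule integral_unique)
      have "((\<lambda>r. p (x + r *\<^sub>R a + t *\<^sub>R b)) has_integral 
        f (x + t *\<^sub>R b + s *\<^sub>R a) - f (x + t *\<^sub>R b + 0 *\<^sub>R a)) {0..s}"
      proof (rule fundamental_theorem_of_calculus)
        show "((\<lambda>r. f (x + t *\<^sub>R b + r *\<^sub>R a)) has_vector_derivative p (x + r *\<^sub>R a + t *\<^sub>R b)) (at r within {0..s})" for r
          using has_D_at[OF smooth_has_D[OF f ab(1)], of "x + t *\<^sub>R b" r] unfolding p_def by (simp add: algebra_simps)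
      qed (use s in auto)
      then show "((\<lambda>r. p (x + r *\<^sub>R a + t *\<^sub>R b)) has_integral 
        f (x + s *\<^sub>R a + t *\<^sub>R b) - f (x + t *\<^sub>R b)) {0..s}" by (simp add: algebra_simps)
    qed
    have "((\<lambda>t. integral (cbox 0 s) (\<lambda>r. p (x + r *\<^sub>R a + t *\<^sub>R b))) has_vector_derivative
       integral (cbox 0 s) (\<lambda>r. q (x + r *\<^sub>R a + 0 *\<^sub>R b))) (at 0 within UNIV)"
    proof (rule leibniz_rule_vector_derivative)
      show "((\<lambda>t. p (x + r *\<^sub>R a + t *\<^sub>R b)) has_vector_derivative q (x + r *\<^sub>R a + t *\<^sub>R b)) (at t within UNIV)" for t r
        by (rule 1)
      show "(\<lambda>r. p (x + r *\<^sub>R a + t *\<^sub>R b)) integrable_on cbox 0 s" for t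
        by (intro integrable_continuous continuous_on_compose2[OF cp] continuous_intros) auto
      show "continuous_on (UNIV \<times> cbox 0 s) (\<lambda>(t, r). q (x + r *\<^sub>R a + t *\<^sub>R b))"
        unfolding split_beta by (intro continuous_on_compose2[OF cq] continuous_intros) auto
    qed auto
    then have A: "((\<lambda>t. f (x + s *\<^sub>R a + t *\<^sub>R b) - f (x + t *\<^sub>R b)) has_vector_derivative
       integral {0..s} (\<lambda>r. q (x + r *\<^sub>R a))) (at 0)"
      by (simp add: I)
    have B: "((\<lambda>t. f (x + s *\<^sub>R a + t *\<^sub>R b) - f (x + t *\<^sub>R b)) has_vector_derivative
       \<i> * D_dir b f (x + s *\<^sub>R a + 0 *\<^sub>R b) - \<i> * D_dir b f (x + 0 *\<^sub>R b)) (at 0)"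
      by (intro has_vector_derivative_diff has_D_at[OF smooth_has_D[OF f ab(2)]])
    show ?thesis using vector_derivative_unique_at[OF A B] by simp
  qed
  have cqx: "continuous_on {0..1} (\<lambda>r. q (x + r *\<^sub>R a))"
    by (intro continuous_on_compose2[OF cq] continuous_intros) auto
  have "((\<lambda>s. \<i> * D_dir b f (x + s *\<^sub>R a) - \<i> * D_dir b f x) has_vector_derivative 
      \<i> * (\<i> * D_dir a (D_dir b f) (x + 0 *\<^sub>R a)) - 0) (at 0 within {0..1})"
    by (intro has_vector_derivative_diff has_vector_derivative_mult_right has_D_at[OF smooth_has_D[OF sb ab(1)]]
        has_vector_derivative_const)
  then have A: "((\<lambda>s. \<i> * D_dir b f (x + s *\<^sub>R a) - \<i> * D_dir b f x) has_vector_derivative 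
      \<i> * (\<i> * D_dir a (D_dir b f) x)) (at 0 within {0..1})" by simp
  have "((\<lambda>s. integral {0..s} (\<lambda>r. q (x + r *\<^sub>R a))) has_vector_derivative q (x + 0 *\<^sub>R a)) (at 0 within {0..1})"
    by (rule integral_has_vector_derivative[OF cqx]) auto
  then have B: "((\<lambda>s. \<i> * D_dir b f (x + s *\<^sub>R a) - \<i> * D_dir b f x) has_vector_derivative q x) (at 0 within {0..1})"
    using 2 by (auto intro: has_vector_derivative_transform[of 0 "{0..1}", rotated 2])
  have "\<i> * (\<i> * D_dir a (D_dir b f) x) = q x"
    using vector_derivative_unique_within_closed_interval[of 0 1 "0::real", simplified, OF A B] .
  then show "D_dir a (D_dir b f) x = D_dir b (D_dir a f) x" unfolding q_def by simp
qed

lemma Dw_move: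
  assumes "smooth f" "set u \<subseteq> Basis" "b \<in> Basis" "set v \<subseteq> Basis"
  shows "Dw (u @ b # v) f = D_dir b (Dw (u @ v) f)"
  using assms(2)
proof (induction u)
  case (Cons a u)
  then have "Dw ((a # u) @ b # v) f = D_dir a (D_dir b (Dw (u @ v) f))" by simp
  also have "\<dots> = D_dir b (D_dir a (Dw (u @ v) f))"
    by (intro D_dir_commute smooth_Dw assms(1)) (use assms Cons.prems in auto)
  finally show ?case by simp
qed simp

text \<open>The head of \<open>w\<close> is located inside \<open>w'\<close> and pulled to its front
  by \<open>Dw_move\<close>; the rest is the induction hypothesis.\<close>

lemma Dw_perm:
  assumes "smooth f" "mset w = mset w'" "set w \<subseteq> Basis"
  shows "Dw w f = Dw w' f"
  using assms(2,3)
proof (induction w arbitrary: w')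
  case (Cons b w)
  then have "b \<in> set w'" by (metis list.set_intros(1) mset_eq_setD)
  then obtain u v where w': "w' = u @ b # v" by (meson split_list)
  have s: "set w' \<subseteq> Basis" using Cons.prems by (metis mset_eq_setD)
  have "mset w = mset (u @ v)" using Cons.prems unfolding w' by simp
  then have "Dw w f = Dw (u @ v) f" by (rule Cons.IH) (use Cons.prems in simp)
  then show ?case using Dw_move[OF assms(1), of u b v] s unfolding w' by simp
qed simp

section \<open>Words and multi-indices\<close>

lemma basis_enum: "distinct (basis_enum :: 'a::euclidean_space list)" "set basis_enum = (Basis :: 'a set)"
proof -
  have "\<exists>bs. distinct bs \<and> set bs = (Basis :: 'a set)"
    using finite_distinct_list[OF finite_Basis] by blast
  then have "distinct (basis_enum :: 'a list) \<and> set basis_enum = (Basis :: 'a set)"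
    unfolding basis_enum_def by (rule someI_ex)
  then show "distinct (basis_enum :: 'a list)" "set basis_enum = (Basis :: 'a set)" by auto
qed

definition mi_word :: "('a::euclidean_space \<Rightarrow> nat) \<Rightarrow> 'a list" where
  "mi_word \<alpha> = concat (map (\<lambda>b. replicate (\<alpha> b) b) basis_enum)"

lemma D_multi_Dw: "D_multi \<alpha> f = Dw (mi_word \<alpha>) f"
proof -
  have "foldr (\<lambda>b. D_dir b ^^ \<alpha> b) bs f = Dw (concat (map (\<lambda>b. replicate (\<alpha> b) b) bs)) f" for bs
    by (induction bs) auto
  then show ?thesis unfolding D_multi_def mi_word_def .
qed

lemma mi_word_Basis: "set (mi_word \<alpha>) \<subseteq> Basis"
  unfolding mi_word_def by (auto simp: basis_enum)

lemma length_mi_word: "length (mi_word \<alpha>) = mi_length \<alpha>"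
proof -
  have "length (mi_word \<alpha>) = sum_list (map \<alpha> basis_enum)"
    unfolding mi_word_def length_concat by (simp add: o_def)
  then show ?thesis unfolding mi_length_def by (metis basis_enum sum_list_distinct_conv_sum_set)
qed

text \<open>Sorting a word into the order of \<open>basis_enum\<close> does not change its
  derivative, and its letter counts form the multi-index. Bounds over all words and bounds over all
  multi-indices are thus the same bounds.\<close>

lemma Dw_D_multi:
  fixes w :: "'a::euclidean_space list"
  assumes "smooth f" "set w \<subseteq> Basis"
  obtains \<alpha> where "D_multi \<alpha> f = Dw w f" "mi_length \<alpha> = length w"
proof
  let ?\<alpha> = "count (mset w)"
  have c: "count (mset (concat (map (\<lambda>b. replicate (?\<alpha> b) b) bs))) x = (if x \<in> set bs then ?\<alpha> x else 0)" 
    if "distinct bs" for bs :: "'a list" and x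
    using that by (induction bs) auto
  have "mset (mi_word ?\<alpha>) = mset w"
    by (rule multiset_eqI, unfold mi_word_def, subst c)
       (use assms(2) in \<open>auto simp: basis_enum not_in_iff[symmetric]\<close>)
  then show "D_multi ?\<alpha> f = Dw w f"
    unfolding D_multi_Dw using Dw_perm[OF assms(1)] assms(2) mi_word_Basis by metis
  show "mi_length ?\<alpha> = length w"
    using \<open>mset (mi_word ?\<alpha>) = mset w\<close> unfolding length_mi_word[symmetric] by (metis size_mset)
qed

text \<open>The mean value inequality for \<open>f\<close> minus a presumed linear part of slope
  \<open>\<i> * c\<close>. With \<open>c = 0\<close> it is the usual mean value bound; with
  \<open>c = g x\<close> and a bound on the increments of \<open>g\<close> it is a second order
  remainder.\<close>

lemma D_dir_Taylor:
  assumes "has_D b f g" and "\<And>s. \<bar>s\<bar> \<le> \<bar>t\<bar> \<Longrightarrow> cmod (g (x + s *\<^sub>R b) - c) \<le> M"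
  shows "cmod (f (x + t *\<^sub>R b) - f x - t *\<^sub>R (\<i> * c)) \<le> M * \<bar>t\<bar>"
proof -
  define h where "h = (\<lambda>s. f (x + s *\<^sub>R b) - s *\<^sub>R (\<i> * c))"
  have "norm (h t - h 0) \<le> M * norm (t - 0)"
  proof (rule differentiable_bound)
    show "convex {-\<bar>t\<bar>..\<bar>t\<bar>}" by simp
    fix s assume s: "s \<in> {-\<bar>t\<bar>..\<bar>t\<bar>}"
    have "(h has_vector_derivative \<i> * g (x + s *\<^sub>R b) - 1 *\<^sub>R (\<i> * c)) (at s within {-\<bar>t\<bar>..\<bar>t\<bar>})"
      unfolding h_def by (intro has_vector_derivative_diff has_D_at assms(1)) (auto intro!: derivative_eq_intros)
    then show "(h has_derivative (\<lambda>r. r *\<^sub>R (\<i> * (g (x + s *\<^sub>R b) - c)))) (at s within {-\<bar>t\<bar>..\<bar>t\<bar>})"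
      unfolding has_vector_derivative_def by (simp add: algebra_simps)
    have "cmod (g (x + s *\<^sub>R b) - c) \<le> M" using s by (intro assms(2)) auto
    then show "onorm (\<lambda>r. r *\<^sub>R (\<i> * (g (x + s *\<^sub>R b) - c))) \<le> M"
      by (intro onorm_le) (simp add: norm_mult mult.commute[of M] mult_left_mono)
  qed auto
  then show ?thesis unfolding h_def by (simp add: algebra_simps)
qed

lemma D_dir_MVT:
  assumes "has_D b f g" and "\<And>s. \<bar>s\<bar> \<le> \<bar>t\<bar> \<Longrightarrow> cmod (g (x + s *\<^sub>R b)) \<le> M"
  shows "cmod (f (x + t *\<^sub>R b) - f x) \<le> M * \<bar>t\<bar>"
  using D_dir_Taylor[of b f g t x 0 M] assms by simp

lemma D_dir_Taylor2:
  assumes "has_D b f g" "has_D b g h" and "\<And>s. \<bar>s\<bar> \<le> \<bar>t\<bar> \<Longrightarrow> cmod (h (x + s *\<^sub>R b)) \<le> M"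
  shows "cmod (f (x + t *\<^sub>R b) - f x - t *\<^sub>R (\<i> * g x)) \<le> M * t\<^sup>2"
proof -
  have "0 \<le> M" by (rule order_trans[OF norm_ge_zero assms(3)[of 0]]) simp
  have "cmod (g (x + s *\<^sub>R b) - g x) \<le> M * \<bar>t\<bar>" if "\<bar>s\<bar> \<le> \<bar>t\<bar>" for s
  proof -
    have "cmod (g (x + s *\<^sub>R b) - g x) \<le> M * \<bar>s\<bar>" by (rule D_dir_MVT[OF assms(2)], rule assms(3), use that in linarith)
    also have "\<dots> \<le> M * \<bar>t\<bar>" using that \<open>0 \<le> M\<close> by (intro mult_left_mono) auto
    finally show ?thesis .
  qed
  then have "cmod (f (x + t *\<^sub>R b) - f x - t *\<^sub>R (\<i> * g x)) \<le> M * \<bar>t\<bar> * \<bar>t\<bar>"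
    by (intro D_dir_Taylor[where g=g] assms(1))
  then show ?thesis by (simp add: power2_eq_square mult.assoc)
qed

text \<open>The path from \<open>x\<close> to \<open>y\<close> moves along one coordinate at a time;
  it has \<open>DIM('a)\<close> legs, each of length at most \<open>norm (y - x)\<close>.\<close>

lemma D_dir_Lipschitz:
  fixes f :: "'a::euclidean_space \<Rightarrow> complex"
  assumes "\<And>b. b \<in> Basis \<Longrightarrow> has_D b f (g b)" "\<And>b x. b \<in> Basis \<Longrightarrow> cmod (g b x) \<le> M"
  shows "cmod (f y - f x) \<le> M * DIM('a) * norm (y - x)"
proof -
  have M: "0 \<le> M" by (rule order_trans[OF norm_ge_zero assms(2)[OF SOME_Basis, of x]])
  have *: "cmod (f (x + (\<Sum>b\<in>A. ((y - x) \<bullet> b) *\<^sub>R b)) - f x) \<le> M * card A * norm (y - x)" if "A \<subseteq> Basis" for A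
    using finite_subset[OF that finite_Basis] that
  proof (induction A rule: finite_induct)
    case (insert b A)
    let ?z = "x + (\<Sum>b\<in>A. ((y - x) \<bullet> b) *\<^sub>R b)"
    have "cmod (f (?z + ((y - x) \<bullet> b) *\<^sub>R b) - f ?z) \<le> M * \<bar>(y - x) \<bullet> b\<bar>"
      by (rule D_dir_MVT[OF assms(1)], use insert.prems in blast, rule assms(2), use insert.prems in blast)
    also have "\<dots> \<le> M * norm (y - x)" using insert.prems M by (intro mult_left_mono Basis_le_norm) auto
    finally have 1: "cmod (f (?z + ((y - x) \<bullet> b) *\<^sub>R b) - f ?z) \<le> M * norm (y - x)" .
    have 2: "cmod (f ?z - f x) \<le> M * card A * norm (y - x)" using insert by auto
    have "cmod (f (?z + ((y - x) \<bullet> b) *\<^sub>R b) - f x) \<le> M * norm (y - x) + M * card A * norm (y - x)"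
      using norm_triangle_mono[OF 1 2] by simp
    then show ?case using insert.hyps by (simp add: algebra_simps)
  qed auto
  have e: "x + (\<Sum>b\<in>Basis. ((y - x) \<bullet> b) *\<^sub>R b) = y" by (simp add: euclidean_representation)
  show ?thesis using *[OF order_refl] unfolding e .
qed

section \<open>Weight functions\<close>

locale weight =
  fixes \<omega> :: "real \<Rightarrow> real"
  assumes weight: "weight_function \<omega>"
begin

section \<open>Growth of the weight\<close>

lemma om_cont: "continuous_on {0..} \<omega>"
  and om_mono_on: "mono_on {0..} \<omega>"
  and om_nonneg': "\<forall>t\<ge>0. 0 \<le> \<omega> t"
  and om_double: "\<exists>L\<ge>1. \<forall>t\<ge>0. \<omega> (2 * t) \<le> L * (\<omega> t + 1)"
  and om_integrable: "set_integrable lborel {1..} (\<lambda>t. \<omega> t / t\<^sup>2)"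
  and om_ln: "ln \<in> o(\<omega>)"
  and om_convex: "convex_on UNIV (\<lambda>t. \<omega> (exp t))"
  and om_zero': "\<forall>t\<in>{0..1}. \<omega> t = 0"
  by (insert weight, unfold weight_function_def, elim conjE, assumption)+

lemma om_mono: "0 \<le> s \<Longrightarrow> s \<le> t \<Longrightarrow> \<omega> s \<le> \<omega> t"
  by (rule mono_onD[OF om_mono_on]) auto

lemma om_nonneg: "0 \<le> t \<Longrightarrow> 0 \<le> \<omega> t"
  using om_nonneg' by simp

lemma om_zero: "0 \<le> t \<Longrightarrow> t \<le> 1 \<Longrightarrow> \<omega> t = 0"
  using om_zero' by simp

lemma om_norm_cont: "continuous_on UNIV (\<lambda>x::'a::real_normed_vector. \<omega> (norm x))"
  by (rule continuous_on_compose2[OF om_cont]) (auto intro: continuous_intros)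

text \<open>Condition (alpha) is iterated n times with 2^n > c. The additive 1 that reappears in
  every step is swallowed by the factor 2 in \<open>(2 * L) ^ n\<close>.\<close>

lemma om_scale:
  assumes "0 \<le> c"
  obtains L where "L \<ge> 1" "\<And>t. 0 \<le> t \<Longrightarrow> \<omega> (c * t) \<le> L * (\<omega> t + 1)"
proof -
  obtain L where L: "L \<ge> 1" "\<And>t. 0 \<le> t \<Longrightarrow> \<omega> (2 * t) \<le> L * (\<omega> t + 1)"
    using om_double by (elim exE conjE) simp
  have *: "\<omega> (2 ^ n * t) \<le> (2 * L) ^ n * (\<omega> t + 1)" if "0 \<le> t" for n t
    using that
  proof (induction n arbitrary: t)
    case (Suc n)
    have 1: "1 \<le> (2 * L) ^ n" using L(1) by (intro one_le_power) simp
    have "\<omega> (2 ^ Suc n * t) = \<omega> (2 * (2 ^ n * t))" by (simp add: mult.assoc)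
    also have "\<dots> \<le> L * (\<omega> (2 ^ n * t) + 1)" using Suc.prems by (intro L) auto
    also have "\<dots> \<le> L * ((2 * L) ^ n * (\<omega> t + 1) + 1)" using Suc L by (intro mult_left_mono add_right_mono) auto
    also have "\<dots> \<le> L * ((2 * L) ^ n * (\<omega> t + 1) + (2 * L) ^ n * (\<omega> t + 1))"
      using L 1 om_nonneg[OF Suc.prems] mult_mono[of 1 "(2 * L) ^ n" 1 "\<omega> t + 1"]
      by (intro mult_left_mono add_left_mono) auto
    finally show ?case by (simp add: algebra_simps)
  qed simp
  obtain n where n: "c < 2 ^ n" using real_arch_pow[of 2 c] by auto
  show ?thesis
  proof
    show "1 \<le> (2 * L) ^ n" using L(1) by (intro one_le_power) simp
    fix t :: real assume t: "0 \<le> t"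
    have "\<omega> (c * t) \<le> \<omega> (2 ^ n * t)" using n t assms by (intro om_mono mult_right_mono) auto
    then show "\<omega> (c * t) \<le> (2 * L) ^ n * (\<omega> t + 1)" using *[OF t, of n] by linarith
  qed
qed

text \<open>Condition (gamma): log t is eventually below any multiple of the weight, hence every
  power is eventually below its exponential. The constant pays for the bounded range t < T.\<close>

lemma om_poly:
  assumes "0 < lam"
  obtains C where "C > 0" "\<And>t. 0 \<le> t \<Longrightarrow> (1 + t) ^ N \<le> C * exp (lam * \<omega> t)"
proof -
  \<comment> \<open>The slope has N + 1 rather than N in the denominator to be positive for N = 0 as
    well.\<close>
  from landau_o.smallD[OF om_ln, of "lam / (real N + 1)"] assms
  obtain T0 where T0: "\<And>t. T0 \<le> t \<Longrightarrow> \<bar>ln t\<bar> \<le> lam / (real N + 1) * \<bar>\<omega> t\<bar>"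
    by (auto simp: eventually_at_top_linorder)
  define T where "T = max T0 1"
  show ?thesis
  proof
    show "(2::real) ^ N + (1 + T) ^ N > 0" unfolding T_def by (simp add: add_pos_pos)
    fix t :: real assume t: "0 \<le> t"
    have e1: "1 \<le> exp (lam * \<omega> t)" using om_nonneg[OF t] assms by simp
    have Tp: "0 \<le> (1 + T) ^ N" unfolding T_def by simp
    show "(1 + t) ^ N \<le> (2 ^ N + (1 + T) ^ N) * exp (lam * \<omega> t)"
    proof (cases "T \<le> t")
      case True
      then have t1: "1 \<le> t" "T0 \<le> t" unfolding T_def by auto
      have "ln t \<le> lam / (real N + 1) * \<omega> t" using T0[OF t1(2)] om_nonneg[OF t] t1 by simp
      then have "N * ln t \<le> N * (lam / (real N + 1) * \<omega> t)" by (intro mult_left_mono) auto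
      also have "\<dots> = (N / (real N + 1)) * (lam * \<omega> t)" by simp
      also have "\<dots> \<le> 1 * (lam * \<omega> t)" using om_nonneg[OF t] assms by (intro mult_right_mono) auto
      finally have "exp (N * ln t) \<le> exp (lam * \<omega> t)" by simp
      then have l: "t ^ N \<le> exp (lam * \<omega> t)" using t1 by (simp add: exp_of_nat_mult)
      have "(1 + t) ^ N \<le> (2 * t) ^ N" using t1 by (intro power_mono) auto
      also have "\<dots> \<le> 2 ^ N * exp (lam * \<omega> t)" using l by (simp add: power_mult_distrib)
      also have "\<dots> \<le> (2 ^ N + (1 + T) ^ N) * exp (lam * \<omega> t)" using Tp by (intro mult_right_mono) auto
      finally show ?thesis .
    next
      case False
      have "(1 + t) ^ N \<le> (1 + T) ^ N" using t False by (intro power_mono) auto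
      also have "\<dots> \<le> (2 ^ N + (1 + T) ^ N) * 1" by simp
      also have "\<dots> \<le> (2 ^ N + (1 + T) ^ N) * exp (lam * \<omega> t)" using e1 Tp by (intro mult_left_mono) auto
      finally show ?thesis .
    qed
  qed
qed

text \<open>Condition (beta) forces linear growth: on [t, 2t] the monotone weight is at least
  \<omega>(t) and s^2 is at most 4 t^2, so this window alone contributes \<omega>(t) / (4 t) to a
  finite integral.\<close>

lemma om_linear:
  obtains C where "C > 0" "\<And>t. 0 \<le> t \<Longrightarrow> \<omega> t \<le> C * (1 + t)"
proof -
  have int: "integrable lborel (\<lambda>s. indicator {1..} s *\<^sub>R (\<omega> s / s\<^sup>2))"
    using om_integrable unfolding set_integrable_def .
  define I where "I = (LINT s|lborel. indicator {1..} s *\<^sub>R (\<omega> s / s\<^sup>2))"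
  have I0: "0 \<le> I" unfolding I_def
    by (rule integral_nonneg_AE) (auto simp: indicator_def intro!: divide_nonneg_nonneg om_nonneg)
  have *: "\<omega> t \<le> 4 * I * t" if t: "1 \<le> t" for t
  proof -
    have "(LINT s|lborel. indicator {t..2*t} s *\<^sub>R (\<omega> t / (4 * t\<^sup>2))) \<le> I"
      unfolding I_def
    proof (rule integral_mono[OF _ int])
      show "integrable lborel (\<lambda>s. indicator {t..2*t} s *\<^sub>R (\<omega> t / (4 * t\<^sup>2)))" 
        using t by (intro integrable_scaleR_left integrable_real_indicator) auto
      fix s
      show "indicator {t..2*t} s *\<^sub>R (\<omega> t / (4 * t\<^sup>2)) \<le> indicator {1..} s *\<^sub>R (\<omega> s / s\<^sup>2)"
      proof (cases "s \<in> {t..2*t}")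
        case True
        have "s\<^sup>2 \<le> (2 * t)\<^sup>2" using True t by (intro power_mono) auto
        then have "\<omega> t / (4 * t\<^sup>2) \<le> \<omega> s / s\<^sup>2"
          using True t by (intro frac_le om_mono om_nonneg) (auto simp: power_mult_distrib)
        then show ?thesis using True t by (simp add: indicator_def)
      next
        case False
        then show ?thesis using om_nonneg[of s] by (auto simp: indicator_def)
      qed
    qed
    moreover have "(LINT s|lborel. indicator {t..2*t} s *\<^sub>R (\<omega> t / (4 * t\<^sup>2))) = t * (\<omega> t / (4 * t\<^sup>2))"
      using t by simp
    ultimately show ?thesis using t by (simp add: power2_eq_square field_simps)
  qed
  show ?thesis
  proof
    show "0 < 4 * I + 1" using I0 by simp
    fix t :: real assume t: "0 \<le> t"
    show "\<omega> t \<le> (4 * I + 1) * (1 + t)"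
    proof (cases "1 \<le> t")
      case True
      then show ?thesis using *[OF True] I0 by (simp add: algebra_simps)
    next
      case False
      then show ?thesis using om_zero[of t] t I0 by simp
    qed
  qed
qed

text \<open>\<open>exp (lam * young_conj \<omega> (k / lam))\<close> is the supremum of \<open>t ^ k * exp (- lam * \<omega> t)\<close> over \<open>t \<ge> 1\<close>;
  in this form all its properties become elementary.\<close>

definition moment :: "real \<Rightarrow> nat \<Rightarrow> real" where
  "moment lam k = exp (lam * young_conj \<omega> (real k / lam))"

lemma moment_pos [simp]: "0 < moment lam k"
  unfolding moment_def by simp

lemma moment_neq_0 [simp]: "moment lam k \<noteq> 0"
  unfolding moment_def by simp

lemma moment_nonneg [simp]: "0 \<le> moment lam k"
  unfolding moment_def by simp

text \<open>Ensures that the \<open>SUP\<close> in \<open>young_conj\<close> is a genuine supremum.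
  Rounding \<open>y\<close> up to a natural number turns exp (s y) into a power of exp s, which the
  weight dominates by \<open>om_poly\<close>.\<close>

lemma young_conj_bdd: "bdd_above ((\<lambda>s. s * y - \<omega> (exp s)) ` {0..})"
proof -
  obtain C where C: "C > 0" "\<And>t. 0 \<le> t \<Longrightarrow> (1 + t) ^ nat \<lceil>\<bar>y\<bar>\<rceil> \<le> C * exp (1 * \<omega> t)" 
    using om_poly[of 1 "nat \<lceil>\<bar>y\<bar>\<rceil>"] by auto
  have "s * y - \<omega> (exp s) \<le> ln C" if "0 \<le> s" for s
  proof -
    have "s * y \<le> s * nat \<lceil>\<bar>y\<bar>\<rceil>" using that by (intro mult_left_mono) linarith+
    then have "exp (s * y) \<le> exp (s * nat \<lceil>\<bar>y\<bar>\<rceil>)" by simp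
    also have "\<dots> = exp s ^ nat \<lceil>\<bar>y\<bar>\<rceil>" by (rule exp_of_nat2_mult)
    also have "\<dots> \<le> (1 + exp s) ^ nat \<lceil>\<bar>y\<bar>\<rceil>" by (intro power_mono) auto
    also have "\<dots> \<le> C * exp (\<omega> (exp s))" using C(2)[of "exp s"] by simp
    also have "\<dots> = exp (ln C + \<omega> (exp s))" using C by (simp add: exp_add)
    finally show ?thesis by simp
  qed
  then show ?thesis by (intro bdd_aboveI2) auto
qed

lemma moment_ge:
  assumes "0 < lam" "1 \<le> t"
  shows "t ^ k * exp (- lam * \<omega> t) \<le> moment lam k"
proof -
  have "ln t * (k / lam) - \<omega> (exp (ln t)) \<le> young_conj \<omega> (k / lam)"
    unfolding young_conj_def using assms by (intro cSUP_upper young_conj_bdd) auto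
  then have "lam * (ln t * (k / lam) - \<omega> t) \<le> lam * young_conj \<omega> (k / lam)"
    using assms by (intro mult_left_mono) auto
  moreover have "lam * (ln t * (k / lam) - \<omega> t) = k * ln t - lam * \<omega> t"
    using assms by (simp add: field_simps)
  ultimately have "exp (k * ln t - lam * \<omega> t) \<le> moment lam k" unfolding moment_def by simp
  then show ?thesis using assms by (simp add: exp_diff exp_minus exp_of_nat_mult field_simps)
qed

text \<open>With \<open>moment_ge\<close> this makes \<open>moment lam k\<close> the least upper
  bound of \<open>t ^ k * exp (- lam * \<omega> t)\<close> over t \<ge> 1, so inequalities between
  moments can be checked at one t at a time.\<close>

lemma moment_le:
  assumes "0 < lam" "\<And>t. 1 \<le> t \<Longrightarrow> t ^ k * exp (- lam * \<omega> t) \<le> M"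
  shows "moment lam k \<le> M"
proof -
  have M: "0 < M" using assms(2)[of 1] less_le_trans[OF exp_gt_zero] by fastforce
  have "young_conj \<omega> (k / lam) \<le> ln M / lam"
    unfolding young_conj_def
  proof (rule cSUP_least)
    fix s :: real assume s: "s \<in> {0..}"
    have "exp (s * k - lam * \<omega> (exp s)) = exp s ^ k * exp (- lam * \<omega> (exp s))"
      by (simp add: exp_diff exp_minus exp_of_nat2_mult field_simps)
    also have "\<dots> \<le> M" using s by (intro assms(2)) auto
    also have "M = exp (ln M)" using M by simp
    finally have "s * k - lam * \<omega> (exp s) \<le> ln M" unfolding exp_le_cancel_iff .
    then have "(s * k - lam * \<omega> (exp s)) / lam \<le> ln M / lam" using assms(1) by (intro divide_right_mono) auto
    moreover have "(s * k - lam * \<omega> (exp s)) / lam = s * (k / lam) - \<omega> (exp s)" 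
      using assms(1) by (simp add: diff_divide_distrib)
    ultimately show "s * (k / lam) - \<omega> (exp s) \<le> ln M / lam" by simp
  qed auto
  then have "lam * young_conj \<omega> (k / lam) \<le> ln M" using assms(1) by (simp add: field_simps)
  then show ?thesis unfolding moment_def using M by (metis exp_le_cancel_iff exp_ln)
qed

lemma moment_0: "0 < lam \<Longrightarrow> moment lam 0 = 1"
proof (rule antisym)
  assume l: "0 < lam"
  show "moment lam 0 \<le> 1" using l om_nonneg by (intro moment_le) auto
  show "1 \<le> moment lam 0" using moment_ge[OF l, of 1 0] om_zero[of 1] by simp
qed

lemma moment_mono:
  assumes "0 < lam" "j \<le> k"
  shows "moment lam j \<le> moment lam k"
proof (rule moment_le[OF assms(1)])
  fix t :: real assume t: "1 \<le> t"
  have "t ^ j * exp (- lam * \<omega> t) \<le> t ^ k * exp (- lam * \<omega> t)"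
    using t assms by (intro mult_right_mono power_increasing) auto
  then show "t ^ j * exp (- lam * \<omega> t) \<le> moment lam k" using moment_ge[OF assms(1) t, of k] by linarith
qed

lemma moment_ge_1: "0 < lam \<Longrightarrow> 1 \<le> moment lam k"
  using moment_mono[of lam 0 k] moment_0 by simp

lemma moment_antimono:
  assumes "0 < mu" "mu \<le> lam"
  shows "moment lam k \<le> moment mu k"
proof (rule moment_le)
  show "0 < lam" using assms by simp
  fix t :: real assume t: "1 \<le> t"
  have "t ^ k * exp (- lam * \<omega> t) \<le> t ^ k * exp (- mu * \<omega> t)"
    using t assms om_nonneg[of t] by (intro mult_left_mono) (auto intro: mult_right_mono)
  then show "t ^ k * exp (- lam * \<omega> t) \<le> moment mu k" using moment_ge[OF assms(1) t, of k] by linarith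
qed

text \<open>The values at t and u multiply to at most the value of order j + k at max t u, because
  \<omega> (max t u) \<le> \<omega> t + \<omega> u. The two suprema are then taken one after the
  other by dividing. It merges derivatives in x and in y into one joint order without loss in
  \<open>lam\<close>.\<close>

lemma moment_mult_le:
  assumes "0 < lam"
  shows "moment lam j * moment lam k \<le> moment lam (j + k)"
proof -
  have 1: "(t ^ j * exp (- lam * \<omega> t)) * (u ^ k * exp (- lam * \<omega> u)) \<le> moment lam (j + k)" 
    if t: "1 \<le> t" and u: "1 \<le> u" for t u :: real
  proof -
    let ?m = "max t u"
    have "(t ^ j * exp (- lam * \<omega> t)) * (u ^ k * exp (- lam * \<omega> u)) = t ^ j * u ^ k * exp (- lam * (\<omega> t + \<omega> u))"
      by (simp add: distrib_left exp_diff exp_minus field_simps)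
    also have "\<dots> \<le> ?m ^ j * ?m ^ k * exp (- lam * \<omega> ?m)"
    proof (intro mult_mono power_mono)
      have "\<omega> ?m \<le> \<omega> t + \<omega> u" using om_nonneg[of t] om_nonneg[of u] t u by (auto simp: max_def)
      then show "exp (- lam * (\<omega> t + \<omega> u)) \<le> exp (- lam * \<omega> ?m)" using assms by simp
    qed (use t u in auto)
    also have "\<dots> = ?m ^ (j + k) * exp (- lam * \<omega> ?m)" by (simp add: power_add)
    also have "\<dots> \<le> moment lam (j + k)" using t by (intro moment_ge assms) auto
    finally show ?thesis .
  qed
  have 2: "moment lam j \<le> moment lam (j + k) / (u ^ k * exp (- lam * \<omega> u))" if u: "1 \<le> u" for u
  proof (rule moment_le[OF assms])
    fix t :: real assume t: "1 \<le> t"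
    have "0 < u ^ k * exp (- lam * \<omega> u)" using u by simp
    then show "t ^ j * exp (- lam * \<omega> t) \<le> moment lam (j + k) / (u ^ k * exp (- lam * \<omega> u))"
      using 1[OF t u] by (subst pos_le_divide_eq) auto
  qed
  have "moment lam k \<le> moment lam (j + k) / moment lam j"
  proof (rule moment_le[OF assms])
    fix u :: real assume u: "1 \<le> u"
    have "0 < u ^ k * exp (- lam * \<omega> u)" using u by simp
    then have "moment lam j * (u ^ k * exp (- lam * \<omega> u)) \<le> moment lam (j + k)"
      using 2[OF u] by (subst (asm) pos_le_divide_eq) auto
    then show "u ^ k * exp (- lam * \<omega> u) \<le> moment lam (j + k) / moment lam j"
      by (simp add: pos_le_divide_eq mult.commute)
  qed
  then show ?thesis by (simp add: pos_le_divide_eq mult.commute)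
qed

text \<open>The converse of \<open>moment_mult_le\<close>, paid for by halving \<open>lam\<close>:
  the exponential is shared equally between the two powers.\<close>

lemma moment_split:
  assumes "0 < lam"
  shows "moment lam (j + k) \<le> moment (lam / 2) j * moment (lam / 2) k"
proof (rule moment_le[OF assms])
  fix t :: real assume t: "1 \<le> t"
  have "t ^ (j + k) * exp (- lam * \<omega> t) = (t ^ j * exp (- (lam / 2) * \<omega> t)) * (t ^ k * exp (- (lam / 2) * \<omega> t))"
    by (simp add: power_add exp_add[symmetric])
  also have "\<dots> \<le> moment (lam / 2) j * moment (lam / 2) k"
    using t assms by (intro mult_mono moment_ge) auto
  finally show "t ^ (j + k) * exp (- lam * \<omega> t) \<le> moment (lam / 2) j * moment (lam / 2) k" .
qed

text \<open>A geometric factor costs only a larger parameter: c^k t^k is (c t)^k, and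
  \<open>om_scale\<close> compares the weight at c t with L times the weight at t. Hence the
  parameter \<open>mu * L\<close> and the constant \<open>exp (mu * L)\<close>.\<close>

lemma moment_geometric:
  assumes "0 < mu" "1 \<le> c"
  obtains lam C where "0 < C" "mu \<le> lam" "\<And>k. c ^ k * moment lam k \<le> C * moment mu k"
proof -
  have c0: "0 \<le> c" using assms by simp
  obtain L where L: "L \<ge> 1" "\<And>t. 0 \<le> t \<Longrightarrow> \<omega> (c * t) \<le> L * (\<omega> t + 1)" by (rule om_scale[OF c0]) blast
  show ?thesis
  proof
    show "mu \<le> mu * L" using L assms by simp
    fix k
    have "moment (mu * L) k \<le> exp (mu * L) * moment mu k / c ^ k"
    proof (rule moment_le)
      show "0 < mu * L" using assms L by simp
      fix t :: real assume t: "1 \<le> t"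
      have "mu * \<omega> (c * t) \<le> mu * (L * (\<omega> t + 1))" using t assms by (intro mult_left_mono L) auto
      then have e: "- (mu * L) * \<omega> t \<le> mu * L + - mu * \<omega> (c * t)" by (simp add: algebra_simps)
      have "c ^ k * (t ^ k * exp (- (mu * L) * \<omega> t)) = (c * t) ^ k * exp (- (mu * L) * \<omega> t)"
        by (simp add: power_mult_distrib)
      also have "\<dots> \<le> (c * t) ^ k * exp (mu * L + - mu * \<omega> (c * t))"
        using assms t e by (intro mult_left_mono) auto
      also have "\<dots> = exp (mu * L) * ((c * t) ^ k * exp (- mu * \<omega> (c * t)))"
        unfolding exp_add by simp
      also have "\<dots> \<le> exp (mu * L) * moment mu k"
        using assms t mult_mono[of 1 c 1 t] by (intro mult_left_mono moment_ge) auto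
      finally show "t ^ k * exp (- (mu * L) * \<omega> t) \<le> exp (mu * L) * moment mu k / c ^ k"
        using assms by (simp add: pos_le_divide_eq mult.commute)
    qed
    then show "c ^ k * moment (mu * L) k \<le> exp (mu * L) * moment mu k"
      using assms by (simp add: pos_le_divide_eq mult.commute)
  qed auto
qed

text \<open>Absorbs the factor m that appears when x_b^m is differentiated. With A the moment of
  order m, the moment of order m - 1 is at most A^((m-1)/m), while m is at most a constant times
  A^(1/m); the product of the two bounds is A.\<close>

lemma moment_ratio:
  assumes "0 < lam"
  obtains H where "0 < H" "\<And>m. 1 \<le> m \<Longrightarrow> real m * moment lam (m - 1) \<le> H * moment lam m"
proof -
  obtain C where C: "C > 0" "\<And>t. 0 \<le> t \<Longrightarrow> \<omega> t \<le> C * (1 + t)" by (rule om_linear) blast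
  show ?thesis
  proof
    show "0 < exp (2 * lam * C)" by simp
    fix m :: nat assume m: "1 \<le> m"
    define A where "A = moment lam m"
    have A: "A > 0" unfolding A_def by simp
    have m1: "1 / real m + real (m - 1) / real m = 1" using m by (simp add: add_divide_distrib[symmetric])
    have "moment lam (m - 1) \<le> A powr ((m - 1) / m)"
    proof (rule moment_le[OF assms])
      fix t :: real assume t: "1 \<le> t"
      \<comment> \<open>Shrinking the exponent by the factor (m-1)/m makes the expression the power
        (m-1)/m of the one whose supremum is \<open>A\<close>.\<close>
      have "t ^ (m - 1) * exp (- lam * \<omega> t) \<le> t ^ (m - 1) * exp (- lam * \<omega> t * ((m - 1) / m))"
      proof (intro mult_left_mono iffD2[OF exp_le_cancel_iff])
        have "lam * \<omega> t * ((m - 1) / m) \<le> lam * \<omega> t * 1"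
          using assms t om_nonneg[of t] m by (intro mult_left_mono) auto
        then show "- lam * \<omega> t \<le> - lam * \<omega> t * ((m - 1) / m)" by simp
      qed (use t in auto)
      also have "\<dots> = (t powr m * exp (- lam * \<omega> t)) powr ((m - 1) / m)"
      proof -
        have "(t powr m) powr ((m - 1) / m) = t powr real (m - 1)"
          unfolding powr_powr using m by simp
        then have "(t powr m) powr ((m - 1) / m) = t ^ (m - 1)"
          using t by (subst (asm) powr_realpow) auto
        then show ?thesis unfolding powr_mult exp_powr_real by (rule arg_cong2[OF sym refl])
      qed
      also have "\<dots> \<le> A powr ((m - 1) / m)"
        unfolding A_def using t m moment_ge[OF assms t, of m] by (intro powr_mono2) (auto simp: powr_realpow)
      finally show "t ^ (m - 1) * exp (- lam * \<omega> t) \<le> A powr ((m - 1) / m)" .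
    qed
    moreover have "real m * exp (- (2 * lam * C)) \<le> A powr (1 / m)"
    proof -
      \<comment> \<open>The supremum defining \<open>A\<close> is tested at t = m. Linear growth of
        the weight makes the exponential there a geometric factor, and 1 + m \<le> 2 m yields the
        constant 2 lam C.\<close>
      have "lam * \<omega> m \<le> lam * (C * (1 + m))" using assms C(2)[of "real m"] by (intro mult_left_mono) auto
      also have "\<dots> \<le> lam * (C * (2 * m))" using assms C m by (intro mult_left_mono) auto
      finally have "- (2 * lam * C * m) \<le> - lam * \<omega> m" by (simp add: algebra_simps)
      then have "(real m * exp (- (2 * lam * C))) ^ m \<le> real m ^ m * exp (- lam * \<omega> m)"
        by (simp add: power_mult_distrib exp_of_nat_mult[symmetric] mult_left_mono algebra_simps)
      also have "\<dots> \<le> A" unfolding A_def using m by (intro moment_ge assms) auto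
      finally have "((real m * exp (- (2 * lam * C))) powr m) powr (1 / m) \<le> A powr (1 / m)"
        using m by (intro powr_mono2) (auto simp: powr_realpow)
      then show ?thesis using m by (simp add: powr_powr)
    qed
    ultimately have "(real m * exp (- (2 * lam * C))) * moment lam (m - 1) \<le> A powr (1 / m) * A powr ((m - 1) / m)"
      by (intro mult_mono) auto
    also have "\<dots> = A" unfolding powr_add[symmetric] m1 using A by simp
    finally show "real m * moment lam (m - 1) \<le> exp (2 * lam * C) * moment lam m"
      unfolding A_def by (simp add: exp_minus field_simps)
  qed
qed

text \<open>The infimum over \<open>k\<close> is attained near the slope of a supporting line of the convex function
  \<open>t \<mapsto> \<omega> (exp t)\<close> at \<open>ln t\<close>; rounding to an even integer costs the factor \<open>t\<^sup>2\<close>.\<close>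

lemma moment_inf:
  assumes "0 < lam" "1 \<le> t"
  obtains k where "moment lam (2 * k) \<le> t ^ (2 * k) * t\<^sup>2 * exp (- lam * \<omega> t)"
proof -
  define s where "s = ln t"
  have s: "0 \<le> s" "t = exp s" using assms unfolding s_def by auto
  \<comment> \<open>The right derivative of the convex function at \<open>s\<close>, written as an
    infimum of difference quotients; it is the slope of a supporting line.\<close>
  define y where "y = Inf ((\<lambda>r. (\<omega> (exp s) - \<omega> (exp r)) / (s - r)) ` ({s<..} \<inter> UNIV))"
  have y: "\<omega> (exp r) \<ge> \<omega> (exp s) + y * (r - s)" for r
    using convex_le_Inf_differential[OF om_convex, of s r] unfolding y_def by simp
  have "y \<ge> 0"
    using y[of "s - 1"] om_mono[of "exp (s - 1)" "exp s"] by simp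
  define k where "k = nat \<lfloor>lam * y / 2\<rfloor>"
  have k: "2 * real k \<le> lam * y" "lam * y < 2 * real k + 2"
  proof -
    have "0 \<le> lam * y / 2" using assms \<open>y \<ge> 0\<close> by simp
    then have "real k = of_int \<lfloor>lam * y / 2\<rfloor>" unfolding k_def by simp
    then show "2 * real k \<le> lam * y" "lam * y < 2 * real k + 2" by linarith+
  qed
  have "moment lam (2 * k) \<le> t ^ (2 * k) * t\<^sup>2 * exp (- lam * \<omega> t)"
  proof (rule moment_le[OF assms(1)])
    fix \<tau> :: real assume \<tau>: "1 \<le> \<tau>"
    define r where "r = ln \<tau>"
    have r: "0 \<le> r" "\<tau> = exp r" using \<tau> unfolding r_def by auto
    have "lam * (\<omega> (exp s) + y * (r - s)) \<le> lam * \<omega> (exp r)" using y assms by (intro mult_left_mono) auto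
    then have "2 * k * r - lam * \<omega> (exp r) \<le> (2 * k - lam * y) * r + lam * y * s - lam * \<omega> (exp s)"
      by (simp add: algebra_simps)
    also have "\<dots> \<le> lam * y * s - lam * \<omega> (exp s)" using k r by (simp add: mult_nonpos_nonneg)
    also have "\<dots> \<le> (2 * real k + 2) * s - lam * \<omega> (exp s)" using k s by (simp add: mult_right_mono)
    finally have "exp (2 * k * r - lam * \<omega> (exp r)) \<le> exp ((2 * real k + 2) * s - lam * \<omega> (exp s))" by simp
    moreover have "\<tau> ^ (2 * k) * exp (- lam * \<omega> \<tau>) = exp (2 * k * r - lam * \<omega> (exp r))"
      unfolding r(2) exp_of_nat_mult[symmetric] exp_add[symmetric] by simp
    moreover have "t ^ (2 * k) * t\<^sup>2 * exp (- lam * \<omega> t) = exp ((2 * real k + 2) * s - lam * \<omega> (exp s))"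
      unfolding s(2) exp_of_nat_mult[symmetric] exp_add[symmetric] by (simp add: algebra_simps)
    ultimately show "\<tau> ^ (2 * k) * exp (- lam * \<omega> \<tau>) \<le> t ^ (2 * k) * t\<^sup>2 * exp (- lam * \<omega> t)" by simp
  qed
  then show ?thesis by (rule that)
qed

end

section \<open>Fourier transforms\<close>

lemma continuous_imp_borel: "continuous_on UNIV f \<Longrightarrow> f \<in> borel_measurable lborel"
  by (simp add: borel_measurable_continuous_onI)

lemma norm_LINT_le:
  fixes f :: "'a \<Rightarrow> 'b::{banach,second_countable_topology}"
  assumes "integrable M f" "integrable M g" "\<And>x. norm (f x) \<le> g x"
  shows "norm (LINT x|M. f x) \<le> (LINT x|M. g x)"
proof -
  have "norm (LINT x|M. f x) \<le> (LINT x|M. norm (f x))" by (rule integral_norm_bound)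
  also have "\<dots> \<le> (LINT x|M. g x)" using assms by (intro integral_mono) auto
  finally show ?thesis .
qed

lemma integral_lborel_prod:
  fixes f :: "'a::euclidean_space \<Rightarrow> real \<Rightarrow> 'b::{real_normed_field,banach,second_countable_topology}"
  assumes "\<And>b. b \<in> Basis \<Longrightarrow> integrable lborel (f b)"
  shows "integrable lborel (\<lambda>x::'a. \<Prod>b\<in>Basis. f b (x \<bullet> b))"
    and "(LINT x|(lborel :: 'a measure). (\<Prod>b\<in>Basis. f b (x \<bullet> b))) = (\<Prod>b\<in>Basis. (LINT t|lborel. f b t))"
proof -
  interpret product_sigma_finite "\<lambda>_::'a. lborel :: real measure" ..
  have m [measurable]: "f b \<in> borel_measurable borel" if "b \<in> Basis" for b
    using borel_measurable_integrable[OF assms[OF that]] by simp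
  have meas: "(\<lambda>x::'a. \<Prod>b\<in>Basis. f b (x \<bullet> b)) \<in> borel_measurable borel"
    by measurable
  have g: "(\<lambda>h. \<Sum>b\<in>Basis. h b *\<^sub>R b) \<in> (\<Pi>\<^sub>M b\<in>(Basis::'a set). lborel) \<rightarrow>\<^sub>M borel"
    by measurable
  have e: "(\<Prod>b\<in>Basis. f b ((\<Sum>c\<in>Basis. h c *\<^sub>R c) \<bullet> b)) = (\<Prod>b\<in>Basis. f b (h b))" for h :: "'a \<Rightarrow> real"
    by (intro prod.cong refl) simp
  show "integrable lborel (\<lambda>x::'a. \<Prod>b\<in>Basis. f b (x \<bullet> b))"
    unfolding lborel_eq[where 'a='a] integrable_distr_eq[OF g meas] e
    by (intro product_integrable_prod assms) auto
  show "(LINT x|(lborel :: 'a measure). (\<Prod>b\<in>Basis. f b (x \<bullet> b))) = (\<Prod>b\<in>Basis. (LINT t|lborel. f b t))"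
    unfolding lborel_eq[where 'a='a] integral_distr[OF g meas] e
    by (intro product_integral_prod assms) auto
qed

lemma integral_lborel_affine:
  fixes f :: "'a::euclidean_space \<Rightarrow> 'b::{banach,second_countable_topology}"
  assumes "f \<in> borel_measurable lborel" "c \<noteq> 0"
  shows "(LINT x|lborel. f x) = \<bar>c\<bar> ^ DIM('a) *\<^sub>R (LINT x|lborel. f (t + c *\<^sub>R x))"
proof -
  have [measurable]: "f \<in> borel_measurable borel" using assms(1) by simp
  have "(LINT x|lborel. f x) = (LINT x|density (distr lborel borel (\<lambda>x. t + c *\<^sub>R x)) (\<lambda>_. ennreal (\<bar>c\<bar>^DIM('a))). f x)"
    using lborel_affine[OF assms(2), of t] by (simp add: ennreal_power)
  also have "\<dots> = (LINT x|distr lborel borel (\<lambda>x. t + c *\<^sub>R x). \<bar>c\<bar>^DIM('a) *\<^sub>R f x)"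
    by (subst integral_density) auto
  also have "\<dots> = (LINT x|lborel. \<bar>c\<bar>^DIM('a) *\<^sub>R f (t + c *\<^sub>R x))"
    by (subst integral_distr) auto
  finally show ?thesis by simp
qed

lemma integrable_lborel_affine:
  fixes f :: "'a::euclidean_space \<Rightarrow> 'b::{banach,second_countable_topology}"
  assumes "integrable lborel f" "c \<noteq> 0"
  shows "integrable lborel (\<lambda>x. f (t + c *\<^sub>R x))"
proof -
  have [measurable]: "f \<in> borel_measurable borel" using borel_measurable_integrable[OF assms(1)] by simp
  have "integrable (density (distr lborel borel (\<lambda>x. t + c *\<^sub>R x)) (\<lambda>_. ennreal (\<bar>c\<bar>^DIM('a)))) f"
    using assms(1) lborel_affine[OF assms(2), of t] by (simp add: ennreal_power)
  then have "integrable (distr lborel borel (\<lambda>x. t + c *\<^sub>R x)) (\<lambda>x. \<bar>c\<bar>^DIM('a) *\<^sub>R f x)"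
    by (subst (asm) integrable_density) auto
  then have "integrable lborel (\<lambda>x. \<bar>c\<bar>^DIM('a) *\<^sub>R f (t + c *\<^sub>R x))"
    by (subst (asm) integrable_distr_eq) auto
  then have "integrable lborel (\<lambda>x. inverse (\<bar>c\<bar>^DIM('a)) *\<^sub>R \<bar>c\<bar>^DIM('a) *\<^sub>R f (t + c *\<^sub>R x))"
    by (rule integrable_scaleR_right)
  then show ?thesis using assms(2) by simp
qed

lemma integral_lborel_translate:
  fixes f :: "'a::euclidean_space \<Rightarrow> 'b::{banach,second_countable_topology}"
  assumes "f \<in> borel_measurable lborel"
  shows "(LINT x|lborel. f (x + t)) = (LINT x|lborel. f x)"
  using integral_lborel_affine[OF assms, of 1 t] by (simp add: add.commute)

lemma integrable_lborel_translate:
  fixes f :: "'a::euclidean_space \<Rightarrow> 'b::{banach,second_countable_topology}"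
  assumes "integrable lborel f"
  shows "integrable lborel (\<lambda>x. f (x + t))"
  using integrable_lborel_affine[OF assms, of 1 t] by (simp add: add.commute)

lemma integrable_mult_bounded:
  fixes f g :: "'a::euclidean_space \<Rightarrow> complex"
  assumes "integrable lborel f" "g \<in> borel_measurable lborel" "\<And>x. cmod (g x) \<le> B"
  shows "integrable lborel (\<lambda>x. f x * g x)"
proof (rule Bochner_Integration.integrable_bound)
  show "integrable lborel (\<lambda>x. B *\<^sub>R f x)" using assms(1) by (rule integrable_scaleR_right)
  show "(\<lambda>x. f x * g x) \<in> borel_measurable lborel"
    using assms(2) borel_measurable_integrable[OF assms(1)] by (rule borel_measurable_times[rotated])
  have "cmod (f x * g x) \<le> cmod (f x) * \<bar>B\<bar>" for x
    unfolding norm_mult using assms(3)[of x] by (intro mult_left_mono) auto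
  then show "AE x in lborel. cmod (f x * g x) \<le> norm (B *\<^sub>R f x)"
    by (simp add: mult.commute)
qed

lemma exp_char_measurable: "(\<lambda>x::'a::euclidean_space. exp (- \<i> * of_real (x \<bullet> \<xi>))) \<in> borel_measurable lborel"
  by (intro continuous_imp_borel continuous_intros)

lemma norm_exp_char [simp]: "cmod (exp (- (\<i> * of_real t))) = 1"
  by (simp add: norm_exp_eq_Re)

lemma integrable_exp_char:
  fixes f :: "'a::euclidean_space \<Rightarrow> complex"
  assumes "integrable lborel f"
  shows "integrable lborel (\<lambda>x. f x * exp (- \<i> * of_real (x \<bullet> \<xi>)))"
  by (rule integrable_mult_bounded[OF assms exp_char_measurable, where B=1]) simp

lemma norm_fourier_le:
  assumes "integrable lborel f"
  shows "cmod (fourier f \<xi>) \<le> (LINT x|lborel. cmod (f x))"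
proof -
  have "cmod (fourier f \<xi>) \<le> (LINT x|lborel. cmod (f x * exp (- \<i> * of_real (x \<bullet> \<xi>))))"
    unfolding fourier_def by (rule integral_norm_bound)
  then show ?thesis by (simp add: norm_mult)
qed

text \<open>Fubini for f(x) g(xi) exp(-i x.xi), absolutely integrable on the product because the
  exponential has modulus 1.\<close>

lemma fourier_mult:
  fixes f g :: "'a::euclidean_space \<Rightarrow> complex"
  assumes f: "integrable lborel f" and g: "integrable lborel g"
  shows "(LINT \<xi>|lborel. fourier f \<xi> * g \<xi>) = (LINT x|lborel. f x * fourier g x)"
proof -
  have [measurable]: "f \<in> borel_measurable borel" "g \<in> borel_measurable borel"
    using f g by (auto dest: borel_measurable_integrable)
  define F where "F = (\<lambda>x \<xi>. f x * g \<xi> * exp (- \<i> * of_real (x \<bullet> \<xi>)))"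
  have "integrable (lborel \<Otimes>\<^sub>M lborel) (case_prod F)"
  proof (rule lborel_pair.Fubini_integrable)
    have "case_prod F \<in> borel_measurable (borel \<Otimes>\<^sub>M borel)" unfolding F_def by measurable
    then show "case_prod F \<in> borel_measurable (lborel \<Otimes>\<^sub>M lborel)" by (simp cong: measurable_cong_sets)
    have "(\<lambda>x. LINT y|lborel. norm (case_prod F (x, y))) = (\<lambda>x. cmod (f x) * (LINT y|lborel. cmod (g y)))"
      unfolding F_def by (simp add: norm_mult)
    then show "integrable lborel (\<lambda>x. LINT y|lborel. norm (case_prod F (x, y)))"
      using f by simp
    have "integrable lborel (F x)" for x
    proof -
      have "integrable lborel (\<lambda>y. f x * (g y * exp (- \<i> * of_real (y \<bullet> x))))"
        by (intro integrable_mult_right integrable_exp_char g)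
      then show ?thesis unfolding F_def by (simp add: mult.assoc inner_commute)
    qed
    then show "AE x in lborel. integrable lborel (\<lambda>y. case_prod F (x, y))" by simp
  qed
  from lborel_pair.Fubini_integral[OF this]
  have "(LINT y|lborel. LINT x|lborel. F x y) = (LINT x|lborel. LINT y|lborel. F x y)" .
  moreover have "(LINT x|lborel. F x y) = fourier f y * g y" for y
  proof -
    have "(\<lambda>x. F x y) = (\<lambda>x. f x * exp (- \<i> * of_real (x \<bullet> y)) * g y)" unfolding F_def by (auto simp: ac_simps)
    then show ?thesis unfolding fourier_def by simp
  qed
  moreover have "(LINT y|lborel. F x y) = f x * fourier g x" for x
  proof -
    have "F x = (\<lambda>y. f x * (g y * exp (- \<i> * of_real (y \<bullet> x))))" unfolding F_def by (auto simp: ac_simps inner_commute)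
    then show ?thesis unfolding fourier_def by simp
  qed
  ultimately show ?thesis by simp
qed

section \<open>The Gaussian, and Fourier inversion as an inequality\<close>

definition gauss :: "'a::euclidean_space \<Rightarrow> real" where
  "gauss x = (\<Prod>b\<in>Basis. std_normal_density (x \<bullet> b))"

lemma gauss_eq: "gauss (x::'a::euclidean_space) = (1 / sqrt (2 * pi)) ^ DIM('a) * exp (- (x \<bullet> x) / 2)"
proof -
  have "gauss x = (\<Prod>b\<in>Basis. (1 / sqrt (2 * pi)) * exp (- (x \<bullet> b)\<^sup>2 / 2))"
    unfolding gauss_def std_normal_density_def by simp
  also have "\<dots> = (1 / sqrt (2 * pi)) ^ DIM('a) * exp (\<Sum>b\<in>Basis. - (x \<bullet> b)\<^sup>2 / 2)"
    unfolding prod.distrib prod_constant by (simp add: exp_sum)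
  also have "(\<Sum>b\<in>Basis. - (x \<bullet> b)\<^sup>2 / 2) = - (x \<bullet> x) / 2"
    by (simp add: euclidean_inner[of x x] sum_divide_distrib sum_negf power2_eq_square)
  finally show ?thesis .
qed

lemma gauss_le: "gauss (x::'a::euclidean_space) \<le> (1 / sqrt (2 * pi)) ^ DIM('a)" and gauss_pos: "0 < gauss x"
  unfolding gauss_eq by (auto intro!: mult_left_le zero_less_power)

lemma integrable_gauss: "integrable lborel gauss"
  unfolding gauss_def[abs_def] by (intro integral_lborel_prod(1)) simp

lemma fourier_gauss: "fourier (\<lambda>x. of_real (gauss x)) (z::'a::euclidean_space) = of_real (exp (- (z \<bullet> z) / 2))"
proof -
  have 1: "(LINT t|lborel. of_real (std_normal_density t) * exp (- \<i> * of_real (t * s))) = complex_of_real (exp (- s\<^sup>2 / 2))" for s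
  proof -
    \<comment> \<open>\<open>char\<close> integrates against exp(+i s t) and \<open>fourier\<close>
      against exp(-i t s), hence the argument -s.\<close>
    have "complex_of_real (exp (- (- s)\<^sup>2 / 2)) = char std_normal_distribution (- s)"
      unfolding char_std_normal_distribution ..
    also have "\<dots> = (LINT t|lborel. std_normal_density t *\<^sub>R iexp (- s * t))"
      unfolding char_def by (subst integral_density) auto
    also have "\<dots> = (LINT t|lborel. of_real (std_normal_density t) * exp (- \<i> * of_real (t * s)))"
      by (simp add: scaleR_conv_of_real mult.commute)
    finally show ?thesis by simp
  qed
  have 2: "integrable lborel (\<lambda>t. complex_of_real (std_normal_density t) * exp (- \<i> * of_real (t * s)))" for s
    using integrable_exp_char[of "\<lambda>t. complex_of_real (std_normal_density t)" s] by simp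
  have "fourier (\<lambda>x. of_real (gauss x)) z = 
      (LINT x|(lborel :: 'a measure). (\<Prod>b\<in>Basis. of_real (std_normal_density (x \<bullet> b)) * exp (- \<i> * of_real ((x \<bullet> b) * (z \<bullet> b)))))"
  proof -
    have "exp (- \<i> * of_real (x \<bullet> z)) = (\<Prod>b\<in>Basis. exp (- \<i> * complex_of_real ((x \<bullet> b) * (z \<bullet> b))))" for x
      by (subst exp_sum[symmetric]) (simp_all add: euclidean_inner[of x z] sum_distrib_left sum_negf)
    then show ?thesis unfolding fourier_def gauss_def by (simp add: prod.distrib)
  qed
  also have "\<dots> = (\<Prod>b\<in>Basis. complex_of_real (exp (- (z \<bullet> b)\<^sup>2 / 2)))"
    by (subst integral_lborel_prod(2)[OF 2]) (simp only: 1)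
  also have "\<dots> = of_real (exp (\<Sum>b\<in>Basis. - (z \<bullet> b)\<^sup>2 / 2))"
    by (subst exp_sum) auto
  also have "(\<Sum>b\<in>Basis. - (z \<bullet> b)\<^sup>2 / 2) = - (z \<bullet> z) / 2"
    by (simp add: euclidean_inner[of z z] sum_divide_distrib sum_negf power2_eq_square)
  finally show ?thesis .
qed

text \<open>A weak form of Fourier inversion: pairing \<open>fourier f\<close> with a wide Gaussian reproduces \<open>f 0\<close>.\<close>

lemma norm_at_0_le_fourier:
  fixes f :: "'a::euclidean_space \<Rightarrow> complex"
  assumes f: "integrable lborel f" "continuous_on UNIV f" "\<And>x. cmod (f x) \<le> B"
    and F: "integrable lborel (fourier f)"
  shows "cmod (f 0) \<le> (LINT \<xi>|lborel. cmod (fourier f \<xi>))"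
proof -
  define \<kappa> where "\<kappa> = (1 / sqrt (2 * pi)) ^ DIM('a)"
  have \<kappa>: "0 < \<kappa>" "\<kappa> \<le> 1" unfolding \<kappa>_def using pi_gt3 by (auto intro!: power_le_one)
  define I where "I = (LINT \<xi>|lborel. cmod (fourier f \<xi>))"
  have I0: "0 \<le> I" unfolding I_def by simp
  have fm: "f \<in> borel_measurable borel" using borel_measurable_integrable[OF f(1)] by simp
  \<comment> \<open>For small \<open>e\<close> the Gaussian is wide in frequency and its transform
    is concentrated at 0. After the substitution x = e w the factors e^d and e^(-d) cancel, so the
    bound is the same for every \<open>e\<close>.\<close>
  have b: "cmod (LINT w|lborel. f (e *\<^sub>R w) * of_real (exp (- (w \<bullet> w) / 2))) \<le> \<kappa> * I" if e: "0 < e" for e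
  proof -
    define g where "g = (\<lambda>\<xi>::'a. complex_of_real (gauss (e *\<^sub>R \<xi>)))"
    have gi: "integrable lborel (\<lambda>\<xi>::'a. complex_of_real (gauss \<xi>))" by (intro integrable_of_real integrable_gauss)
    have g: "integrable lborel g"
      using integrable_lborel_affine[OF gi, of e 0] e unfolding g_def by simp
    have "fourier g (e *\<^sub>R w) = of_real ((1 / e) ^ DIM('a)) * of_real (exp (- (w \<bullet> w) / 2))" for w
    proof -
      have "fourier g (e *\<^sub>R w) = (LINT \<xi>|lborel. g \<xi> * exp (- \<i> * of_real (\<xi> \<bullet> (e *\<^sub>R w))))" by (simp add: fourier_def)
      also have "\<dots> = \<bar>1 / e\<bar> ^ DIM('a) *\<^sub>R (LINT \<xi>|lborel. g (0 + (1 / e) *\<^sub>R \<xi>) * exp (- \<i> * of_real ((0 + (1 / e) *\<^sub>R \<xi>) \<bullet> (e *\<^sub>R w))))"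
        by (rule integral_lborel_affine[OF borel_measurable_integrable[OF integrable_exp_char[OF g]]]) (use e in simp)
      also have "\<dots> = (1 / e) ^ DIM('a) *\<^sub>R fourier (\<lambda>x. of_real (gauss x)) w"
        using e unfolding fourier_def g_def by simp
      finally show ?thesis unfolding fourier_gauss by (simp add: scaleR_conv_of_real)
    qed
    note fg = this
    have "(LINT x|lborel. f x * fourier g x) = \<bar>e\<bar> ^ DIM('a) *\<^sub>R (LINT w|lborel. f (0 + e *\<^sub>R w) * fourier g (0 + e *\<^sub>R w))"
    proof (rule integral_lborel_affine)
      have "fourier g = (\<lambda>x. of_real ((1 / e) ^ DIM('a)) * of_real (exp (- (((1 / e) *\<^sub>R x) \<bullet> ((1 / e) *\<^sub>R x)) / 2)))"
      proof
        fix x show "fourier g x = of_real ((1 / e) ^ DIM('a)) * of_real (exp (- (((1 / e) *\<^sub>R x) \<bullet> ((1 / e) *\<^sub>R x)) / 2))"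
          using fg[of "(1 / e) *\<^sub>R x"] e by simp
      qed
      moreover have "continuous_on UNIV \<dots>" by (intro continuous_intros) auto
      ultimately have "continuous_on UNIV (fourier g)" by simp
      then show "(\<lambda>x. f x * fourier g x) \<in> borel_measurable lborel"
        by (intro continuous_imp_borel continuous_intros f)
    qed (use e in simp)
    also have "\<dots> = (e ^ DIM('a) * (1 / e) ^ DIM('a)) *\<^sub>R (LINT w|lborel. f (e *\<^sub>R w) * of_real (exp (- (w \<bullet> w) / 2)))"
    proof -
      have "(\<lambda>w. f (e *\<^sub>R w) * fourier g (e *\<^sub>R w)) = (\<lambda>w. (1 / e) ^ DIM('a) *\<^sub>R (f (e *\<^sub>R w) * of_real (exp (- (w \<bullet> w) / 2))))"
        unfolding fg by (simp add: scaleR_conv_of_real ac_simps)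
      then show ?thesis using e by simp
    qed
    also have "\<dots> = (LINT w|lborel. f (e *\<^sub>R w) * of_real (exp (- (w \<bullet> w) / 2)))"
      using e by (simp add: power_mult_distrib[symmetric])
    finally have *: "(LINT w|lborel. f (e *\<^sub>R w) * of_real (exp (- (w \<bullet> w) / 2))) = (LINT \<xi>|lborel. fourier f \<xi> * g \<xi>)"
      unfolding fourier_mult[OF f(1) g] by simp
    have "cmod (LINT \<xi>|lborel. fourier f \<xi> * g \<xi>) \<le> (LINT \<xi>|lborel. cmod (fourier f \<xi> * g \<xi>))"
      by (rule integral_norm_bound)
    also have "\<dots> \<le> (LINT \<xi>|lborel. \<kappa> * cmod (fourier f \<xi>))"
    proof (rule integral_mono)
      have gl: "cmod (g \<xi>) \<le> \<kappa>" for \<xi>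
        unfolding g_def using gauss_le[of "e *\<^sub>R \<xi>"] gauss_pos[of "e *\<^sub>R \<xi>"] unfolding \<kappa>_def by simp
      show "integrable lborel (\<lambda>\<xi>. cmod (fourier f \<xi> * g \<xi>))"
        by (intro integrable_norm integrable_mult_bounded[OF F _ gl] borel_measurable_integrable g)
      show "cmod (fourier f \<xi> * g \<xi>) \<le> \<kappa> * cmod (fourier f \<xi>)" for \<xi>
        unfolding norm_mult using gl[of \<xi>] by (simp add: mult.commute mult_right_mono)
      show "integrable lborel (\<lambda>\<xi>. \<kappa> * cmod (fourier f \<xi>))"
        using F by simp
    qed
    finally show ?thesis unfolding * I_def by simp
  qed
  have gi: "integrable lborel (\<lambda>w::'a. exp (- (w \<bullet> w) / 2))"
  proof -
    have E: "exp (- (w \<bullet> w) / 2) = inverse \<kappa> * gauss w" for w :: 'a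
      unfolding gauss_eq \<kappa>_def[symmetric] using \<kappa> by simp
    show ?thesis unfolding E by (intro integrable_mult_right integrable_gauss)
  qed
  have lim: "(\<lambda>n. LINT w|lborel. f ((1 / real (Suc n)) *\<^sub>R w) * of_real (exp (- (w \<bullet> w) / 2))) \<longlonglongrightarrow>
      (LINT w|(lborel :: 'a measure). f 0 * of_real (exp (- (w \<bullet> w) / 2)))"
  proof (rule integral_dominated_convergence)
    show "(\<lambda>w::'a. f 0 * of_real (exp (- (w \<bullet> w) / 2))) \<in> borel_measurable lborel" by (intro continuous_imp_borel continuous_intros) auto
    show "(\<lambda>w. f ((1 / real (Suc n)) *\<^sub>R w) * of_real (exp (- (w \<bullet> w) / 2))) \<in> borel_measurable lborel" for n
      by (intro continuous_imp_borel continuous_intros continuous_on_compose2[OF f(2)]) auto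
    show "integrable lborel (\<lambda>w::'a. B * exp (- (w \<bullet> w) / 2))" using gi by simp
    show "AE w::'a in lborel. (\<lambda>n. f ((1 / real (Suc n)) *\<^sub>R w) * of_real (exp (- (w \<bullet> w) / 2))) \<longlonglongrightarrow> f 0 * of_real (exp (- (w \<bullet> w) / 2))"
    proof (intro AE_I2 tendsto_mult tendsto_const)
      fix w :: 'a
      have "(\<lambda>n. (1 / real (Suc n)) *\<^sub>R w) \<longlonglongrightarrow> 0 *\<^sub>R w"
        by (intro tendsto_scaleR tendsto_const) (rule LIMSEQ_Suc[OF lim_1_over_n])
      then have "(\<lambda>n. (1 / real (Suc n)) *\<^sub>R w) \<longlonglongrightarrow> 0" by simp
      then show "(\<lambda>n. f ((1 / real (Suc n)) *\<^sub>R w)) \<longlonglongrightarrow> f 0"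
        by (rule continuous_on_tendsto_compose[OF f(2)]) auto
    qed
    show "AE w::'a in lborel. norm (f ((1 / real (Suc n)) *\<^sub>R w) * of_real (exp (- (w \<bullet> w) / 2))) \<le> B * exp (- (w \<bullet> w) / 2)" for n
      using f(3) by (auto simp: norm_mult intro!: mult_right_mono)
  qed
  have "cmod (LINT w|(lborel :: 'a measure). f 0 * of_real (exp (- (w \<bullet> w) / 2))) \<le> \<kappa> * I"
    by (rule LIMSEQ_le_const2[OF tendsto_norm[OF lim]]) (use b in auto)
  moreover have "(LINT w|(lborel :: 'a measure). complex_of_real (exp (- (w \<bullet> w) / 2))) = of_real (1 / \<kappa>)"
  proof -
    have "complex_of_real (\<kappa> * exp (- (w \<bullet> w) / 2)) = of_real (gauss w) * exp (- \<i> * of_real (w \<bullet> 0))" for w :: 'a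
      unfolding gauss_eq \<kappa>_def by simp
    then have "(LINT w|(lborel :: 'a measure). complex_of_real (\<kappa> * exp (- (w \<bullet> w) / 2))) = 1"
      using fourier_gauss[of "0::'a"] unfolding fourier_def by simp
    then have "of_real \<kappa> * (LINT w|(lborel :: 'a measure). complex_of_real (exp (- (w \<bullet> w) / 2))) = 1"
      by (simp del: integral_complex_of_real)
    then show ?thesis using \<kappa> by (simp add: field_simps del: integral_complex_of_real)
  qed
  \<comment> \<open>\<kappa> enters twice, as the height of the Gaussian and through the integral 1
    / \<kappa> of its unnormalised form. Their product is the (2 pi)^(-d) of the inversion formula,
    estimated here by 1.\<close>
  ultimately have "cmod (f 0) / \<kappa> \<le> \<kappa> * I"
    using \<kappa> by (simp add: norm_mult norm_divide del: integral_complex_of_real)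
  also have "\<dots> \<le> 1 * I" using \<kappa> I0 by (intro mult_right_mono) auto
  finally have 1: "cmod (f 0) / \<kappa> \<le> I" by simp
  have "cmod (f 0) * 1 \<le> cmod (f 0) * (1 / \<kappa>)" using \<kappa> by (intro mult_left_mono) auto
  then show ?thesis using 1 unfolding I_def by simp
qed

text \<open>Translating \<open>f\<close> multiplies its transform by a factor of modulus 1, so the
  bound at 0 holds at every point.\<close>

lemma norm_le_fourier:
  fixes f :: "'a::euclidean_space \<Rightarrow> complex"
  assumes f: "integrable lborel f" "continuous_on UNIV f" "\<And>x. cmod (f x) \<le> B"
    and F: "integrable lborel (fourier f)"
  shows "cmod (f x) \<le> (LINT \<xi>|lborel. cmod (fourier f \<xi>))"
proof -
  define g where "g = (\<lambda>y. f (y + x))"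
  have g: "fourier g \<xi> = fourier f \<xi> * exp (- \<i> * of_real (- x \<bullet> \<xi>))" for \<xi>
  proof -
    have "fourier g \<xi> = (LINT y|lborel. (f (y + x) * exp (- \<i> * of_real ((y + x) \<bullet> \<xi>))) * exp (- \<i> * of_real (- x \<bullet> \<xi>)))"
      unfolding fourier_def g_def by (simp add: mult.assoc exp_add[symmetric] inner_simps algebra_simps)
    also have "\<dots> = (LINT y|lborel. (f (y + x) * exp (- \<i> * of_real ((y + x) \<bullet> \<xi>)))) * exp (- \<i> * of_real (- x \<bullet> \<xi>))"
      by simp
    also have "(LINT y|lborel. (f (y + x) * exp (- \<i> * of_real ((y + x) \<bullet> \<xi>)))) = fourier f \<xi>"
      unfolding fourier_def 
      by (rule integral_lborel_translate[OF borel_measurable_integrable[OF integrable_exp_char[OF f(1)]]])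
    finally show ?thesis .
  qed
  have "cmod (g 0) \<le> (LINT \<xi>|lborel. cmod (fourier g \<xi>))"
  proof (rule norm_at_0_le_fourier)
    show "integrable lborel g" unfolding g_def by (rule integrable_lborel_translate[OF f(1)])
    show "continuous_on UNIV g" unfolding g_def by (intro continuous_on_compose2[OF f(2)] continuous_intros) auto
    show "cmod (g y) \<le> B" for y unfolding g_def by (rule f(3))
    have "fourier g = (\<lambda>\<xi>. fourier f \<xi> * exp (- \<i> * of_real (\<xi> \<bullet> (- x))))" by (intro ext) (simp only: g inner_commute)
    then show "integrable lborel (fourier g)" using integrable_exp_char[OF F, of "- x"] by simp
  qed
  then show ?thesis unfolding g by (simp add: g_def norm_mult norm_exp_eq_Re)
qed

text \<open>Avoids boundary terms: h(x + b) - h(x) has integral 0 by translation invariance, and it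
  is i times the integral of h'(x + s b) over s in [0, 1]. After Fubini the inner integral over x
  does not depend on s, so it vanishes.\<close>

lemma integral_D_eq_0:
  fixes h :: "'a::euclidean_space \<Rightarrow> complex"
  assumes D: "has_D b h h'" and c: "continuous_on UNIV h'" and h: "integrable lborel h" and h': "integrable lborel h'"
  shows "(LINT x|lborel. h' x) = 0"
proof -
  define F where "F = (\<lambda>x s. indicator {0..1::real} s *\<^sub>R h' (x + s *\<^sub>R b))"
  have [measurable]: "h' \<in> borel_measurable borel" using c by (simp add: borel_measurable_continuous_onI)
  have Fm: "(\<lambda>(s, x). F x s) \<in> borel_measurable (lborel \<Otimes>\<^sub>M lborel)"
  proof -
    have "(\<lambda>(s, x). F x s) \<in> borel_measurable (borel \<Otimes>\<^sub>M borel)" unfolding F_def by measurable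
    then show ?thesis by (simp cong: measurable_cong_sets)
  qed
  have "integrable (lborel \<Otimes>\<^sub>M lborel) (\<lambda>(s, x). F x s)"
  proof (rule lborel_pair.Fubini_integrable[OF Fm])
    have "(LINT x|lborel. norm (F x s)) = indicator {0..1} s *\<^sub>R (LINT x|lborel. norm (h' x))" for s
      using integral_lborel_translate[of "\<lambda>x. norm (h' x)" "s *\<^sub>R b"] unfolding F_def by simp
    moreover have "integrable lborel (\<lambda>s. indicator {0..1::real} s *\<^sub>R (LINT x|lborel. norm (h' x)))"
      by (intro integrable_scaleR_left integrable_real_indicator) auto
    ultimately show "integrable lborel (\<lambda>s. LINT x|lborel. norm (case (s, x) of (s, x) \<Rightarrow> F x s))" by simp
    show "AE s in lborel. integrable lborel (\<lambda>x. case (s, x) of (s, x) \<Rightarrow> F x s)"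
      unfolding F_def by (auto intro!: integrable_scaleR_right integrable_lborel_translate h')
  qed
  from lborel_pair.Fubini_integral[OF this]
  have "(LINT x|lborel. LINT s|lborel. F x s) = (LINT s|lborel. LINT x|lborel. F x s)" .
  moreover have "(LINT x|lborel. F x s) = indicator {0..1} s *\<^sub>R (LINT x|lborel. h' x)" for s
    using integral_lborel_translate[of h' "s *\<^sub>R b"] unfolding F_def by simp
  moreover have "(LINT s|lborel. F x s) = (h (x + b) - h x) / \<i>" for x
  proof -
    have "((\<lambda>s. \<i> * h' (x + s *\<^sub>R b)) has_integral h (x + 1 *\<^sub>R b) - h (x + 0 *\<^sub>R b)) {0..1}"
      by (intro fundamental_theorem_of_calculus has_D_at[OF D]) auto
    then have "((\<lambda>s. \<i> * h' (x + s *\<^sub>R b)) has_integral h (x + b) - h x) {0..1}" by simp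
    then have "integral {0..1} (\<lambda>s. \<i> * h' (x + s *\<^sub>R b)) = h (x + b) - h x" by (rule integral_unique)
    moreover have "(LINT s|lborel. indicator {0..1} s *\<^sub>R (\<i> * h' (x + s *\<^sub>R b))) = integral {0..1} (\<lambda>s. \<i> * h' (x + s *\<^sub>R b))"
      unfolding set_lebesgue_integral_def[symmetric]
      by (intro set_borel_integral_eq_integral(2) borel_integrable_atLeastAtMost' continuous_intros
         continuous_on_compose2[OF c]) auto
    moreover have "(\<lambda>s. indicator {0..1} s *\<^sub>R (\<i> * h' (x + s *\<^sub>R b))) = (\<lambda>s. \<i> * F x s)" unfolding F_def by auto
    ultimately have "\<i> * (LINT s|lborel. F x s) = h (x + b) - h x" by simp
    then show ?thesis by (metis complex_i_not_zero nonzero_mult_div_cancel_left)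
  qed
  moreover have "(LINT x|lborel. (h (x + b) - h x) / \<i>) = 0"
  proof -
    have "(LINT x|lborel. h (x + b) - h x) = (LINT x|lborel. h (x + b)) - (LINT x|lborel. h x)"
      by (intro Bochner_Integration.integral_diff integrable_lborel_translate h)
    also have "\<dots> = 0" using integral_lborel_translate[OF borel_measurable_integrable[OF h], of b] by simp
    finally show ?thesis by simp
  qed
  ultimately show ?thesis by simp
qed

lemma has_D_exp_char:
  "has_D b (\<lambda>x::'a::euclidean_space. exp (- \<i> * of_real (x \<bullet> \<xi>))) (\<lambda>x. - of_real (\<xi> \<bullet> b) * exp (- \<i> * of_real (x \<bullet> \<xi>)))"
  unfolding has_D_def
proof
  fix x
  have "((\<lambda>z. exp (- \<i> * (of_real (x \<bullet> \<xi>) + z * of_real (b \<bullet> \<xi>)))) has_field_derivative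
     exp (- \<i> * (of_real (x \<bullet> \<xi>) + of_real 0 * of_real (b \<bullet> \<xi>))) * (- \<i> * of_real (b \<bullet> \<xi>))) (at (of_real 0))"
    by (auto intro!: derivative_eq_intros)
  from has_vector_derivative_real_field[OF this, where s=UNIV]
  show "((\<lambda>t. exp (- \<i> * of_real ((x + t *\<^sub>R b) \<bullet> \<xi>))) has_vector_derivative
     \<i> * (- of_real (\<xi> \<bullet> b) * exp (- \<i> * of_real (x \<bullet> \<xi>)))) (at 0)"
    by (simp add: inner_simps inner_commute algebra_simps)
qed

text \<open>\<open>integral_D_eq_0\<close> applied to \<open>f\<close> times the character; the
  product rule supplies both terms of the identity.\<close>

lemma fourier_D:
  fixes f :: "'a::euclidean_space \<Rightarrow> complex"
  assumes D: "has_D b f g" and c: "continuous_on UNIV f" "continuous_on UNIV g" 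
    and i: "integrable lborel f" "integrable lborel g"
  shows "fourier g \<xi> = of_real (\<xi> \<bullet> b) * fourier f \<xi>"
proof -
  let ?e = "\<lambda>x. exp (- \<i> * of_real (x \<bullet> \<xi>))"
  have i1: "integrable lborel (\<lambda>x. of_real (\<xi> \<bullet> b) * (f x * ?e x))"
    by (intro integrable_mult_right integrable_exp_char i)
  have "(LINT x|lborel. g x * ?e x - of_real (\<xi> \<bullet> b) * (f x * ?e x)) = 0"
  proof (rule integral_D_eq_0)
    show "has_D b (\<lambda>x. f x * ?e x) (\<lambda>x. g x * ?e x - of_real (\<xi> \<bullet> b) * (f x * ?e x))"
      by (rule has_D_cong[OF has_D_mult[OF D has_D_exp_char]]) (simp add: algebra_simps)
    show "continuous_on UNIV (\<lambda>x. g x * ?e x - of_real (\<xi> \<bullet> b) * (f x * ?e x))"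
      by (intro continuous_intros c)
    show "integrable lborel (\<lambda>x. f x * ?e x)" by (intro integrable_exp_char i)
    show "integrable lborel (\<lambda>x. g x * ?e x - of_real (\<xi> \<bullet> b) * (f x * ?e x))"
      by (intro Bochner_Integration.integrable_diff i1 integrable_exp_char i)
  qed
  moreover have "(LINT x|lborel. g x * ?e x - of_real (\<xi> \<bullet> b) * (f x * ?e x)) = fourier g \<xi> - of_real (\<xi> \<bullet> b) * fourier f \<xi>"
    unfolding fourier_def Bochner_Integration.integral_diff[OF integrable_exp_char[OF i(2)] i1] by simp
  ultimately show ?thesis by simp
qed

text \<open>The criterion by which transforms, the kernel in its second variable and the extended
  operator are differentiated: an estimate of the remainder takes the place of an interchange of
  limits.\<close>

lemma has_vector_derivative_quadratic_error:
  fixes f :: "real \<Rightarrow> complex"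
  assumes "\<And>t. cmod (f t - f 0 - t *\<^sub>R d) \<le> M * t\<^sup>2"
  shows "(f has_vector_derivative d) (at 0)"
proof -
  have M: "0 \<le> M" using order_trans[OF norm_ge_zero assms[of 1]] by simp
  have "((\<lambda>t. (1 / \<bar>t\<bar>) *\<^sub>R (f t - f 0 - t *\<^sub>R d)) \<longlongrightarrow> 0) (at 0)"
  proof (rule Lim_null_comparison)
    show "((\<lambda>t. M * \<bar>t\<bar>) \<longlongrightarrow> 0) (at 0)" by (auto intro!: tendsto_eq_intros)
    have "norm ((1 / \<bar>t\<bar>) *\<^sub>R (f t - f 0 - t *\<^sub>R d)) \<le> M * \<bar>t\<bar>" for t
    proof (cases "t = 0")
      case False
      have "norm ((1 / \<bar>t\<bar>) *\<^sub>R (f t - f 0 - t *\<^sub>R d)) = cmod (f t - f 0 - t *\<^sub>R d) / \<bar>t\<bar>"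
        by simp
      also have "\<dots> \<le> M * t\<^sup>2 / \<bar>t\<bar>" using assms by (intro divide_right_mono) auto
      also have "M * t\<^sup>2 = (M * \<bar>t\<bar>) * \<bar>t\<bar>" by (simp add: power2_eq_square)
      also have "\<dots> / \<bar>t\<bar> = M * \<bar>t\<bar>" using False by (simp only: nonzero_mult_div_cancel_right abs_eq_0 simp_thms)
      finally show ?thesis .
    qed (use M in auto)
    then show "\<forall>\<^sub>F t in at 0. norm ((1 / \<bar>t\<bar>) *\<^sub>R (f t - f 0 - t *\<^sub>R d)) \<le> M * \<bar>t\<bar>" by simp
  qed
  then show ?thesis
    unfolding has_vector_derivative_def has_derivative_within
    by (simp add: bounded_linear_scaleR_left diff_diff_eq)
qed

section \<open>Continuity and differentiability of the Fourier transform\<close>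

lemma integrable_norm_power:
  fixes f :: "'a::euclidean_space \<Rightarrow> complex"
  assumes "f \<in> borel_measurable lborel" "integrable lborel (\<lambda>x. (1 + norm x) ^ 2 * cmod (f x))" "k \<le> 2"
  shows "integrable lborel (\<lambda>x. norm x ^ k * cmod (f x))"
proof (rule Bochner_Integration.integrable_bound[OF assms(2)])
  have [measurable]: "f \<in> borel_measurable borel" using assms(1) by simp
  show "(\<lambda>x. norm x ^ k * cmod (f x)) \<in> borel_measurable lborel" by simp
  have "norm x ^ k \<le> (1 + norm x) ^ 2" for x :: 'a
  proof -
    have "norm x ^ k \<le> (1 + norm x) ^ k" by (intro power_mono) auto
    also have "\<dots> \<le> (1 + norm x) ^ 2" using assms(3) by (intro power_increasing) auto
    finally show ?thesis .
  qed
  then show "AE x in lborel. norm (norm x ^ k * cmod (f x)) \<le> norm ((1 + norm x)\<^sup>2 * cmod (f x))"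
    by (auto simp: abs_mult intro!: AE_I2 mult_right_mono)
qed

text \<open>The transform is Lipschitz, with the first absolute moment of \<open>f\<close> as
  constant.\<close>

lemma fourier_continuous:
  fixes f :: "'a::euclidean_space \<Rightarrow> complex"
  assumes f: "integrable lborel f" "integrable lborel (\<lambda>x. (1 + norm x) ^ 2 * cmod (f x))"
  shows "continuous_on UNIV (fourier f)"
proof -
  define A where "A = (LINT x|lborel. norm x ^ 1 * cmod (f x))"
  note fm = borel_measurable_integrable[OF f(1)]
  have i: "integrable lborel (\<lambda>x. norm x ^ 1 * cmod (f x))" by (rule integrable_norm_power[OF fm f(2)]) simp
  have A: "0 \<le> A" unfolding A_def by (intro integral_nonneg_AE) auto
  have "cmod (fourier f \<eta> - fourier f \<xi>) \<le> A * norm (\<eta> - \<xi>)" for \<eta> \<xi>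
  proof -
    have "fourier f \<eta> - fourier f \<xi> = (LINT x|lborel. f x * exp (- \<i> * of_real (x \<bullet> \<eta>)) - f x * exp (- \<i> * of_real (x \<bullet> \<xi>)))"
      unfolding fourier_def by (rule Bochner_Integration.integral_diff[symmetric]) (intro integrable_exp_char f)+
    also have "cmod \<dots> \<le> (LINT x|lborel. norm (\<eta> - \<xi>) * (norm x ^ 1 * cmod (f x)))"
    proof (rule norm_LINT_le)
      show "integrable lborel (\<lambda>x. f x * exp (- \<i> * of_real (x \<bullet> \<eta>)) - f x * exp (- \<i> * of_real (x \<bullet> \<xi>)))"
        by (intro Bochner_Integration.integrable_diff integrable_exp_char f)
      show "integrable lborel (\<lambda>x. norm (\<eta> - \<xi>) * (norm x ^ 1 * cmod (f x)))" using i by simp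
      fix x
      have "exp (- \<i> * of_real (x \<bullet> \<eta>)) - exp (- \<i> * of_real (x \<bullet> \<xi>)) = 
         exp (- \<i> * of_real (x \<bullet> \<xi>)) * (iexp (x \<bullet> (\<xi> - \<eta>)) - 1)"
        by (simp add: inner_simps algebra_simps exp_add[symmetric] exp_diff[symmetric])
      then have "f x * exp (- \<i> * of_real (x \<bullet> \<eta>)) - f x * exp (- \<i> * of_real (x \<bullet> \<xi>)) =
         f x * (exp (- \<i> * of_real (x \<bullet> \<xi>)) * (iexp (x \<bullet> (\<xi> - \<eta>)) - 1))"
        by (simp add: right_diff_distrib[symmetric] del: mult_minus_left)
      moreover have "cmod (iexp (x \<bullet> (\<xi> - \<eta>)) - 1) \<le> norm x * norm (\<eta> - \<xi>)"
      proof -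
        have "cmod (iexp (x \<bullet> (\<xi> - \<eta>)) - 1) \<le> \<bar>x \<bullet> (\<xi> - \<eta>)\<bar>"
          using iexp_approx1[of "x \<bullet> (\<xi> - \<eta>)" 0] by simp
        also have "\<dots> \<le> norm x * norm (\<eta> - \<xi>)" using Cauchy_Schwarz_ineq2[of x "\<xi> - \<eta>"] by (simp add: norm_minus_commute)
        finally show ?thesis .
      qed
      from mult_left_mono[OF this norm_ge_zero[of "f x"]] 
      have "cmod (f x) * cmod (iexp (x \<bullet> (\<xi> - \<eta>)) - 1) \<le> norm (\<eta> - \<xi>) * (norm x ^ 1 * cmod (f x))"
        by (simp add: ac_simps)
      ultimately show "norm (f x * exp (- \<i> * of_real (x \<bullet> \<eta>)) - f x * exp (- \<i> * of_real (x \<bullet> \<xi>))) \<le> norm (\<eta> - \<xi>) * (norm x ^ 1 * cmod (f x))"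
        by (simp add: norm_mult)
    qed
    also have "\<dots> = A * norm (\<eta> - \<xi>)" unfolding A_def by simp
    finally show ?thesis .
  qed
  then have "A-lipschitz_on UNIV (fourier f)" using A by (auto simp: lipschitz_on_def dist_norm)
  then show ?thesis by (rule lipschitz_on_continuous_on)
qed

text \<open>The second order remainder of exp(i theta) is at most theta^2, so the remainder of the
  transform is at most t^2 times the second absolute moment of \<open>f\<close>.\<close>

lemma has_D_fourier:
  fixes f :: "'a::euclidean_space \<Rightarrow> complex"
  assumes f: "integrable lborel f" "integrable lborel (\<lambda>x. (1 + norm x) ^ 2 * cmod (f x))" and b: "b \<in> Basis"
  shows "has_D b (fourier f) (fourier (\<lambda>x. - (of_real (x \<bullet> b) * f x)))"
  unfolding has_D_def
proof
  fix \<xi>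
  note fm = borel_measurable_integrable[OF f(1)]
  have [measurable]: "f \<in> borel_measurable borel" using fm by simp
  define A where "A = (LINT x|lborel. norm x ^ 2 * cmod (f x))"
  have i2: "integrable lborel (\<lambda>x. norm x ^ 2 * cmod (f x))" by (rule integrable_norm_power[OF fm f(2)]) simp
  have i1: "integrable lborel (\<lambda>x. norm x ^ 1 * cmod (f x))" by (rule integrable_norm_power[OF fm f(2)]) simp
  define g where "g = (\<lambda>x. - (of_real (x \<bullet> b) * f x))"
  have g: "integrable lborel g"
  proof (rule Bochner_Integration.integrable_bound[OF i1])
    show "g \<in> borel_measurable lborel" unfolding g_def by simp
    show "AE x in lborel. norm (g x) \<le> norm (norm x ^ 1 * cmod (f x))"
      unfolding g_def using Basis_le_norm[OF b] by (auto simp: norm_mult intro!: AE_I2 mult_right_mono)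
  qed
  show "((\<lambda>t. fourier f (\<xi> + t *\<^sub>R b)) has_vector_derivative \<i> * fourier g \<xi>) (at 0)"
  proof (rule has_vector_derivative_quadratic_error[where M=A])
    fix t :: real
    let ?e = "\<lambda>x. exp (- \<i> * of_real (x \<bullet> \<xi>))"
    let ?e' = "\<lambda>x. exp (- \<i> * of_real (x \<bullet> (\<xi> + t *\<^sub>R b)))"
    let ?r = "\<lambda>x. f x * ?e' x - f x * ?e x - (of_real t * \<i>) * (g x * ?e x)"
    have "fourier f (\<xi> + t *\<^sub>R b) - fourier f (\<xi> + 0 *\<^sub>R b) - t *\<^sub>R (\<i> * fourier g \<xi>) = (LINT x|lborel. ?r x)"
      unfolding fourier_def
      by (subst Bochner_Integration.integral_diff Bochner_Integration.integral_diff, 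
        (intro Bochner_Integration.integrable_diff integrable_mult_right integrable_exp_char f g)+)+ 
         (simp add: scaleR_conv_of_real mult.assoc)
    also have "cmod \<dots> \<le> (LINT x|lborel. t\<^sup>2 * (norm x ^ 2 * cmod (f x)))"
    proof (rule norm_LINT_le)
      show "integrable lborel ?r"
        by (intro Bochner_Integration.integrable_diff integrable_mult_right integrable_exp_char f g)
      show "integrable lborel (\<lambda>x. t\<^sup>2 * (norm x ^ 2 * cmod (f x)))" using i2 by simp
      fix x
      let ?\<theta> = "- (t * (x \<bullet> b))"
      have e': "?e' x = ?e x * iexp ?\<theta>" by (simp add: inner_simps algebra_simps exp_add[symmetric])
      have "?r x = f x * ?e x * (iexp ?\<theta> - 1 - \<i> * of_real ?\<theta>)"
        unfolding e' g_def by (simp add: algebra_simps)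
      moreover have "cmod (iexp ?\<theta> - 1 - \<i> * of_real ?\<theta>) \<le> t\<^sup>2 * norm x ^ 2"
      proof -
        have "cmod (iexp ?\<theta> - 1 - \<i> * of_real ?\<theta>) \<le> \<bar>?\<theta>\<bar> ^ 2 / 2"
          using iexp_approx1[of ?\<theta> 1] by (simp add: numeral_2_eq_2 diff_diff_eq2 algebra_simps)
        also have "\<dots> \<le> \<bar>?\<theta>\<bar> ^ 2" by simp
        also have "\<dots> = t\<^sup>2 * \<bar>x \<bullet> b\<bar> ^ 2" by (simp add: power_mult_distrib)
        also have "\<dots> \<le> t\<^sup>2 * norm x ^ 2" using Basis_le_norm[OF b] by (intro mult_left_mono power_mono) auto
        finally show ?thesis .
      qed
      ultimately show "norm (?r x) \<le> t\<^sup>2 * (norm x ^ 2 * cmod (f x))"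
        by (simp add: norm_mult mult_left_mono ac_simps)
    qed
    also have "\<dots> = A * t\<^sup>2" unfolding A_def by simp
    finally show "cmod (fourier f (\<xi> + t *\<^sub>R b) - fourier f (\<xi> + 0 *\<^sub>R b) - t *\<^sub>R (\<i> * fourier g \<xi>)) \<le> A * t\<^sup>2" .
  qed
qed

context weight begin

section \<open>Integrability from decay\<close>

lemma om_norm_borel: "(\<lambda>x::'a::euclidean_space. \<omega> (norm x)) \<in> borel_measurable borel"
  by (intro borel_measurable_continuous_onI om_norm_cont)

text \<open>The product of 1 + x_b^2 over the coordinates is at most (1 + |x|)^(2d), and its
  reciprocal is integrable as a product of functions of one variable. \<open>om_poly\<close> with
  exponent N + 2d compares the integrand with that reciprocal.\<close>

lemma integrable_weight:
  assumes "0 < lam"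
  shows "integrable lborel (\<lambda>x::'a::euclidean_space. (1 + norm x) ^ N * exp (- lam * \<omega> (norm x)))"
proof -
  obtain C where C: "C > 0" "\<And>t. 0 \<le> t \<Longrightarrow> (1 + t) ^ (N + 2 * DIM('a)) \<le> C * exp (lam * \<omega> t)"
    using om_poly[OF assms] by blast
  have i1: "integrable lborel (\<lambda>t::real. inverse (1 + t\<^sup>2))"
    using integrable_inverse_1_plus_square by (simp add: set_integrable_def)
  have i: "integrable lborel (\<lambda>x::'a. C * (\<Prod>b\<in>Basis. inverse (1 + (x \<bullet> b)\<^sup>2)))"
    by (intro integrable_mult_right integral_lborel_prod(1)[OF i1])
  show ?thesis
  proof (rule Bochner_Integration.integrable_bound[OF i])
    show "(\<lambda>x::'a. (1 + norm x) ^ N * exp (- lam * \<omega> (norm x))) \<in> borel_measurable lborel"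
    proof -
      note [measurable] = om_norm_borel
      have "(\<lambda>x::'a. (1 + norm x) ^ N * exp (- lam * \<omega> (norm x))) \<in> borel_measurable borel" by measurable
      then show ?thesis by simp
    qed
    have "(1 + norm x) ^ N * exp (- lam * \<omega> (norm x)) \<le> C * (\<Prod>b\<in>Basis. inverse (1 + (x \<bullet> b)\<^sup>2))" for x :: 'a
    proof -
      have "(\<Prod>b\<in>Basis. 1 + (x \<bullet> b)\<^sup>2) \<le> (\<Prod>b\<in>(Basis::'a set). (1 + norm x)\<^sup>2)"
      proof (intro prod_mono conjI)
        fix b :: 'a assume b: "b \<in> Basis"
        have "(x \<bullet> b)\<^sup>2 \<le> (norm x)\<^sup>2" using Basis_le_norm[OF b, of x] by (simp add: abs_le_square_iff[symmetric])
        then show "1 + (x \<bullet> b)\<^sup>2 \<le> (1 + norm x)\<^sup>2" using norm_ge_zero[of x] unfolding power2_sum by (simp del: norm_ge_zero)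
      qed auto
      also have "\<dots> = (1 + norm x) ^ (2 * DIM('a))" by (simp add: power_mult)
      finally have p: "(\<Prod>b\<in>Basis. 1 + (x \<bullet> b)\<^sup>2) \<le> (1 + norm x) ^ (2 * DIM('a))" .
      have pos: "0 < (\<Prod>b\<in>Basis. 1 + (x \<bullet> b)\<^sup>2)" by (intro prod_pos) (simp add: add_pos_nonneg)
      have "(1 + norm x) ^ N * (\<Prod>b\<in>Basis. 1 + (x \<bullet> b)\<^sup>2) \<le> (1 + norm x) ^ N * (1 + norm x) ^ (2 * DIM('a))"
        using p by (intro mult_left_mono) auto
      also have "\<dots> \<le> C * exp (lam * \<omega> (norm x))" unfolding power_add[symmetric] by (rule C(2)) simp
      finally show ?thesis using pos by (simp add: exp_minus field_simps prod_dividef prod_inversef[unfolded o_def, symmetric])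
    qed
    moreover have "0 \<le> (\<Prod>b\<in>Basis. inverse (1 + (x \<bullet> b)\<^sup>2))" for x :: 'a by (intro prod_nonneg) simp
    ultimately show "AE x::'a in lborel. norm ((1 + norm x) ^ N * exp (- lam * \<omega> (norm x))) \<le> norm (C * (\<Prod>b\<in>Basis. inverse (1 + (x \<bullet> b)\<^sup>2)))"
      using C(1) by (auto simp: abs_mult)
  qed
qed

lemma integrable_decay:
  fixes f :: "'a::euclidean_space \<Rightarrow> complex"
  assumes "0 < lam" "f \<in> borel_measurable lborel" "\<And>x. cmod (f x) \<le> C * exp (- lam * \<omega> (norm x))"
  shows "integrable lborel f" "integrable lborel (\<lambda>x. (1 + norm x) ^ N * cmod (f x))"
proof -
  have [measurable]: "f \<in> borel_measurable borel" using assms(2) by simp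
  have b: "(1 + norm x) ^ N * cmod (f x) \<le> C * ((1 + norm x) ^ N * exp (- lam * \<omega> (norm x)))" for x N
    using mult_left_mono[OF assms(3)[of x], of "(1 + norm x) ^ N"] by (simp add: ac_simps)
  have *: "integrable lborel (\<lambda>x. (1 + norm x) ^ N * cmod (f x))" for N
  proof (rule Bochner_Integration.integrable_bound)
    show "integrable lborel (\<lambda>x::'a. C * ((1 + norm x) ^ N * exp (- lam * \<omega> (norm x))))"
      using integrable_weight[OF assms(1)] by (rule integrable_mult_right)
    show "(\<lambda>x. (1 + norm x) ^ N * cmod (f x)) \<in> borel_measurable lborel" by simp
    show "AE x in lborel. norm ((1 + norm x) ^ N * cmod (f x)) \<le> norm (C * ((1 + norm x) ^ N * exp (- lam * \<omega> (norm x))))"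
      using order_trans[OF b abs_ge_self] by (auto simp: abs_mult)
  qed
  show "integrable lborel (\<lambda>x. (1 + norm x) ^ N * cmod (f x))" by (rule *)
  show "integrable lborel f" using *[of 0] integrable_norm_iff[OF assms(2)] by simp
qed

end

section \<open>Ultradifferentiable decay and the Fourier transform\<close>

text \<open>Allows powers of |x| to be replaced by powers of a single coordinate, chosen according
  to the point.\<close>

lemma coord_ge:
  fixes x :: "'a::euclidean_space"
  obtains b where "b \<in> Basis" "norm x \<le> DIM('a) * \<bar>x \<bullet> b\<bar>"
proof -
  have "\<exists>b\<in>Basis. norm x \<le> DIM('a) * \<bar>x \<bullet> b\<bar>"
  proof (rule ccontr)
    assume "\<not> (\<exists>b\<in>Basis. norm x \<le> DIM('a) * \<bar>x \<bullet> b\<bar>)"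
    then have *: "DIM('a) * \<bar>x \<bullet> b\<bar> < norm x" if "b \<in> Basis" for b
      using that by (simp add: not_le)
    have "DIM('a) * norm x \<le> DIM('a) * (\<Sum>b\<in>Basis. \<bar>x \<bullet> b\<bar>)"
      by (intro mult_left_mono norm_le_l1) auto
    also have "\<dots> = (\<Sum>b\<in>Basis. DIM('a) * \<bar>x \<bullet> b\<bar>)" by (simp add: sum_distrib_left)
    also have "\<dots> < (\<Sum>b\<in>(Basis::'a set). norm x)" by (intro sum_strict_mono *) auto
    finally show False by simp
  qed
  then show ?thesis using that by blast
qed

context weight begin

text \<open>Dividing the bound of order 2k by t^(2k) and choosing k as in \<open>moment_inf\<close>
  returns the exponential of the weight at t, up to t^2. The constants precede \<open>t\<close>,
  \<open>s\<close> and \<open>A\<close>, so the result applies uniformly in points and derivatives.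
  Here \<open>t\<close> is the modulus of a coordinate, or half of it, and \<open>s\<close> the
  norm.\<close>

lemma decay_from_moments:
  assumes lam: "0 < lam" and c: "0 \<le> c"
  shows "\<exists>mu C. 0 < mu \<and> 0 < C \<and> (\<forall>t s A. 0 \<le> s \<longrightarrow> s \<le> c * t \<longrightarrow> 0 \<le> t \<longrightarrow>
    (\<forall>k. t ^ (2 * k) * A \<le> moment mu (2 * k)) \<longrightarrow> A \<le> C * exp (- lam * \<omega> s))"
proof -
  obtain L where L: "L \<ge> 1" "\<And>t. 0 \<le> t \<Longrightarrow> \<omega> (c * t) \<le> L * (\<omega> t + 1)" by (rule om_scale[OF c]) blast
  have one: "0 < (1::real)" by simp
  obtain C2 where C2: "C2 > 0" "\<And>t. 0 \<le> t \<Longrightarrow> (1 + t) ^ 2 \<le> C2 * exp (1 * \<omega> t)" by (rule om_poly[OF one, of 2]) blast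
  show ?thesis
  proof (intro exI conjI allI impI)
    \<comment> \<open>In \<open>lam * L + 1\<close> the factor \<open>L\<close> pays for passing
      from t to s \<le> c t, and the 1 pays for the t^2 of \<open>moment_inf\<close>.\<close>
    show mu: "0 < lam * L + 1" using L lam by (simp add: add_pos_pos)
    show "0 < C2 * exp (lam * L) + exp (lam * \<omega> c)" using C2 by (simp add: add_pos_pos)
    fix t s A :: real
    assume s: "0 \<le> s" "s \<le> c * t" and t: "0 \<le> t" and A0: "\<forall>k. t ^ (2 * k) * A \<le> moment (lam * L + 1) (2 * k)"
    note A = A0[rule_format]
    have d: "(C2 * exp (lam * L) + exp (lam * \<omega> c)) * exp (- lam * \<omega> s) =
        C2 * exp (lam * L) * exp (- lam * \<omega> s) + exp (lam * \<omega> c) * exp (- lam * \<omega> s)" by (rule distrib_right)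
    show "A \<le> (C2 * exp (lam * L) + exp (lam * \<omega> c)) * exp (- lam * \<omega> s)"
    proof (cases "1 \<le> t")
      case True
      obtain k where "moment (lam * L + 1) (2 * k) \<le> t ^ (2 * k) * t\<^sup>2 * exp (- (lam * L + 1) * \<omega> t)"
        by (rule moment_inf[OF mu True])
      with A[of k] have "t ^ (2 * k) * A \<le> t ^ (2 * k) * (t\<^sup>2 * exp (- (lam * L + 1) * \<omega> t))" by (simp add: mult.assoc)
      then have "A \<le> t\<^sup>2 * exp (- (lam * L + 1) * \<omega> t)" using True by (simp add: mult_le_cancel_left_pos)
      also have "\<dots> \<le> (C2 * exp (\<omega> t)) * exp (- (lam * L + 1) * \<omega> t)"
      proof (intro mult_right_mono)
        have "t\<^sup>2 \<le> (1 + t)\<^sup>2" using t by (intro power_mono) auto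
        then show "t\<^sup>2 \<le> C2 * exp (\<omega> t)" using C2(2)[OF t] by simp
      qed simp
      also have "\<dots> = C2 * exp (- lam * L * \<omega> t)" by (simp add: mult.assoc exp_add[symmetric] algebra_simps)
      also have "\<dots> \<le> C2 * exp (lam * L + - lam * \<omega> s)"
      proof -
        have "\<omega> s \<le> \<omega> (c * t)" using s by (intro om_mono)
        also have "\<dots> \<le> L * (\<omega> t + 1)" by (rule L(2)[OF t])
        finally have "lam * \<omega> s \<le> lam * (L * (\<omega> t + 1))" using lam by (intro mult_left_mono) auto
        then show ?thesis using C2(1) by (simp add: algebra_simps)
      qed
      also have "\<dots> = C2 * exp (lam * L) * exp (- lam * \<omega> s)" unfolding exp_add by simp
      finally show ?thesis unfolding d by (rule order_trans) simp
    next
      case False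
      \<comment> \<open>For t < 1 only k = 0 is used, giving A \<le> 1. Then s \<le> c, and the
        second summand of the constant covers this range.\<close>
      have "A \<le> 1" using A[of 0] moment_0[OF mu] by simp
      also have "1 \<le> exp (lam * \<omega> c) * exp (- lam * \<omega> s)"
      proof -
        have "s \<le> c" using s(2) False t c mult_left_mono[of t 1 c] by simp
        then have "lam * \<omega> s \<le> lam * \<omega> c" using s lam by (intro mult_left_mono om_mono) auto
        then show ?thesis by (simp add: exp_add[symmetric])
      qed
      finally show ?thesis unfolding d using C2(1) by (simp add: add_increasing)
    qed
  qed
qed

lemma power_le_moment:
  assumes "0 < lam" "0 \<le> t"
  shows "t ^ k \<le> moment lam k * exp (lam * \<omega> t)"
proof (cases "1 \<le> t")
  case True
  then show ?thesis using moment_ge[OF assms(1) True, of k] by (simp add: exp_minus field_simps)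
next
  case False
  have "t ^ k \<le> 1" using False assms by (intro power_le_one) auto
  moreover have "1 * 1 \<le> moment lam k * exp (lam * \<omega> t)"
    using moment_ge_1[OF assms(1)] om_nonneg[OF assms(2)] assms by (intro mult_mono) auto
  ultimately show ?thesis by simp
qed

text \<open>Decaying functions with derivative bounds; \<open>ultra_eq_S_space\<close> below identifies them with \<open>S_space \<omega>\<close>.\<close>

definition ultra :: "('a::euclidean_space \<Rightarrow> complex) set" where
  "ultra = {f. smooth f \<and> (\<forall>lam>0. \<exists>C>0. \<forall>w x. set w \<subseteq> Basis \<longrightarrow>
     cmod (Dw w f x) \<le> C * moment lam (length w) * exp (- lam * \<omega> (norm x)))}"

lemma ultraI:
  fixes f :: "'a::euclidean_space \<Rightarrow> complex"
  assumes "smooth f" 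
    "\<And>lam. 0 < lam \<Longrightarrow> \<exists>C. \<forall>w x. set w \<subseteq> Basis \<longrightarrow> cmod (Dw w f x) \<le> C * moment lam (length w) * exp (- lam * \<omega> (norm x))"
  shows "f \<in> ultra"
proof -
  have "\<exists>C>0. \<forall>w x. set w \<subseteq> Basis \<longrightarrow> cmod (Dw w f x) \<le> C * moment lam (length w) * exp (- lam * \<omega> (norm x))"
    if lam: "0 < lam" for lam
  proof -
    from assms(2)[OF lam] obtain C where C0: "\<forall>w x. set w \<subseteq> Basis \<longrightarrow> cmod (Dw w f x) \<le> C * moment lam (length w) * exp (- lam * \<omega> (norm x))"
      by (elim exE)
    note C = C0[rule_format]
    have "C * moment lam (length w) * exp (- lam * \<omega> (norm x)) \<le> (\<bar>C\<bar> + 1) * moment lam (length w) * exp (- lam * \<omega> (norm x))" for w :: "'a list" and x :: 'a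
      by (intro mult_right_mono) auto
    then show ?thesis by (intro exI[of _ "\<bar>C\<bar> + 1"] conjI allI impI order_trans[OF C]) auto
  qed
  then show ?thesis unfolding ultra_def using assms(1) by simp
qed

section \<open>Linear combinations and coordinate multiples in \<open>ultra\<close>\<close>

lemma ultra_smooth: "f \<in> ultra \<Longrightarrow> smooth f"
  unfolding ultra_def by simp

lemma ultraD:
  fixes f :: "'a::euclidean_space \<Rightarrow> complex"
  assumes "f \<in> ultra" "0 < lam"
  obtains C where "0 < C" "\<And>w x. set w \<subseteq> Basis \<Longrightarrow> cmod (Dw w f x) \<le> C * moment lam (length w) * exp (- lam * \<omega> (norm x))"
proof -
  have "\<exists>C>0. \<forall>w x. set w \<subseteq> Basis \<longrightarrow> cmod (Dw w f x) \<le> C * moment lam (length w) * exp (- lam * \<omega> (norm x))"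
    using assms(2) CollectD[OF assms(1)[unfolded ultra_def], THEN conjunct2, rule_format, of lam] by blast
  then obtain C where C: "0 < C" "\<forall>w x. set w \<subseteq> Basis \<longrightarrow> cmod (Dw w f x) \<le> C * moment lam (length w) * exp (- lam * \<omega> (norm x))"
    by (elim exE conjE)
  show ?thesis by (rule that[OF C(1) C(2)[rule_format]])
qed

lemma ultra_Dw_decay:
  fixes f :: "'a::euclidean_space \<Rightarrow> complex"
  assumes "f \<in> ultra" "0 < lam" "set w \<subseteq> Basis"
  obtains C where "0 < C" "\<And>x. cmod (Dw w f x) \<le> C * exp (- lam * \<omega> (norm x))"
proof -
  obtain C where C: "0 < C" "\<And>w x. set w \<subseteq> Basis \<Longrightarrow> cmod (Dw w f x) \<le> C * moment lam (length w) * exp (- lam * \<omega> (norm x))"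
    by (rule ultraD[OF assms(1,2)]) blast
  show ?thesis by (rule that[of "C * moment lam (length w)"]) (use C assms(3) in auto)
qed

lemma ultra_integrable:
  fixes f :: "'a::euclidean_space \<Rightarrow> complex"
  assumes "f \<in> ultra" "set w \<subseteq> Basis"
  shows "integrable lborel (Dw w f)" "integrable lborel (\<lambda>x. (1 + norm x) ^ N * cmod (Dw w f x))"
proof -
  have one: "0 < (1::real)" by simp
  obtain C where C: "0 < C" "\<And>x. cmod (Dw w f x) \<le> C * exp (- 1 * \<omega> (norm x))" by (rule ultra_Dw_decay[OF assms(1) one assms(2)]) blast
  have m: "Dw w f \<in> borel_measurable lborel"
    by (intro continuous_imp_borel smooth_continuous smooth_Dw ultra_smooth assms)
  show "integrable lborel (Dw w f)" "integrable lborel (\<lambda>x. (1 + norm x) ^ N * cmod (Dw w f x))"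
    using integrable_decay[OF one m C(2)] by auto
qed

lemma ultra_lin:
  fixes f g :: "'a::euclidean_space \<Rightarrow> complex"
  assumes "f \<in> ultra" "g \<in> ultra"
  shows "(\<lambda>x. c * f x + d * g x) \<in> ultra"
proof (rule ultraI)
  show "smooth (\<lambda>x. c * f x + d * g x)" by (intro smooth_lin ultra_smooth assms)
  fix lam :: real assume lam: "0 < lam"
  obtain C where C: "0 < C" "\<And>w x. set w \<subseteq> Basis \<Longrightarrow> cmod (Dw w f x) \<le> C * moment lam (length w) * exp (- lam * \<omega> (norm x))"
    by (rule ultraD[OF assms(1) lam]) blast
  obtain C' where C': "0 < C'" "\<And>w x. set w \<subseteq> Basis \<Longrightarrow> cmod (Dw w g x) \<le> C' * moment lam (length w) * exp (- lam * \<omega> (norm x))"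
    by (rule ultraD[OF assms(2) lam]) blast
  show "\<exists>C. \<forall>w x. set w \<subseteq> Basis \<longrightarrow> cmod (Dw w (\<lambda>x. c * f x + d * g x) x) \<le> C * moment lam (length w) * exp (- lam * \<omega> (norm x))"
  proof (intro exI allI impI)
    fix w :: "'a list" and x :: 'a assume w: "set w \<subseteq> Basis"
    let ?M = "moment lam (length w) * exp (- lam * \<omega> (norm x))"
    have "cmod (Dw w (\<lambda>x. c * f x + d * g x) x) \<le> cmod c * cmod (Dw w f x) + cmod d * cmod (Dw w g x)"
      unfolding Dw_lin[OF ultra_smooth[OF assms(1)] ultra_smooth[OF assms(2)] w] by (rule order_trans[OF norm_triangle_ineq]) (simp add: norm_mult)
    also have "\<dots> \<le> cmod c * (C * ?M) + cmod d * (C' * ?M)"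
      using C(2)[OF w, of x] C'(2)[OF w, of x] by (intro add_mono mult_left_mono) (auto simp: mult.assoc)
    finally show "cmod (Dw w (\<lambda>x. c * f x + d * g x) x) \<le> (cmod c * C + cmod d * C') * moment lam (length w) * exp (- lam * \<omega> (norm x))"
      by (simp add: algebra_simps)
  qed
qed

lemma smooth_coord_mult:
  fixes f :: "'a::euclidean_space \<Rightarrow> complex"
  assumes "smooth f" "b \<in> Basis"
  shows "smooth (\<lambda>x. of_real (x \<bullet> b) * f x)"
proof -
  have "smooth (\<lambda>x. of_real (x \<bullet> b) * f x + 0 * f x)"
  proof (rule smooth_coinduct[where P="\<lambda>h. \<exists>f g. smooth f \<and> smooth g \<and> h = (\<lambda>x. of_real (x \<bullet> b) * f x + g x)"])
    show "\<exists>f' g. smooth f' \<and> smooth g \<and> (\<lambda>x. of_real (x \<bullet> b) * f x + 0 * f x) = (\<lambda>x. of_real (x \<bullet> b) * f' x + g x)"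
      using assms smooth_lin[OF assms(1,1), of 0 0] by (intro exI[of _ f] exI[of _ "\<lambda>x. 0 * f x + 0 * f x"]) simp
    fix h :: "'a \<Rightarrow> complex"
    assume "\<exists>f g. smooth f \<and> smooth g \<and> h = (\<lambda>x. of_real (x \<bullet> b) * f x + g x)"
    then obtain f g where h: "smooth f" "smooth g" "h = (\<lambda>x. of_real (x \<bullet> b) * f x + g x)" by (elim exE conjE)
    show "continuous_on UNIV h \<and> (\<forall>e\<in>Basis. \<exists>g. has_D e h g \<and> 
        (\<exists>f f'. smooth f \<and> smooth f' \<and> g = (\<lambda>x. of_real (x \<bullet> b) * f x + f' x)))"
    proof (intro conjI ballI)
      show "continuous_on UNIV h" unfolding h(3) by (intro continuous_intros smooth_continuous h)
      fix e :: 'a assume e: "e \<in> Basis"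
      have "has_D e (\<lambda>x. 1 * (of_real (x \<bullet> b) * f x) + 1 * g x)
        (\<lambda>x. 1 * ((if e = b then - \<i> else 0) * f x + of_real (x \<bullet> b) * D_dir e f x) + 1 * D_dir e g x)"
        by (intro has_D_lin has_D_mult has_D_coord smooth_has_D h e assms)
      then have "has_D e h (\<lambda>x. of_real (x \<bullet> b) * D_dir e f x + ((if e = b then - \<i> else 0) * f x + 1 * D_dir e g x))"
        unfolding h(3) by (simp add: algebra_simps)
      then show "\<exists>g. has_D e h g \<and> (\<exists>f f'. smooth f \<and> smooth f' \<and> g = (\<lambda>x. of_real (x \<bullet> b) * f x + f' x))"
        by (intro exI[of _ "\<lambda>x. of_real (x \<bullet> b) * D_dir e f x + ((if e = b then - \<i> else 0) * f x + 1 * D_dir e g x)"] conjI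
           exI[of _ "D_dir e f"] exI[of _ "\<lambda>x. (if e = b then - \<i> else 0) * f x + 1 * D_dir e g x"] smooth_D_dir smooth_lin h e refl)
    qed
  qed
  then show ?thesis by simp
qed

text \<open>\<open>g\<close> is the commutator of \<open>Dw w\<close> with multiplication by a
  coordinate: a sum of at most \<open>length w\<close> derivatives of \<open>f\<close>, each with a
  letter removed. Its derivatives are bounded along with it because the next induction step
  differentiates it again.\<close>

lemma Dw_coord_mult:
  fixes f :: "'a::euclidean_space \<Rightarrow> complex"
  assumes f: "smooth f" and b: "b \<in> Basis" and lam: "0 < lam" and C: "0 < C"
    and bd: "\<And>w x. set w \<subseteq> Basis \<Longrightarrow> cmod (Dw w f x) \<le> C * moment lam (length w) * exp (- lam * \<omega> (norm x))"
    and w: "set w \<subseteq> Basis"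
  shows "\<exists>g. smooth g \<and> Dw w (\<lambda>x. of_real (x \<bullet> b) * f x) = (\<lambda>x. of_real (x \<bullet> b) * Dw w f x + g x) \<and>
    (\<forall>v x. set v \<subseteq> Basis \<longrightarrow> cmod (Dw v g x) \<le> length w * (C * moment lam (length w + length v) * exp (- lam * \<omega> (norm x))))"
  using w
proof (induction w)
  case Nil
  have z: "smooth (\<lambda>x. 0 * f x + 0 * f x)" by (intro smooth_lin f)
  have "Dw v (\<lambda>x. 0 * f x + 0 * f x) = (\<lambda>x. 0 * Dw v f x + 0 * Dw v f x)" if "set v \<subseteq> Basis" for v
    by (intro Dw_lin f that)
  then show ?case using z by (intro exI[of _ "\<lambda>x. 0 * f x + 0 * f x"]) auto
next
  case (Cons e w)
  then have e: "e \<in> Basis" and w: "set w \<subseteq> Basis" by auto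
  from Cons.IH[OF w] obtain g where g: "smooth g" "Dw w (\<lambda>x. of_real (x \<bullet> b) * f x) = (\<lambda>x. of_real (x \<bullet> b) * Dw w f x + g x)"
    "\<And>v x. set v \<subseteq> Basis \<Longrightarrow> cmod (Dw v g x) \<le> length w * (C * moment lam (length w + length v) * exp (- lam * \<omega> (norm x)))"
    by (elim exE conjE) simp
  \<comment> \<open>Product rule: differentiating the coordinate gives one new term, and the old
    commutator is differentiated once more.\<close>
  define g' where "g' = (\<lambda>x. (if e = b then - \<i> else 0) * Dw w f x + 1 * D_dir e g x)"
  have g': "smooth g'" unfolding g'_def by (intro smooth_lin smooth_Dw smooth_D_dir f g w e)
  have "has_D e (\<lambda>x. 1 * (of_real (x \<bullet> b) * Dw w f x) + 1 * g x)
        (\<lambda>x. 1 * ((if e = b then - \<i> else 0) * Dw w f x + of_real (x \<bullet> b) * D_dir e (Dw w f) x) + 1 * D_dir e g x)"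
    by (intro has_D_lin has_D_mult has_D_coord smooth_has_D smooth_Dw f g e b w)
  from has_D_D_dir[OF this] have "D_dir e (\<lambda>x. of_real (x \<bullet> b) * Dw w f x + g x) = (\<lambda>x. of_real (x \<bullet> b) * D_dir e (Dw w f) x + g' x)"
    unfolding g'_def by (simp add: algebra_simps)
  then have "Dw (e # w) (\<lambda>x. of_real (x \<bullet> b) * f x) = (\<lambda>x. of_real (x \<bullet> b) * Dw (e # w) f x + g' x)"
    by (simp add: g(2))
  moreover have "cmod (Dw v g' x) \<le> length (e # w) * (C * moment lam (length (e # w) + length v) * exp (- lam * \<omega> (norm x)))"
    if v: "set v \<subseteq> Basis" for v x
  proof -
    let ?M = "C * moment lam (length (e # w) + length v) * exp (- lam * \<omega> (norm x))"
    have "Dw v g' x = (if e = b then - \<i> else 0) * Dw (v @ w) f x + 1 * Dw (v @ [e]) g x"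
      unfolding g'_def by (subst Dw_lin) (use smooth_Dw[OF f w] smooth_D_dir[OF g(1) e] v in auto)
    then have "cmod (Dw v g' x) \<le> cmod (if e = b then - \<i> else 0) * cmod (Dw (v @ w) f x) + cmod (Dw (v @ [e]) g x)"
      using norm_triangle_ineq[of "(if e = b then - \<i> else 0) * Dw (v @ w) f x" "Dw (v @ [e]) g x"] by (simp add: norm_mult)
    also have "\<dots> \<le> 1 * ?M + length w * ?M"
    proof (intro add_mono mult_mono)
      have "cmod (Dw (v @ w) f x) \<le> C * moment lam (length (v @ w)) * exp (- lam * \<omega> (norm x))"
        using v w by (intro bd) auto
      also have "\<dots> \<le> ?M" using C by (intro mult_right_mono mult_left_mono moment_mono lam) auto
      finally show "cmod (Dw (v @ w) f x) \<le> ?M" .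
      have "cmod (Dw (v @ [e]) g x) \<le> length w * (C * moment lam (length w + length (v @ [e])) * exp (- lam * \<omega> (norm x)))"
        using v e by (intro g(3)) auto
      then show "cmod (Dw (v @ [e]) g x) \<le> length w * ?M" by (simp add: add.assoc)
    qed auto
    finally show ?thesis by (simp add: algebra_simps)
  qed
  ultimately show ?case using g' by (intro exI[of _ g']) auto
qed

lemma ultra_coord_mult:
  fixes f :: "'a::euclidean_space \<Rightarrow> complex"
  assumes f: "f \<in> ultra" and b: "b \<in> Basis"
  shows "(\<lambda>x. of_real (x \<bullet> b) * f x) \<in> ultra"
proof (rule ultraI)
  show "smooth (\<lambda>x. of_real (x \<bullet> b) * f x)" by (intro smooth_coord_mult ultra_smooth f b)
  fix mu :: real assume mu: "0 < mu"
  have two: "1 \<le> (2::real)" by simp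
  obtain lam0 K where K: "0 < K" "mu \<le> lam0" "\<And>k. 2 ^ k * moment lam0 k \<le> K * moment mu k"
    by (rule moment_geometric[OF mu two]) blast
  \<comment> \<open>\<open>lam0\<close> absorbs 2^k, which majorises the number k of commutator
    terms; the extra 1 absorbs the factor 1 + |x|.\<close>
  define lam where "lam = lam0 + 1"
  have lam: "0 < lam" "mu + 1 \<le> lam" using K mu unfolding lam_def by auto
  have one: "0 < (1::real)" by simp
  obtain P where P: "0 < P" "\<And>t. 0 \<le> t \<Longrightarrow> (1 + t) ^ 1 \<le> P * exp (1 * \<omega> t)" by (rule om_poly[OF one, of 1]) blast
  obtain C where C: "0 < C" "\<And>w x. set w \<subseteq> Basis \<Longrightarrow> cmod (Dw w f x) \<le> C * moment lam (length w) * exp (- lam * \<omega> (norm x))"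
    by (rule ultraD[OF f lam(1)]) blast
  show "\<exists>C. \<forall>w x. set w \<subseteq> Basis \<longrightarrow> cmod (Dw w (\<lambda>x. of_real (x \<bullet> b) * f x) x) \<le> C * moment mu (length w) * exp (- mu * \<omega> (norm x))"
  proof (intro exI allI impI)
    fix w :: "'a list" and x :: 'a assume w: "set w \<subseteq> Basis"
    let ?k = "length w"
    let ?M = "C * moment lam ?k * exp (- lam * \<omega> (norm x))"
    obtain g where g: "Dw w (\<lambda>x. of_real (x \<bullet> b) * f x) = (\<lambda>x. of_real (x \<bullet> b) * Dw w f x + g x)"
      and g0: "\<forall>v x. set v \<subseteq> Basis \<longrightarrow> cmod (Dw v g x) \<le> length w * (C * moment lam (length w + length v) * exp (- lam * \<omega> (norm x)))"
      using Dw_coord_mult[where f=f and b=b and lam=lam and C=C and w=w, OF ultra_smooth[OF f] b lam(1) C(1) _ w] C(2) by blast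
    have g2: "cmod (g x) \<le> ?k * ?M" using g0[rule_format, of "[]" x] by simp
    have "cmod (Dw w (\<lambda>x. of_real (x \<bullet> b) * f x) x) \<le> \<bar>x \<bullet> b\<bar> * cmod (Dw w f x) + cmod (g x)"
      unfolding g using norm_triangle_ineq[of "of_real (x \<bullet> b) * Dw w f x" "g x"] by (simp add: norm_mult)
    also have "\<dots> \<le> norm x * ?M + ?k * ?M"
      using C(2)[OF w, of x] g2 Basis_le_norm[OF b, of x] by (intro add_mono mult_mono) auto
    also have "\<dots> \<le> (1 + norm x) * 2 ^ ?k * ?M"
    proof -
      have 1: "real ?k \<le> 2 ^ ?k" "1 \<le> (2::real) ^ ?k" using of_nat_less_two_power[of ?k] by (auto intro: less_imp_le)
      have "norm x * 1 \<le> norm x * 2 ^ ?k" using 1 by (intro mult_left_mono) auto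
      then have "norm x + ?k \<le> norm x * 2 ^ ?k + 2 ^ ?k" using 1 by linarith
      then have "norm x + ?k \<le> (1 + norm x) * 2 ^ ?k" by (simp only: distrib_right mult_1_left add.commute)
      then have "(norm x + ?k) * ?M \<le> ((1 + norm x) * 2 ^ ?k) * ?M" using C(1) by (intro mult_right_mono) auto
      then show ?thesis by (simp add: algebra_simps)
    qed
    also have "\<dots> = C * (2 ^ ?k * moment lam ?k) * ((1 + norm x) * exp (- lam * \<omega> (norm x)))" by simp
    also have "\<dots> \<le> C * (K * moment mu ?k) * (P * exp (- mu * \<omega> (norm x)))"
    proof (rule mult_mono)
      have "2 ^ ?k * moment lam ?k \<le> 2 ^ ?k * moment lam0 ?k"
        using mu K unfolding lam_def by (intro mult_left_mono moment_antimono) auto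
      then have "2 ^ ?k * moment lam ?k \<le> K * moment mu ?k" using K(3)[of ?k] by linarith
      then show "C * (2 ^ ?k * moment lam ?k) \<le> C * (K * moment mu ?k)" using C(1) by (intro mult_left_mono) auto
      have "(1 + norm x) * exp (- lam * \<omega> (norm x)) \<le> (P * exp (\<omega> (norm x))) * exp (- lam * \<omega> (norm x))"
        using P(2)[of "norm x"] by (intro mult_right_mono) auto
      also have "\<dots> = P * exp (- (lam - 1) * \<omega> (norm x))" by (simp add: mult.assoc exp_add[symmetric] algebra_simps)
      also have "\<dots> \<le> P * exp (- mu * \<omega> (norm x))"
        using P(1) lam(2) om_nonneg[of "norm x"] mult_right_mono[of mu "lam - 1" "\<omega> (norm x)"] by (intro mult_left_mono) (auto simp: algebra_simps)
      finally show "(1 + norm x) * exp (- lam * \<omega> (norm x)) \<le> P * exp (- mu * \<omega> (norm x))" .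
    qed (use C K in auto)
    finally show "cmod (Dw w (\<lambda>x. of_real (x \<bullet> b) * f x) x) \<le> (C * K * P) * moment mu ?k * exp (- mu * \<omega> (norm x))"
      by (simp add: ac_simps)
  qed
qed

lemma ultra_coord_mult_neg:
  fixes f :: "'a::euclidean_space \<Rightarrow> complex"
  assumes "f \<in> ultra" "b \<in> Basis"
  shows "(\<lambda>x. - (of_real (x \<bullet> b) * f x)) \<in> ultra"
  using ultra_lin[OF ultra_coord_mult[OF assms] assms(1), of "-1" 0] by simp

lemma ultra_has_D_fourier:
  fixes f :: "'a::euclidean_space \<Rightarrow> complex"
  assumes "f \<in> ultra" "b \<in> Basis"
  shows "has_D b (fourier f) (fourier (\<lambda>x. - (of_real (x \<bullet> b) * f x)))"
  using ultra_integrable[of f "[]"] assms by (intro has_D_fourier) auto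

text \<open>A derivative of a transform is the transform of a coordinate multiple, and
  \<open>ultra\<close> is stable under those; the transforms of \<open>ultra\<close> are therefore a
  class fit for \<open>smooth_coinduct\<close>.\<close>

lemma smooth_fourier:
  fixes f :: "'a::euclidean_space \<Rightarrow> complex"
  assumes "f \<in> ultra"
  shows "smooth (fourier f)"
proof (rule smooth_coinduct[where P="\<lambda>h. \<exists>f\<in>ultra. h = fourier f"])
  show "\<exists>g\<in>ultra. fourier f = fourier g" using assms by (intro bexI[of _ f] refl)
  fix h :: "'a \<Rightarrow> complex" assume "\<exists>f\<in>ultra. h = fourier f"
  then obtain g where g: "g \<in> ultra" "h = fourier g" by (elim bexE)
  show "continuous_on UNIV h \<and> (\<forall>b\<in>Basis. \<exists>g. has_D b h g \<and> (\<exists>f\<in>ultra. g = fourier f))"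
  proof (intro conjI ballI)
    show "continuous_on UNIV h" unfolding g(2) using ultra_integrable[of g "[]"] g(1) by (intro fourier_continuous) auto
    fix b :: 'a assume b: "b \<in> Basis"
    show "\<exists>g. has_D b h g \<and> (\<exists>f\<in>ultra. g = fourier f)" unfolding g(2)
      by (intro exI[of _ "fourier (\<lambda>x. - (of_real (x \<bullet> b) * g x))"] bexI[of _ "\<lambda>x. - (of_real (x \<bullet> b) * g x)"]
          conjI ultra_has_D_fourier ultra_coord_mult_neg g b refl)
  qed
qed

lemma Dw_fourier:
  fixes f :: "'a::euclidean_space \<Rightarrow> complex"
  assumes "f \<in> ultra" "set w \<subseteq> Basis"
  shows "\<exists>g\<in>ultra. Dw w (fourier f) = fourier g"
  using assms(2)
proof (induction w)
  case Nil
  show ?case using assms(1) by (intro bexI[of _ f]) auto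
next
  case (Cons b w)
  from Cons.IH Cons.prems obtain g where g: "g \<in> ultra" "Dw w (fourier f) = fourier g" by auto
  have b: "b \<in> Basis" using Cons.prems by simp
  show ?case
    using has_D_D_dir[OF ultra_has_D_fourier[OF g(1) b]] g by (intro bexI[OF _ ultra_coord_mult_neg[OF g(1) b]]) simp
qed

lemma fourier_Dw_replicate:
  fixes f :: "'a::euclidean_space \<Rightarrow> complex"
  assumes f: "f \<in> ultra" and b: "b \<in> Basis"
  shows "fourier (Dw (replicate k b) f) \<xi> = of_real (\<xi> \<bullet> b) ^ k * fourier f \<xi>"
proof (induction k)
  case (Suc k)
  have w: "set (replicate k b) \<subseteq> Basis" "set (replicate (Suc k) b) \<subseteq> Basis" using b by auto
  have "fourier (D_dir b (Dw (replicate k b) f)) \<xi> = of_real (\<xi> \<bullet> b) * fourier (Dw (replicate k b) f) \<xi>"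
  proof (rule fourier_D)
    show "has_D b (Dw (replicate k b) f) (D_dir b (Dw (replicate k b) f))" by (intro smooth_has_D smooth_Dw ultra_smooth f b w)
    show "continuous_on UNIV (Dw (replicate k b) f)" by (intro smooth_continuous smooth_Dw ultra_smooth f w)
    show "continuous_on UNIV (D_dir b (Dw (replicate k b) f))" by (intro smooth_continuous smooth_D_dir smooth_Dw ultra_smooth f w b)
    show "integrable lborel (Dw (replicate k b) f)" by (rule ultra_integrable[OF f w(1)])
    show "integrable lborel (D_dir b (Dw (replicate k b) f))" using ultra_integrable(1)[OF f w(2)] by simp
  qed
  then show ?case using Suc by simp
qed simp

text \<open>A power 2k of a frequency coordinate times the transform is the transform of a
  derivative of order 2k, hence bounded by an L1 norm of size \<open>moment mu (2 * k)\<close>.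
  \<open>decay_from_moments\<close> in the dominant coordinate turns these bounds into
  decay.\<close>

lemma fourier_decay:
  fixes f :: "'a::euclidean_space \<Rightarrow> complex"
  assumes f: "f \<in> ultra" and lam: "0 < lam"
  shows "\<exists>C. \<forall>\<xi>. cmod (fourier f \<xi>) \<le> C * exp (- lam * \<omega> (norm \<xi>))"
proof -
  have d: "0 \<le> real DIM('a)" by simp
  obtain mu K where K: "0 < mu" "0 < K" and K3: "\<forall>(t::real) (s::real) A. 0 \<le> s \<longrightarrow> s \<le> DIM('a) * t \<longrightarrow> 0 \<le> t \<longrightarrow>
    (\<forall>k. t ^ (2 * k) * A \<le> moment mu (2 * k)) \<longrightarrow> A \<le> K * exp (- lam * \<omega> s)"
    using decay_from_moments[OF lam d] by (elim exE conjE)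
  obtain C where C: "0 < C" "\<And>w x. set w \<subseteq> Basis \<Longrightarrow> cmod (Dw w f x) \<le> C * moment mu (length w) * exp (- mu * \<omega> (norm x))"
    by (rule ultraD[OF f K(1)]) blast
  have iw: "integrable lborel (\<lambda>x::'a. exp (- mu * \<omega> (norm x)))" using integrable_weight[OF K(1), of 0] by simp
  define I where "I = (LINT x|(lborel :: 'a measure). exp (- mu * \<omega> (norm x)))"
  have I: "0 \<le> I" unfolding I_def by simp
  have "cmod (fourier f \<xi>) \<le> (C * (I + 1) * K) * exp (- lam * \<omega> (norm \<xi>))" for \<xi>
  proof -
    obtain b where b: "b \<in> Basis" "norm \<xi> \<le> DIM('a) * \<bar>\<xi> \<bullet> b\<bar>" by (rule coord_ge[of \<xi>])
    have "cmod (fourier f \<xi>) / (C * (I + 1)) \<le> K * exp (- lam * \<omega> (norm \<xi>))"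
    proof (rule K3[rule_format])
      show "norm \<xi> \<le> DIM('a) * \<bar>\<xi> \<bullet> b\<bar>" by (rule b)
      fix k
      have w: "set (replicate (2 * k) b) \<subseteq> Basis" using b by auto
      have "\<bar>\<xi> \<bullet> b\<bar> ^ (2 * k) * cmod (fourier f \<xi>) = cmod (fourier (Dw (replicate (2 * k) b) f) \<xi>)"
        unfolding fourier_Dw_replicate[OF f b(1)] by (simp add: norm_mult norm_power)
      also have "\<dots> \<le> (LINT x|lborel. cmod (Dw (replicate (2 * k) b) f x))"
        by (rule norm_fourier_le[OF ultra_integrable(1)[OF f w]])
      also have "\<dots> \<le> (LINT x|(lborel :: 'a measure). C * moment mu (2 * k) * exp (- mu * \<omega> (norm x)))"
      proof (rule integral_mono)
        show "integrable lborel (\<lambda>x. cmod (Dw (replicate (2 * k) b) f x))" by (rule integrable_norm[OF ultra_integrable(1)[OF f w]])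
        show "integrable lborel (\<lambda>x::'a. C * moment mu (2 * k) * exp (- mu * \<omega> (norm x)))" by (rule integrable_mult_right[OF iw])
        show "cmod (Dw (replicate (2 * k) b) f x) \<le> C * moment mu (2 * k) * exp (- mu * \<omega> (norm x))" for x
          using C(2)[OF w, of x] unfolding length_replicate .
      qed
      also have "\<dots> = C * moment mu (2 * k) * I" unfolding I_def by simp
      \<comment> \<open>\<open>I + 1\<close> is used as a manifestly positive number to divide
        by.\<close>
      also have "\<dots> \<le> C * moment mu (2 * k) * (I + 1)" using C by (intro mult_left_mono) auto
      finally have X: "\<bar>\<xi> \<bullet> b\<bar> ^ (2 * k) * cmod (fourier f \<xi>) \<le> C * moment mu (2 * k) * (I + 1)" .
      show "\<bar>\<xi> \<bullet> b\<bar> ^ (2 * k) * (cmod (fourier f \<xi>) / (C * (I + 1))) \<le> moment mu (2 * k)"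
      proof -
        have p: "0 < C * (I + 1)" using C(1) I by simp
        from X have "(\<bar>\<xi> \<bullet> b\<bar> ^ (2 * k) * cmod (fourier f \<xi>)) / (C * (I + 1)) \<le> moment mu (2 * k)"
          using p by (subst pos_divide_le_eq) (auto simp: ac_simps)
        then show ?thesis by simp
      qed
    qed auto
    moreover have "0 < C * (I + 1)" using C(1) I by simp
    ultimately show ?thesis by (subst (asm) pos_divide_le_eq) (auto simp: ac_simps)
  qed
  then show ?thesis by blast
qed

lemma bdd_above_decay:
  fixes f :: "'a::euclidean_space \<Rightarrow> complex"
  assumes "\<And>x. cmod (f x) \<le> C * exp (- lam * \<omega> (norm x))"
  shows "bdd_above (range (\<lambda>x. exp (lam * \<omega> (norm x)) * cmod (f x)))"
proof (rule bdd_aboveI2)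
  fix x
  have "exp (lam * \<omega> (norm x)) * cmod (f x) \<le> exp (lam * \<omega> (norm x)) * (C * exp (- lam * \<omega> (norm x)))"
    using assms by (intro mult_left_mono) auto
  also have "\<dots> = C" by (simp add: exp_minus field_simps)
  finally show "exp (lam * \<omega> (norm x)) * cmod (f x) \<le> C" .
qed

text \<open>Derivatives of the transform are again transforms of functions in \<open>ultra\<close>,
  so \<open>fourier_decay\<close> serves every multi-index.\<close>

lemma ultra_subset_S_space: "ultra \<subseteq> S_space \<omega>"
proof
  fix f :: "'a \<Rightarrow> complex" assume f: "f \<in> ultra"
  have 1: "bdd_above (range (\<lambda>x. exp (lam * \<omega> (norm x)) * cmod (D_multi \<alpha> f x)))" if "0 < lam" for lam \<alpha>
    unfolding D_multi_Dw by (rule ultra_Dw_decay[OF f that mi_word_Basis[of \<alpha>]]) (rule bdd_above_decay)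
  have 2: "bdd_above (range (\<lambda>x. exp (lam * \<omega> (norm x)) * cmod (D_multi \<alpha> (fourier f) x)))" if lam: "0 < lam" for lam \<alpha>
  proof -
    obtain g where g: "g \<in> ultra" "Dw (mi_word \<alpha>) (fourier f) = fourier g" using Dw_fourier[OF f mi_word_Basis[of \<alpha>]] by (elim bexE)
    obtain C where C: "\<forall>\<xi>. cmod (fourier g \<xi>) \<le> C * exp (- lam * \<omega> (norm \<xi>))" using fourier_decay[OF g(1) lam] by (elim exE)
    show ?thesis unfolding D_multi_Dw g(2) by (rule bdd_above_decay[OF C[rule_format]])
  qed
  show "f \<in> S_space \<omega>"
    unfolding S_space_def using 1 2 ultra_integrable(1)[OF f, of "[]"] ultra_smooth[OF f] smooth_fourier[OF f] by simp
qed

end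

section \<open>The description of the space by seminorms\<close>

lemma has_D_coord_power:
  assumes "b \<in> Basis" "e \<in> Basis"
  shows "has_D e (\<lambda>x. of_real (x \<bullet> b) ^ m) (\<lambda>x. of_nat m * of_real (x \<bullet> b) ^ (m - 1) * (if e = b then - \<i> else 0))"
proof (induction m)
  case 0
  show ?case unfolding has_D_def by simp
next
  case (Suc m)
  have "has_D e (\<lambda>x. of_real (x \<bullet> b) * of_real (x \<bullet> b) ^ m)
     (\<lambda>x. (if e = b then - \<i> else 0) * of_real (x \<bullet> b) ^ m + 
       of_real (x \<bullet> b) * (of_nat m * of_real (x \<bullet> b) ^ (m - 1) * (if e = b then - \<i> else 0)))"
    by (rule has_D_mult[OF has_D_coord[OF assms] Suc])
  moreover have "(if e = b then - \<i> else 0) * of_real (x \<bullet> b) ^ m + 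
       of_real (x \<bullet> b) * (of_nat m * of_real (x \<bullet> b) ^ (m - 1) * (if e = b then - \<i> else 0)) =
       of_nat (Suc m) * of_real (x \<bullet> b) ^ (Suc m - 1) * (if e = b then - \<i> else 0)" for x :: 'a
    by (cases m) (auto simp: algebra_simps)
  ultimately show ?case by (simp only: power_Suc)
qed

text \<open>On the ball of radius |g(x)| / (2 M) the Lipschitz bound keeps |g| above half of |g(x)|.
  The radius is at most 1/2, so |z_b| stays above half of |x_b| once |x_b| \<ge> 1. The volume of
  the ball contributes a further power d of |g(x)|.\<close>

lemma ball_integral_bound:
  fixes g :: "'a::euclidean_space \<Rightarrow> complex"
  assumes M: "0 < M" "cmod (g x) \<le> M" and lip: "\<And>z. cmod (g z - g x) \<le> M * norm (z - x)"
    and b: "b \<in> Basis" and k: "k = 0 \<or> 1 \<le> \<bar>x \<bullet> b\<bar>"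
    and int: "integrable lborel (\<lambda>z. \<bar>z \<bullet> b\<bar> ^ k * (cmod (g z))\<^sup>2)"
  shows "(\<bar>x \<bullet> b\<bar> / 2) ^ k * ((cmod (g x))\<^sup>2 / 4 * (unit_ball_vol (real DIM('a)) * (cmod (g x) / (2 * M)) ^ DIM('a)))
    \<le> (LINT z|lborel. \<bar>z \<bullet> b\<bar> ^ k * (cmod (g z))\<^sup>2)"
proof -
  define r where "r = cmod (g x) / (2 * M)"
  have r: "0 \<le> r" "r \<le> 1 / 2" "M * r = cmod (g x) / 2" using M unfolding r_def by (auto simp: field_simps)
  define c where "c = (\<bar>x \<bullet> b\<bar> / 2) ^ k * ((cmod (g x))\<^sup>2 / 4)"
  have fin: "emeasure lborel (ball x r) < \<infinity>" by (rule emeasure_bounded_finite) simp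
  have "(LINT z|lborel. indicator (ball x r) z *\<^sub>R c) \<le> (LINT z|lborel. \<bar>z \<bullet> b\<bar> ^ k * (cmod (g z))\<^sup>2)"
  proof (rule integral_mono[OF _ int])
    show "integrable lborel (\<lambda>z. indicator (ball x r) z *\<^sub>R c)"
      using fin by (intro integrable_scaleR_left integrable_real_indicator) auto
    fix z
    show "indicator (ball x r) z *\<^sub>R c \<le> \<bar>z \<bullet> b\<bar> ^ k * (cmod (g z))\<^sup>2"
    proof (cases "z \<in> ball x r")
      case True
      then have zr: "norm (z - x) \<le> r" by (simp add: dist_norm norm_minus_commute)
      have "cmod (g z - g x) \<le> M * r" using order_trans[OF lip[of z] mult_left_mono[OF zr]] M by simp
      then have "cmod (g x) / 2 \<le> cmod (g z)" using r(3) norm_triangle_ineq2[of "g x" "g z"] by (simp add: norm_minus_commute)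
      then have 1: "(cmod (g x) / 2)\<^sup>2 \<le> (cmod (g z))\<^sup>2" by (intro power_mono) auto
      have 2: "(\<bar>x \<bullet> b\<bar> / 2) ^ k \<le> \<bar>z \<bullet> b\<bar> ^ k"
      proof (cases "k = 0")
        case False
        have "\<bar>(z - x) \<bullet> b\<bar> \<le> 1 / 2" using order_trans[OF Basis_le_norm[OF b] zr] r(2) by simp
        then have "\<bar>z \<bullet> b - x \<bullet> b\<bar> \<le> 1 / 2" by (simp add: inner_diff_left)
        then have "\<bar>x \<bullet> b\<bar> / 2 \<le> \<bar>z \<bullet> b\<bar>" using k False by linarith
        then show ?thesis by (intro power_mono) auto
      qed simp
      have "c \<le> \<bar>z \<bullet> b\<bar> ^ k * (cmod (g z))\<^sup>2"
        unfolding c_def using mult_mono[OF 2 1] by (simp add: power_divide)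
      then show ?thesis using True by simp
    qed simp
  qed
  also have "(LINT z|lborel. indicator (ball x r) z *\<^sub>R c) = measure lborel (ball x r) * c" by simp
  also have "measure lborel (ball x r) = unit_ball_vol (real DIM('a)) * r ^ DIM('a)" using r content_ball[of r x] by simp
  finally show ?thesis unfolding c_def r_def by (simp add: ac_simps)
qed

context weight begin

section \<open>First consequences of membership in \<open>S_space\<close>\<close>

lemma S_space_smooth: "u \<in> S_space \<omega> \<Longrightarrow> smooth u"
  unfolding S_space_def by simp

lemma bdd_above_decayD:
  fixes f :: "'a::euclidean_space \<Rightarrow> complex"
  assumes "bdd_above (range (\<lambda>x. exp (lam * \<omega> (norm x)) * cmod (f x)))"
  shows "\<exists>C>0. \<forall>x. cmod (f x) \<le> C * exp (- lam * \<omega> (norm x))"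
proof -
  from assms obtain M where M0: "\<forall>y\<in>range (\<lambda>x. exp (lam * \<omega> (norm x)) * cmod (f x)). y \<le> M"
    unfolding bdd_above_def by (elim exE)
  have M: "exp (lam * \<omega> (norm x)) * cmod (f x) \<le> M" for x using M0 by simp
  have "cmod (f x) \<le> (\<bar>M\<bar> + 1) * exp (- lam * \<omega> (norm x))" for x
  proof -
    have "exp (lam * \<omega> (norm x)) * cmod (f x) \<le> \<bar>M\<bar> + 1" using M[of x] by linarith
    then show ?thesis by (simp add: exp_minus field_simps)
  qed
  then show ?thesis by (intro exI[of _ "\<bar>M\<bar> + 1"]) simp
qed

lemma S_space_decay:
  fixes u :: "'a::euclidean_space \<Rightarrow> complex"
  assumes "u \<in> S_space \<omega>" "0 < lam" "set w \<subseteq> Basis"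
  shows "\<exists>C>0. \<forall>x. cmod (Dw w u x) \<le> C * exp (- lam * \<omega> (norm x))"
proof -
  obtain \<alpha> where \<alpha>: "D_multi \<alpha> u = Dw w u" by (rule Dw_D_multi[OF S_space_smooth[OF assms(1)] assms(3)])
  have "bdd_above (range (\<lambda>x. exp (lam * \<omega> (norm x)) * cmod (D_multi \<alpha> u x)))"
    using assms(1,2) unfolding S_space_def by simp
  then show ?thesis unfolding \<alpha> by (rule bdd_above_decayD)
qed

lemma S_space_fourier_decay:
  fixes u :: "'a::euclidean_space \<Rightarrow> complex"
  assumes "u \<in> S_space \<omega>" "0 < lam"
  shows "\<exists>C>0. \<forall>\<xi>. cmod (fourier u \<xi>) \<le> C * exp (- lam * \<omega> (norm \<xi>))"
proof -
  have "mi_word (\<lambda>_::'a. 0) = []" unfolding mi_word_def by simp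
  then have \<alpha>: "D_multi (\<lambda>_. 0) (fourier u) = fourier u" unfolding D_multi_Dw by simp
  have "bdd_above (range (\<lambda>x. exp (lam * \<omega> (norm x)) * cmod (D_multi (\<lambda>_. 0) (fourier u) x)))"
    using assms unfolding S_space_def by simp
  then show ?thesis unfolding \<alpha> by (rule bdd_above_decayD)
qed

lemma S_space_Dw:
  fixes u :: "'a::euclidean_space \<Rightarrow> complex"
  assumes "u \<in> S_space \<omega>" "set w \<subseteq> Basis"
  shows "continuous_on UNIV (Dw w u)" "integrable lborel (Dw w u)" "integrable lborel (\<lambda>x. (1 + norm x) ^ N * cmod (Dw w u x))"
proof -
  show c: "continuous_on UNIV (Dw w u)" by (intro smooth_continuous smooth_Dw S_space_smooth assms)
  have one: "0 < (1::real)" by simp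
  obtain C where C: "\<forall>x. cmod (Dw w u x) \<le> C * exp (- 1 * \<omega> (norm x))"
    using S_space_decay[OF assms(1) one assms(2)] by (elim exE conjE)
  show "integrable lborel (Dw w u)" "integrable lborel (\<lambda>x. (1 + norm x) ^ N * cmod (Dw w u x))"
    by (rule integrable_decay[OF one continuous_imp_borel[OF c] C[rule_format]])+
qed

lemma norm_fourier_Dw:
  fixes u :: "'a::euclidean_space \<Rightarrow> complex"
  assumes "u \<in> S_space \<omega>" "set w \<subseteq> Basis"
  shows "cmod (fourier (Dw w u) \<xi>) \<le> norm \<xi> ^ length w * cmod (fourier u \<xi>)"
  using assms(2)
proof (induction w)
  case (Cons b w)
  then have b: "b \<in> Basis" and w: "set w \<subseteq> Basis" and bw: "set (b # w) \<subseteq> Basis" by auto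
  have "fourier (Dw (b # w) u) \<xi> = of_real (\<xi> \<bullet> b) * fourier (Dw w u) \<xi>"
  proof (rule fourier_D)
    show "has_D b (Dw w u) (Dw (b # w) u)" using smooth_has_D[OF smooth_Dw[OF S_space_smooth[OF assms(1)] w] b] by simp
  qed (rule S_space_Dw[OF assms(1)] w bw)+
  then have "cmod (fourier (Dw (b # w) u) \<xi>) = \<bar>\<xi> \<bullet> b\<bar> * cmod (fourier (Dw w u) \<xi>)" by (simp add: norm_mult)
  also have "\<dots> \<le> norm \<xi> * (norm \<xi> ^ length w * cmod (fourier u \<xi>))"
    using Cons.IH[OF w] Basis_le_norm[OF b, of \<xi>] by (intro mult_mono) auto
  finally show ?case by simp
qed simp

text \<open>One constant for all derivatives, from the decay of the undifferentiated transform
  alone: of its rate \<open>lam + 1\<close>, \<open>lam\<close> turns the power of the frequency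
  into a moment and 1 makes the integral in the inversion bound finite.\<close>

lemma S_space_sup_bound:
  fixes u :: "'a::euclidean_space \<Rightarrow> complex"
  assumes u: "u \<in> S_space \<omega>" and lam: "0 < lam"
  shows "\<exists>C>0. \<forall>w x. set w \<subseteq> Basis \<longrightarrow> cmod (Dw w u x) \<le> C * moment lam (length w)"
proof -
  have l1: "0 < lam + 1" using lam by simp
  obtain C where C: "C > 0" "\<forall>\<xi>. cmod (fourier u \<xi>) \<le> C * exp (- (lam + 1) * \<omega> (norm \<xi>))"
    using S_space_fourier_decay[OF u l1] by (elim exE conjE)
  have one: "0 < (1::real)" by simp
  have iw: "integrable lborel (\<lambda>x::'a. exp (- 1 * \<omega> (norm x)))" using integrable_weight[OF one, of 0] by simp
  define I where "I = (LINT x|(lborel :: 'a measure). exp (- 1 * \<omega> (norm x)))"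
  have I: "0 \<le> I" unfolding I_def by simp
  have "cmod (Dw w u x) \<le> (C * (I + 1)) * moment lam (length w)" if w: "set w \<subseteq> Basis" for w x
  proof -
    have dec: "cmod (fourier (Dw w u) \<xi>) \<le> (C * moment lam (length w)) * exp (- 1 * \<omega> (norm \<xi>))" for \<xi>
    proof -
      have "cmod (fourier (Dw w u) \<xi>) \<le> norm \<xi> ^ length w * cmod (fourier u \<xi>)" by (rule norm_fourier_Dw[OF u w])
      also have "\<dots> \<le> (moment lam (length w) * exp (lam * \<omega> (norm \<xi>))) * (C * exp (- (lam + 1) * \<omega> (norm \<xi>)))"
        using power_le_moment[OF lam, of "norm \<xi>" "length w"] C(2) by (intro mult_mono) auto
      also have "\<dots> = (C * moment lam (length w)) * (exp (lam * \<omega> (norm \<xi>)) * exp (- (lam + 1) * \<omega> (norm \<xi>)))" by simp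
      also have "exp (lam * \<omega> (norm \<xi>)) * exp (- (lam + 1) * \<omega> (norm \<xi>)) = exp (- 1 * \<omega> (norm \<xi>))"
        by (simp add: exp_add[symmetric] algebra_simps)
      finally show ?thesis .
    qed
    have fc: "continuous_on UNIV (fourier (Dw w u))" by (intro fourier_continuous S_space_Dw u w)
    have fi: "integrable lborel (fourier (Dw w u))" by (rule integrable_decay(1)[OF one continuous_imp_borel[OF fc] dec])
    \<comment> \<open>This bound depends on \<open>w\<close>, but it only supplies the boundedness
      that \<open>norm_le_fourier\<close> asks for and does not enter its conclusion.\<close>
    obtain B where B: "B > 0" "\<forall>x. cmod (Dw w u x) \<le> B * exp (- 1 * \<omega> (norm x))" using S_space_decay[OF u one w] by (elim exE conjE)
    have B': "cmod (Dw w u x) \<le> B" for x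
    proof -
      have "B * exp (- 1 * \<omega> (norm x)) \<le> B * 1" using B(1) om_nonneg[of "norm x"] by (intro mult_left_mono) auto
      then show ?thesis using B(2)[rule_format, of x] by simp
    qed
    have "cmod (Dw w u x) \<le> (LINT \<xi>|lborel. cmod (fourier (Dw w u) \<xi>))"
      by (rule norm_le_fourier[OF S_space_Dw(2)[OF u w] S_space_Dw(1)[OF u w] B' fi])
    also have "\<dots> \<le> (LINT \<xi>|(lborel :: 'a measure). (C * moment lam (length w)) * exp (- 1 * \<omega> (norm \<xi>)))"
      by (intro integral_mono integrable_norm fi integrable_mult_right iw dec)
    also have "\<dots> = C * moment lam (length w) * I" unfolding I_def by simp
    also have "\<dots> \<le> C * moment lam (length w) * (I + 1)" using C(1) by (intro mult_left_mono) auto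
    finally show ?thesis by (simp add: ac_simps)
  qed
  moreover have "0 < C * (I + 1)" using C(1) I by simp
  ultimately show ?thesis by (intro exI[of _ "C * (I + 1)"]) simp
qed

text \<open>The polynomial factor is charged to \<open>p\<close> alone, so \<open>q\<close> may be
  merely bounded.\<close>

lemma integrable_coord_power_mult:
  fixes p q :: "'a::euclidean_space \<Rightarrow> complex"
  assumes p: "continuous_on UNIV p" "integrable lborel (\<lambda>x. (1 + norm x) ^ m * cmod (p x))"
    and q: "continuous_on UNIV q" "\<And>x. cmod (q x) \<le> B" and b: "b \<in> Basis"
  shows "integrable lborel (\<lambda>x. p x * of_real (x \<bullet> b) ^ m * q x)"
proof (rule Bochner_Integration.integrable_bound)
  show "integrable lborel (\<lambda>x. ((1 + norm x) ^ m * cmod (p x)) * B)" using p(2) by simp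
  show "(\<lambda>x. p x * of_real (x \<bullet> b) ^ m * q x) \<in> borel_measurable lborel"
    by (intro continuous_imp_borel continuous_intros p q)
  have "cmod (p x * of_real (x \<bullet> b) ^ m * q x) \<le> ((1 + norm x) ^ m * cmod (p x)) * B" for x
  proof -
    have "\<bar>x \<bullet> b\<bar> ^ m \<le> (1 + norm x) ^ m" using Basis_le_norm[OF b, of x] by (intro power_mono) auto
    then have "cmod (p x) * \<bar>x \<bullet> b\<bar> ^ m \<le> cmod (p x) * (1 + norm x) ^ m" by (intro mult_left_mono) auto
    then have "(cmod (p x) * \<bar>x \<bullet> b\<bar> ^ m) * cmod (q x) \<le> (cmod (p x) * (1 + norm x) ^ m) * B"
      by (rule mult_mono[OF _ q(2)]) auto
    then show ?thesis by (simp add: norm_mult norm_power ac_simps)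
  qed
  then show "AE x in lborel. norm (p x * of_real (x \<bullet> b) ^ m * q x) \<le> norm (((1 + norm x) ^ m * cmod (p x)) * B)"
    by (intro AE_I2 order_trans[OF _ norm_ge_zero[THEN abs_of_nonneg, THEN eq_refl]]) (metis abs_ge_self order_trans real_norm_def)
qed

text \<open>The derivative of the full product integrates to 0. The letter passes to the other
  factor without a change of sign by \<open>has_D_cnj\<close>, and the commutator with the
  coordinate power is the remaining term; for m = 0 its coefficient is 0.\<close>

lemma S_space_pairing_by_parts:
  fixes u :: "'a::euclidean_space \<Rightarrow> complex"
  assumes u: "u \<in> S_space \<omega>" and b: "b \<in> Basis" and e: "e \<in> Basis" and w: "set w \<subseteq> Basis" and v: "set v \<subseteq> Basis"
  shows "(LINT x|lborel. Dw (e # w) u x * of_real (x \<bullet> b) ^ m * cnj (Dw v u x)) =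
     (LINT x|lborel. Dw w u x * of_real (x \<bullet> b) ^ m * cnj (Dw (e # v) u x)) -
     of_nat m * (if e = b then - \<i> else 0) * (LINT x|lborel. Dw w u x * of_real (x \<bullet> b) ^ (m - 1) * cnj (Dw v u x))"
proof -
  have ew: "set (e # w) \<subseteq> Basis" and ev: "set (e # v) \<subseteq> Basis" using e w v by auto
  let ?X = "\<lambda>m x. complex_of_real (x \<bullet> b) ^ m"
  let ?c = "if e = b then - \<i> else 0"
  obtain B where B: "B > 0" "\<forall>w x. set w \<subseteq> Basis \<longrightarrow> cmod (Dw w u x) \<le> B * moment 1 (length w)"
    using S_space_sup_bound[OF u, of 1] by auto
  have int: "integrable lborel (\<lambda>x. Dw w u x * ?X m x * cnj (Dw v u x))" if "set w \<subseteq> Basis" "set v \<subseteq> Basis" for w v m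
    by (rule integrable_coord_power_mult[OF S_space_Dw(1,3)[OF u that(1)] _ _ b, where B="B * moment 1 (length v)"])
       (use B(2) that in \<open>auto intro!: continuous_intros S_space_Dw(1)[OF u]\<close>)
  have Dwe: "has_D e (Dw w u) (Dw (e # w) u)" and Dve: "has_D e (Dw v u) (Dw (e # v) u)"
    using smooth_has_D[OF smooth_Dw[OF S_space_smooth[OF u] w] e] smooth_has_D[OF smooth_Dw[OF S_space_smooth[OF u] v] e] by simp_all
  define h' where "h' = (\<lambda>x. Dw (e # w) u x * ?X m x * cnj (Dw v u x) + 
     (of_nat m * ?c) * (Dw w u x * ?X (m - 1) x * cnj (Dw v u x)) - Dw w u x * ?X m x * cnj (Dw (e # v) u x))"
  have "has_D e (\<lambda>x. Dw w u x * ?X m x * cnj (Dw v u x)) h'"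
    by (rule has_D_cong[OF has_D_mult[OF has_D_mult[OF Dwe has_D_coord_power[OF b e]] has_D_cnj[OF Dve]]])
       (auto simp: h'_def algebra_simps)
  moreover have "continuous_on UNIV h'"
    unfolding h'_def by (intro continuous_intros S_space_Dw(1)[OF u] w v ew ev)
  moreover have "integrable lborel (\<lambda>x. Dw w u x * ?X m x * cnj (Dw v u x))" by (rule int[OF w v])
  moreover have "integrable lborel h'"
    unfolding h'_def by (intro Bochner_Integration.integrable_diff Bochner_Integration.integrable_add integrable_mult_right int w v ew ev)
  ultimately have "(LINT x|lborel. h' x) = 0" by (rule integral_D_eq_0)
  moreover have "(LINT x|lborel. h' x) = (LINT x|lborel. Dw (e # w) u x * ?X m x * cnj (Dw v u x)) +
     (of_nat m * ?c) * (LINT x|lborel. Dw w u x * ?X (m - 1) x * cnj (Dw v u x)) - (LINT x|lborel. Dw w u x * ?X m x * cnj (Dw (e # v) u x))"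
  proof -
    have i2: "integrable lborel (\<lambda>x. (of_nat m * ?c) * (Dw w u x * ?X (m - 1) x * cnj (Dw v u x)))" by (intro integrable_mult_right int w v)
    show ?thesis
      unfolding h'_def Bochner_Integration.integral_diff[OF Bochner_Integration.integrable_add[OF int[OF ew v] i2] int[OF w ev]]
        Bochner_Integration.integral_add[OF int[OF ew v] i2] integral_mult_right_zero by simp
  qed
  ultimately show ?thesis by (simp add: algebra_simps)
qed

text \<open>The constant \<open>H\<close> depends only on \<open>lam\<close>, which governs the decay, so that \<open>lam'\<close> can be chosen afterwards
  large enough for the derivative bounds to absorb \<open>H ^ length w\<close>.\<close>

lemma S_space_weighted_L2:
  fixes u :: "'a::euclidean_space \<Rightarrow> complex"
  assumes u: "u \<in> S_space \<omega>" and lam: "0 < lam"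
  shows "\<exists>H\<ge>1. \<forall>lam'>0. \<exists>C>0. \<forall>b\<in>Basis. \<forall>w v m. set w \<subseteq> Basis \<longrightarrow> set v \<subseteq> Basis \<longrightarrow>
     cmod (LINT x|lborel. Dw w u x * of_real (x \<bullet> b) ^ m * cnj (Dw v u x)) \<le>
       C * H ^ length w * moment lam m * moment lam' (length w + length v)"
proof -
  obtain H0 where H0: "0 < H0" "\<And>m. 1 \<le> m \<Longrightarrow> real m * moment lam (m - 1) \<le> H0 * moment lam m"
    by (rule moment_ratio[OF lam]) blast
  define H where "H = H0 + 1"
  have H: "1 \<le> H" "0 < H" using H0 unfolding H_def by auto
  \<comment> \<open>For m = 0 the truncated index \<open>m - 1\<close> is harmless, since the left
    side is 0.\<close>
  have H0': "real m * moment lam (m - 1) \<le> H0 * moment lam m" for m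
    using H0 by (cases "m = 0") auto
  have l1: "0 < lam + 1" using lam by simp
  have nil: "set ([] :: 'a list) \<subseteq> Basis" by simp
  obtain C1 where C1: "C1 > 0" "\<forall>x. cmod (Dw [] u x) \<le> C1 * exp (- (lam + 1) * \<omega> (norm x))"
    using S_space_decay[OF u l1 nil] by (elim exE conjE)
  have one: "0 < (1::real)" by simp
  have iw: "integrable lborel (\<lambda>x::'a. exp (- 1 * \<omega> (norm x)))" using integrable_weight[OF one, of 0] by simp
  define I where "I = (LINT x|(lborel :: 'a measure). exp (- 1 * \<omega> (norm x)))"
  have I: "0 \<le> I" unfolding I_def by simp
  have main: "\<exists>C>0. \<forall>b\<in>Basis. \<forall>w v m. set w \<subseteq> Basis \<longrightarrow> set v \<subseteq> Basis \<longrightarrow>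
     cmod (LINT x|lborel. Dw w u x * of_real (x \<bullet> b) ^ m * cnj (Dw v u x)) \<le>
       C * H ^ length w * moment lam m * moment lam' (length w + length v)" if lam': "0 < lam'" for lam'
  proof -
    obtain C0 where C0: "C0 > 0" "\<forall>w x. set w \<subseteq> Basis \<longrightarrow> cmod (Dw w u x) \<le> C0 * moment lam' (length w)"
      using S_space_sup_bound[OF u lam'] by (elim exE conjE)
    define C where "C = C0 * C1 * (I + 1)"
    have C: "0 < C" unfolding C_def using C0(1) C1(1) I by simp
    have "cmod (LINT x|lborel. Dw w u x * of_real (x \<bullet> b) ^ m * cnj (Dw v u x)) \<le>
       C * H ^ length w * moment lam m * moment lam' (length w + length v)"
      if b: "b \<in> Basis" and w: "set w \<subseteq> Basis" and v: "set v \<subseteq> Basis" for b w v m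
      using w v
    \<comment> \<open>Letters move from \<open>w\<close> to \<open>v\<close>: the total length,
      which is the order of the \<open>lam'\<close> moment, is preserved in the main term and drops
      by one in the commutator term.\<close>
    proof (induction w arbitrary: v m)
      \<comment> \<open>The first factor is now \<open>u\<close> itself, with decay
        \<open>lam + 1\<close>: \<open>lam\<close> turns the coordinate power into
        \<open>moment lam m\<close>, and 1 keeps the integral finite. The other factor needs only
        its supremum.\<close>
      case (Nil v m)
      note v = Nil(2)
      let ?D = "(C0 * C1) * moment lam m * moment lam' (length v)"
      have "cmod (LINT x|lborel. Dw [] u x * of_real (x \<bullet> b) ^ m * cnj (Dw v u x)) \<le> (LINT x|(lborel :: 'a measure). ?D * exp (- 1 * \<omega> (norm x)))"
      proof (rule norm_LINT_le)
        show "integrable lborel (\<lambda>x. Dw [] u x * of_real (x \<bullet> b) ^ m * cnj (Dw v u x))"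
          by (rule integrable_coord_power_mult[OF S_space_Dw(1,3)[OF u nil] _ _ b, where B="C0 * moment lam' (length v)"])
             (use C0(2) v in \<open>auto intro!: continuous_intros S_space_Dw(1)[OF u]\<close>)
        show "integrable lborel (\<lambda>x::'a. ?D * exp (- 1 * \<omega> (norm x)))" by (intro integrable_mult_right iw)
        fix x
        have "\<bar>x \<bullet> b\<bar> ^ m \<le> norm x ^ m" using Basis_le_norm[OF b, of x] by (intro power_mono) auto
        also have "\<dots> \<le> moment lam m * exp (lam * \<omega> (norm x))" by (rule power_le_moment[OF lam]) simp
        finally have X: "\<bar>x \<bullet> b\<bar> ^ m \<le> moment lam m * exp (lam * \<omega> (norm x))" .
        have "norm (Dw [] u x * of_real (x \<bullet> b) ^ m * cnj (Dw v u x)) = (cmod (Dw [] u x) * \<bar>x \<bullet> b\<bar> ^ m) * cmod (Dw v u x)"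
          by (simp add: norm_mult norm_power)
        also have "\<dots> \<le> ((C1 * exp (- (lam + 1) * \<omega> (norm x))) * (moment lam m * exp (lam * \<omega> (norm x)))) * (C0 * moment lam' (length v))"
        proof (rule mult_mono)
          show "cmod (Dw [] u x) * \<bar>x \<bullet> b\<bar> ^ m \<le> (C1 * exp (- (lam + 1) * \<omega> (norm x))) * (moment lam m * exp (lam * \<omega> (norm x)))"
            using C1 by (intro mult_mono C1(2)[rule_format] X) auto
          show "cmod (Dw v u x) \<le> C0 * moment lam' (length v)" using C0(2) v by blast
        qed (use C1(1) in auto)
        also have "\<dots> = ?D * (exp (- (lam + 1) * \<omega> (norm x)) * exp (lam * \<omega> (norm x)))" by simp
        also have "exp (- (lam + 1) * \<omega> (norm x)) * exp (lam * \<omega> (norm x)) = exp (- 1 * \<omega> (norm x))"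
          by (simp add: exp_add[symmetric] algebra_simps)
        finally show "norm (Dw [] u x * of_real (x \<bullet> b) ^ m * cnj (Dw v u x)) \<le> ?D * exp (- 1 * \<omega> (norm x))" .
      qed
      also have "\<dots> = ?D * I" unfolding I_def by simp
      also have "\<dots> \<le> ?D * (I + 1)" using C0(1) C1(1) by (intro mult_left_mono) auto
      also have "\<dots> = C * H ^ length ([]::'a list) * moment lam m * moment lam' (length ([]::'a list) + length v)" unfolding C_def by simp
      finally show ?case .
    next
      case (Cons e w v m)
      then have e: "e \<in> Basis" and w: "set w \<subseteq> Basis" and ev: "set (e # v) \<subseteq> Basis" and v: "set v \<subseteq> Basis" by auto
      let ?a = "moment lam m" and ?n = "length w" and ?q = "moment lam' (length (e # w) + length v)"
      let ?P = "LINT x|lborel. Dw w u x * of_real (x \<bullet> b) ^ (m - 1) * cnj (Dw v u x)"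
      let ?Q = "LINT x|lborel. Dw w u x * of_real (x \<bullet> b) ^ m * cnj (Dw (e # v) u x)"
      have Q: "cmod ?Q \<le> C * H ^ ?n * ?a * ?q" using Cons.IH[OF w ev, of m] by simp
      have P: "cmod ?P \<le> C * H ^ ?n * moment lam (m - 1) * ?q"
      proof -
        have "cmod ?P \<le> C * H ^ ?n * moment lam (m - 1) * moment lam' (?n + length v)" by (rule Cons.IH[OF w v])
        also have "\<dots> \<le> C * H ^ ?n * moment lam (m - 1) * ?q"
          using C H by (intro mult_left_mono moment_mono lam') auto
        finally show ?thesis .
      qed
      have "cmod (LINT x|lborel. Dw (e # w) u x * of_real (x \<bullet> b) ^ m * cnj (Dw v u x)) \<le>
          cmod ?Q + cmod (of_nat m * (if e = b then - \<i> else 0) * ?P)"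
        unfolding S_space_pairing_by_parts[OF u b e w v] by (rule norm_triangle_ineq4)
      also have "\<dots> \<le> cmod ?Q + real m * cmod ?P" by (simp add: norm_mult)
      also have "\<dots> \<le> C * H ^ ?n * ?a * ?q + real m * (C * H ^ ?n * moment lam (m - 1) * ?q)"
        using Q P by (intro add_mono mult_left_mono) auto
      also have "\<dots> = (C * H ^ ?n * ?q) * (?a + real m * moment lam (m - 1))" by (simp add: algebra_simps)
      \<comment> \<open>In \<open>H = H0 + 1\<close> the 1 stands for the moved derivative and
        \<open>H0\<close> for the commutator, whose factor m is absorbed by
        \<open>moment_ratio\<close>.\<close>
      also have "\<dots> \<le> (C * H ^ ?n * ?q) * (?a + H0 * ?a)" using C H H0' by (intro mult_left_mono add_left_mono) auto
      also have "\<dots> = C * H ^ length (e # w) * ?a * ?q" unfolding H_def by (simp add: algebra_simps)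
      finally show ?case .
    qed
    then show ?thesis using C by (intro exI[of _ C]) blast
  qed
  show ?thesis by (intro exI[of _ H] conjI allI impI H(1) main)
qed

text \<open>The hard inclusion. The order of the constants is decisive: \<open>mu\<close> fixes
  \<open>lam\<close>, which fixes \<open>H\<close>, and only then is the derivative parameter
  \<open>lam0\<close> taken large enough to absorb \<open>H ^ k\<close>. In the final estimate the
  moments of order k occur with total power d + 2, matching the power of the derivative, so a root
  can be taken.\<close>

lemma S_space_subset_ultra: "S_space \<omega> \<subseteq> ultra"
proof
  fix u :: "'a \<Rightarrow> complex" assume u: "u \<in> S_space \<omega>"
  show "u \<in> ultra"
  proof (rule ultraI[OF S_space_smooth[OF u]])
    fix mu :: real assume mu: "0 < mu"
    let ?n = "DIM('a)"
    \<comment> \<open>The ball estimate has degree d + 2 in the value of the derivative: 2 from the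
      square and d from the volume of the ball. Decay is requested at rate \<open>N * mu\<close> so
      that \<open>mu\<close> remains after the N-th root.\<close>
    define N where "N = ?n + 2"
    have Nmu: "0 < real N * mu" unfolding N_def using mu by simp
    have c: "0 \<le> 2 * real ?n" by simp
    obtain lam K where K: "0 < lam" "0 < K" and K3: "\<forall>(t::real) (s::real) A. 0 \<le> s \<longrightarrow> s \<le> 2 * real ?n * t \<longrightarrow> 0 \<le> t \<longrightarrow>
        (\<forall>k. t ^ (2 * k) * A \<le> moment lam (2 * k)) \<longrightarrow> A \<le> K * exp (- (real N * mu) * \<omega> s)"
      using decay_from_moments[OF Nmu c] by (elim exE conjE)
    obtain H where H: "H \<ge> 1" and H2: "\<forall>lam'>0. \<exists>C>0. \<forall>b\<in>Basis. \<forall>w v m. set w \<subseteq> Basis \<longrightarrow> set v \<subseteq> Basis \<longrightarrow>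
       cmod (LINT x|lborel. Dw w u x * of_real (x \<bullet> b) ^ m * cnj (Dw v u x)) \<le>
       C * H ^ length w * moment lam m * moment lam' (length w + length v)"
      using S_space_weighted_L2[OF u K(1)] by (elim exE conjE)
    obtain lam0 K1 where K1: "0 < K1" "mu \<le> lam0" "\<And>k. H ^ k * moment lam0 k \<le> K1 * moment mu k"
      by (rule moment_geometric[OF mu H]) blast
    \<comment> \<open>Doubled in advance, because \<open>moment_split\<close> will halve it.\<close>
    define lam' where "lam' = 2 * lam0"
    have lam': "0 < lam'" "lam' / 2 = lam0" unfolding lam'_def using K1(2) mu by auto
    obtain C where C: "C > 0" and C2: "\<forall>b\<in>Basis. \<forall>w v m. set w \<subseteq> Basis \<longrightarrow> set v \<subseteq> Basis \<longrightarrow>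
       cmod (LINT x|lborel. Dw w u x * of_real (x \<bullet> b) ^ m * cnj (Dw v u x)) \<le>
       C * H ^ length w * moment lam m * moment lam' (length w + length v)"
      using H2[rule_format, OF lam'(1)] by (elim exE conjE)
    obtain C0 where C0: "C0 > 0" and C02: "\<forall>w x. set w \<subseteq> Basis \<longrightarrow> cmod (Dw w u x) \<le> C0 * moment lam' (length w)"
      using S_space_sup_bound[OF u lam'(1)] by (elim exE conjE)
    define V where "V = unit_ball_vol (real ?n)"
    have V: "0 < V" unfolding V_def by simp
    define Q where "Q = 4 / V * (2 * C0 * real ?n * moment lam0 1) ^ ?n * K * C"
    have Q: "0 \<le> Q" unfolding Q_def using V C0 K C by simp
    have n1: "1 \<le> real ?n" using DIM_positive[where 'a='a] by linarith
    have "cmod (Dw w u x) \<le> ((Q + 1) * K1) * moment mu (length w) * exp (- mu * \<omega> (norm x))" if w: "set w \<subseteq> Basis" for w x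
    proof -
      define k where "k = length w"
      define g where "g = Dw w u"
      \<comment> \<open>Both a Lipschitz constant and a bound for \<open>g\<close>: the order k + 1
        accounts for one extra derivative, the dimension for \<open>D_dir_Lipschitz\<close>.\<close>
      define M where "M = C0 * moment lam' (k + 1) * real ?n"
      have M: "0 < M" unfolding M_def using C0 n1 by simp
      have le: "C0 * moment lam' k \<le> C0 * moment lam' (k + 1)" using C0 lam'(1) by (intro mult_left_mono moment_mono) auto
      have "cmod (g x) \<le> C0 * moment lam' k" unfolding g_def k_def using C02 w by blast
      also have "\<dots> \<le> C0 * moment lam' (k + 1) * 1" using le by simp
      also have "\<dots> \<le> M" unfolding M_def using C0 n1 by (intro mult_left_mono) auto
      finally have gM: "cmod (g x) \<le> M" .
      have lip: "cmod (g z - g x) \<le> M * norm (z - x)" for z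
        unfolding M_def
      proof (rule D_dir_Lipschitz)
        fix b :: 'a assume b: "b \<in> Basis"
        show "has_D b g (D_dir b g)" unfolding g_def by (intro smooth_has_D smooth_Dw S_space_smooth u w b)
        show "cmod (D_dir b g y) \<le> C0 * moment lam' (k + 1)" for y
          using C02[rule_format, of "b # w" y] b w unfolding g_def k_def by simp
      qed
      have gc: "continuous_on UNIV g" unfolding g_def by (rule S_space_Dw(1)[OF u w])
      define A where "A = (cmod (g x))\<^sup>2 / 4 * (V * (cmod (g x) / (2 * M)) ^ ?n) / (C * H ^ k * moment lam' (k + k))"
      \<comment> \<open>\<open>A\<close> is the part of the ball estimate that is free of x_b,
        divided by the constants of the L2 bound, so that its coordinate moments are bounded by pure
        moments as \<open>decay_from_moments\<close> requires.\<close>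
      have A0: "0 \<le> A" unfolding A_def using C H M V by simp
      obtain b where b: "b \<in> Basis" "norm x \<le> real ?n * \<bar>x \<bullet> b\<bar>" by (rule coord_ge[of x])
      have J: "(\<bar>x \<bullet> b\<bar> / 2) ^ (2 * j) * A \<le> moment lam (2 * j)" if j: "2 * j = 0 \<or> 1 \<le> \<bar>x \<bullet> b\<bar>" for j
      proof -
        have e: "g z * of_real (z \<bullet> b) ^ (2 * j) * cnj (g z) = of_real (\<bar>z \<bullet> b\<bar> ^ (2 * j) * (cmod (g z))\<^sup>2)" for z
        proof -
          have "\<bar>z \<bullet> b\<bar> ^ (2 * j) = (z \<bullet> b) ^ (2 * j)" by (simp add: power_even_abs)
          then show ?thesis using complex_norm_square[of "g z"] by (simp add: ac_simps)
        qed
        have i: "integrable lborel (\<lambda>z. g z * of_real (z \<bullet> b) ^ (2 * j) * cnj (g z))"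
          unfolding g_def by (rule integrable_coord_power_mult[OF S_space_Dw(1,3)[OF u w] _ _ b(1), where B="C0 * moment lam' k"])
             (use C02 w k_def in \<open>auto intro!: continuous_intros S_space_Dw(1)[OF u]\<close>)
        have i': "integrable lborel (\<lambda>z. \<bar>z \<bullet> b\<bar> ^ (2 * j) * (cmod (g z))\<^sup>2)"
          using i unfolding e by (simp only: complex_of_real_integrable_eq)
        have "(\<bar>x \<bullet> b\<bar> / 2) ^ (2 * j) * ((cmod (g x))\<^sup>2 / 4 * (V * (cmod (g x) / (2 * M)) ^ ?n)) \<le> (LINT z|lborel. \<bar>z \<bullet> b\<bar> ^ (2 * j) * (cmod (g z))\<^sup>2)"
          unfolding V_def by (rule ball_integral_bound[OF M gM lip b(1) j i'])
        also have "\<dots> \<le> \<bar>LINT z|lborel. \<bar>z \<bullet> b\<bar> ^ (2 * j) * (cmod (g z))\<^sup>2\<bar>" by (rule abs_ge_self)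
        also have "\<dots> = cmod (LINT z|lborel. g z * of_real (z \<bullet> b) ^ (2 * j) * cnj (g z))"
          unfolding e integral_complex_of_real norm_of_real ..
        also have "\<dots> \<le> C * H ^ k * moment lam (2 * j) * moment lam' (k + k)"
          unfolding g_def k_def using C2 b(1) w by blast
        also have "\<dots> = moment lam (2 * j) * (C * H ^ k * moment lam' (k + k))" by simp
        finally have "((\<bar>x \<bullet> b\<bar> / 2) ^ (2 * j) * ((cmod (g x))\<^sup>2 / 4 * (V * (cmod (g x) / (2 * M)) ^ ?n))) / (C * H ^ k * moment lam' (k + k)) \<le> moment lam (2 * j)"
          using C H by (subst pos_divide_le_eq) auto
        then show ?thesis unfolding A_def by simp
      qed
      have "A \<le> K * exp (- (real N * mu) * \<omega> (norm x))"
      proof (rule K3[rule_format])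
        show "norm x \<le> 2 * real ?n * (\<bar>x \<bullet> b\<bar> / 2)" using b(2) by simp
        fix j
        show "(\<bar>x \<bullet> b\<bar> / 2) ^ (2 * j) * A \<le> moment lam (2 * j)"
        proof (cases "1 \<le> \<bar>x \<bullet> b\<bar>")
          case True then show ?thesis using J by simp
        next
          case False
          \<comment> \<open>The ball estimate with a positive power needs |x_b| \<ge> 1. Otherwise
            the power is at most 1 and the case j = 0 already gives A \<le> 1.\<close>
          have "(\<bar>x \<bullet> b\<bar> / 2) ^ (2 * j) * A \<le> 1 * A" using False A0 by (intro mult_right_mono power_le_one) auto
          also have "\<dots> \<le> 1" using J[of 0] moment_0[OF K(1)] by simp
          also have "\<dots> \<le> moment lam (2 * j)" by (rule moment_ge_1[OF K(1)])
          finally show ?thesis .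
        qed
      qed auto
      define y where "y = cmod (g x)"
      define E where "E = exp (- mu * \<omega> (norm x))"
      define a where "a = moment lam0 k"
      have EN: "exp (- (real N * mu) * \<omega> (norm x)) = E ^ N" unfolding E_def by (simp add: exp_of_nat_mult[symmetric] ac_simps)
      have pos: "0 \<le> y" "0 < E" "0 < a" unfolding y_def E_def a_def by auto
      have D: "0 < C * H ^ k * moment lam' (k + k)" using C H by simp
      have X1: "y\<^sup>2 / 4 * (V * (y / (2 * M)) ^ ?n) \<le> K * E ^ N * (C * H ^ k * moment lam' (k + k))"
        using \<open>A \<le> K * exp (- (real N * mu) * \<omega> (norm x))\<close> D unfolding A_def EN y_def[symmetric] by (subst (asm) pos_divide_le_eq) auto
      have X2: "y\<^sup>2 / 4 * (V * (y / (2 * M)) ^ ?n) = y ^ N * (V / (4 * (2 * M) ^ ?n))"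
        unfolding N_def by (simp add: power_divide power_add power2_eq_square)
      have "y ^ N * (V / (4 * (2 * M) ^ ?n)) \<le> K * E ^ N * (C * H ^ k * moment lam' (k + k))" using X1 unfolding X2 .
      moreover have "0 < V / (4 * (2 * M) ^ ?n)" using V M by simp
      ultimately have "y ^ N \<le> K * E ^ N * (C * H ^ k * moment lam' (k + k)) / (V / (4 * (2 * M) ^ ?n))"
        by (subst pos_le_divide_eq)
      also have "\<dots> = (4 / V * K * C * H ^ k * E ^ N) * ((2 * M) ^ ?n * moment lam' (k + k))" by simp
      \<comment> \<open>\<open>M ^ d\<close> contributes the power d of \<open>a\<close> and the
        moment of order k + k contributes the square: together \<open>a ^ N\<close>.\<close>
      also have "\<dots> \<le> (4 / V * K * C * H ^ k * E ^ N) * ((2 * (C0 * (a * moment lam0 1) * real ?n)) ^ ?n * (a * a))"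
      proof (intro mult_left_mono mult_mono power_mono)
        have "moment lam' (k + 1) \<le> a * moment lam0 1" unfolding a_def using moment_split[OF lam'(1), of k 1] unfolding lam'(2) .
        then show "M \<le> C0 * (a * moment lam0 1) * real ?n" unfolding M_def using C0 by (intro mult_right_mono mult_left_mono) auto
        show "moment lam' (k + k) \<le> a * a" unfolding a_def using moment_split[OF lam'(1), of k k] unfolding lam'(2) .
      qed (use M V K C H C0 pos in auto)
      also have "\<dots> = Q * H ^ k * (a * E) ^ N"
        unfolding Q_def N_def by (simp add: power_mult_distrib power_add power2_eq_square)
      \<comment> \<open>\<open>Q\<close> and \<open>H ^ k\<close> are enlarged to N-th powers so
        that the whole right side has an explicit N-th root.\<close>
      also have "\<dots> \<le> (Q + 1) ^ N * (H ^ k) ^ N * (a * E) ^ N"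
      proof (intro mult_right_mono mult_mono)
        have "Q \<le> (Q + 1) ^ 1" by simp
        also have "\<dots> \<le> (Q + 1) ^ N" using Q unfolding N_def by (intro power_increasing) auto
        finally show "Q \<le> (Q + 1) ^ N" .
        have "(H ^ k) ^ 1 \<le> (H ^ k) ^ N" using H unfolding N_def by (intro power_increasing) auto
        then show "H ^ k \<le> (H ^ k) ^ N" by simp
      qed (use Q H pos in auto)
      also have "\<dots> = ((Q + 1) * (H ^ k * a) * E) ^ N" by (simp add: power_mult_distrib)
      finally have yN: "y ^ N \<le> ((Q + 1) * (H ^ k * a) * E) ^ N" .
      have "y \<le> (Q + 1) * (H ^ k * a) * E"
      proof (rule power_le_imp_le_base)
        show "y ^ Suc (N - 1) \<le> ((Q + 1) * (H ^ k * a) * E) ^ Suc (N - 1)" using yN unfolding N_def by simp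
        show "0 \<le> (Q + 1) * (H ^ k * a) * E" using Q H pos by simp
      qed
      also have "\<dots> \<le> (Q + 1) * (K1 * moment mu k) * E"
        using K1(3)[of k] Q pos unfolding a_def by (intro mult_right_mono mult_left_mono) auto
      finally show ?thesis unfolding y_def g_def k_def E_def by (simp add: ac_simps)
    qed
    then show "\<exists>C. \<forall>w x. set w \<subseteq> Basis \<longrightarrow> cmod (Dw w u x) \<le> C * moment mu (length w) * exp (- mu * \<omega> (norm x))"
      by (intro exI[of _ "(Q + 1) * K1"] allI impI)
  qed
qed

lemma ultra_eq_S_space: "ultra = S_space \<omega>"
  using ultra_subset_S_space S_space_subset_ultra by blast

end

section \<open>The topologies of the space and its strong dual\<close>

text \<open>Balls around points of \<open>V\<close> are subbasic, so one ball around each point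
  inside the set suffices. As \<open>P\<close> may hold arbitrary real functions, that a ball
  contains its centre is an explicit hypothesis.\<close>

lemma openin_seminorm_topologyI:
  assumes "W \<subseteq> V" and "\<And>p g. p \<in> P \<Longrightarrow> g \<in> V \<Longrightarrow> p (\<lambda>x. g x - g x) \<le> 0"
    and "\<And>g. g \<in> W \<Longrightarrow> \<exists>p\<in>P. \<exists>e>0. \<forall>h\<in>V. p (\<lambda>x. h x - g x) < e \<longrightarrow> h \<in> W"
  shows "openin (seminorm_topology V P) W"
proof (subst openin_subopen, intro ballI)
  fix g assume g: "g \<in> W"
  from assms(3)[OF g] obtain p e where p: "p \<in> P" "0 < e" "\<forall>h\<in>V. p (\<lambda>x. h x - g x) < e \<longrightarrow> h \<in> W"
    by (elim bexE exE conjE)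
  have gV: "g \<in> V" using g assms(1) by blast
  let ?T = "{h \<in> V. p (\<lambda>x. h x - g x) < e}"
  have "openin (seminorm_topology V P) ?T"
    unfolding seminorm_topology_def openin_topology_generated_by_iff
    by (rule generate_topology_on.Basis) (use p gV in blast)
  moreover have "g \<in> ?T" using gV p(2) assms(2)[OF p(1) gV] by simp
  moreover have "?T \<subseteq> W" using p(3) by blast
  ultimately show "\<exists>T. openin (seminorm_topology V P) T \<and> g \<in> T \<and> T \<subseteq> W" by blast
qed

text \<open>\<open>z\<close> plays the part of the zero element, and the triangle inequality through
  \<open>z\<close> is all that is asked of the members of \<open>P\<close>. The finite set
  \<open>F\<close> grows by the intersections in the induction over generated open sets.\<close>

lemma seminorm_topology_nhd:
  assumes "openin (seminorm_topology V P) W" and "z \<in> W"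
    and tri: "\<And>p f g. p \<in> P \<Longrightarrow> f \<in> V \<Longrightarrow> g \<in> V \<Longrightarrow> p (\<lambda>x. g x - f x) \<le> p g + p (\<lambda>x. z x - f x)"
  shows "\<exists>F e. finite F \<and> F \<subseteq> P \<and> 0 < e \<and> (\<forall>g\<in>V. (\<forall>p\<in>F. p g < e) \<longrightarrow> g \<in> W)"
proof -
  have "generate_topology_on {{g \<in> V. p (\<lambda>x. g x - f x) < e} | p f e. p \<in> P \<and> f \<in> V \<and> 0 < e} W"
    using assms(1) unfolding seminorm_topology_def openin_topology_generated_by_iff .
  then have "z \<in> W \<longrightarrow> (\<exists>F e. finite F \<and> F \<subseteq> P \<and> 0 < e \<and> (\<forall>g\<in>V. (\<forall>p\<in>F. p g < e) \<longrightarrow> g \<in> W))"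
  proof (induction rule: generate_topology_on.induct)
    case Empty
    then show ?case by simp
  next
    case (Int A B)
    show ?case
    proof
      assume "z \<in> A \<inter> B"
      with Int.IH obtain F e F' e' where *: "finite F" "F \<subseteq> P" "0 < e" "\<forall>g\<in>V. (\<forall>p\<in>F. p g < e) \<longrightarrow> g \<in> A"
        "finite F'" "F' \<subseteq> P" "0 < e'" "\<forall>g\<in>V. (\<forall>p\<in>F'. p g < e') \<longrightarrow> g \<in> B" by (elim IntE impE exE conjE) simp_all
      show "\<exists>F e. finite F \<and> F \<subseteq> P \<and> 0 < e \<and> (\<forall>g\<in>V. (\<forall>p\<in>F. p g < e) \<longrightarrow> g \<in> A \<inter> B)"
      proof (intro exI[of _ "F \<union> F'"] exI[of _ "min e e'"] conjI ballI impI)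
        fix g assume g: "g \<in> V" and "\<forall>p\<in>F \<union> F'. p g < min e e'"
        then have "\<forall>p\<in>F. p g < e" "\<forall>p\<in>F'. p g < e'" by simp_all
        then show "g \<in> A \<inter> B" using *(4)[rule_format, OF g] *(8)[rule_format, OF g] by blast
      qed (use * in simp_all)
    qed
  next
    case (UN K)
    show ?case
    proof
      assume "z \<in> \<Union>K"
      then obtain A where A: "A \<in> K" "z \<in> A" by blast
      from UN.IH[OF A(1)] A(2) obtain F e where *: "finite F" "F \<subseteq> P" "0 < e" "\<forall>g\<in>V. (\<forall>p\<in>F. p g < e) \<longrightarrow> g \<in> A"
        by (elim impE exE conjE) simp_all
      then show "\<exists>F e. finite F \<and> F \<subseteq> P \<and> 0 < e \<and> (\<forall>g\<in>V. (\<forall>p\<in>F. p g < e) \<longrightarrow> g \<in> \<Union>K)"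
        using A(1) by (intro exI[of _ F] exI[of _ e] conjI) (assumption, assumption, assumption, blast)
    qed
  next
    case (Basis A)
    then obtain p f e where A: "A = {g \<in> V. p (\<lambda>x. g x - f x) < e}" "p \<in> P" "f \<in> V" by blast
    show ?case
    proof
      assume z: "z \<in> A"
      show "\<exists>F e. finite F \<and> F \<subseteq> P \<and> 0 < e \<and> (\<forall>g\<in>V. (\<forall>p\<in>F. p g < e) \<longrightarrow> g \<in> A)"
      proof (intro exI[of _ "{p}"] exI[of _ "e - p (\<lambda>x. z x - f x)"] conjI ballI impI)
        show "0 < e - p (\<lambda>x. z x - f x)" using z unfolding A(1) by simp
        fix g assume g: "g \<in> V" and "\<forall>q\<in>{p}. q g < e - p (\<lambda>x. z x - f x)"
        then have "p g < e - p (\<lambda>x. z x - f x)" by simp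
        then show "g \<in> A" using tri[OF A(2,3) g] g unfolding A(1) by simp
      qed (use A(2) in simp_all)
    qed
  qed
  then show ?thesis using assms(2) by simp
qed

context weight begin

section \<open>Linear structure and seminorms of \<open>S_space\<close>\<close>

lemma S_space_lin:
  fixes f g :: "'a::euclidean_space \<Rightarrow> complex"
  assumes "f \<in> S_space \<omega>" "g \<in> S_space \<omega>"
  shows "(\<lambda>x. c * f x + d * g x) \<in> S_space \<omega>"
  by (rule ultra_lin[unfolded ultra_eq_S_space, OF assms])

lemma S_space_scale:
  fixes f :: "'a::euclidean_space \<Rightarrow> complex"
  assumes "f \<in> S_space \<omega>"
  shows "(\<lambda>x. c * f x) \<in> S_space \<omega>"
  using S_space_lin[OF assms assms, of c 0] by simp

lemma S_space_diff:
  fixes f g :: "'a::euclidean_space \<Rightarrow> complex"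
  assumes "f \<in> S_space \<omega>" "g \<in> S_space \<omega>"
  shows "(\<lambda>x. f x - g x) \<in> S_space \<omega>"
  using S_space_lin[OF assms, of 1 "-1"] by simp

lemma Dw_zero: "set w \<subseteq> Basis \<Longrightarrow> Dw w (\<lambda>_::'a::euclidean_space. 0) = (\<lambda>_. 0)"
proof (induction w)
  case (Cons b w)
  have "has_D b (\<lambda>_::'a. 0) (\<lambda>_. 0)" unfolding has_D_def by simp
  from has_D_D_dir[OF this] show ?case using Cons by simp
qed simp

lemma S_space_zero: "(\<lambda>_::'a::euclidean_space. 0) \<in> S_space \<omega>"
proof -
  have "(\<lambda>_::'a. 0) \<in> ultra"
  proof (rule ultraI)
    show "smooth (\<lambda>_::'a. 0)"
    proof (rule smooth_coinduct[where P="\<lambda>h. h = (\<lambda>_. 0)"])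
      fix f :: "'a \<Rightarrow> complex" assume f: "f = (\<lambda>_. 0)"
      have "has_D b f f" for b unfolding has_D_def f by simp
      then show "continuous_on UNIV f \<and> (\<forall>b\<in>Basis. \<exists>g. has_D b f g \<and> g = (\<lambda>_. 0))" using f by simp
    qed simp
  qed (auto simp: Dw_zero intro!: exI[of _ 0])
  then show ?thesis unfolding ultra_eq_S_space .
qed

text \<open>Here the identification with \<open>ultra\<close> pays off: it makes the
  \<open>SUP\<close> over all multi-indices and points a genuine supremum.\<close>

lemma S_seminorm_bdd:
  fixes f :: "'a::euclidean_space \<Rightarrow> complex"
  assumes f: "f \<in> S_space \<omega>" and lam: "0 < lam"
  shows "bdd_above (range (\<lambda>(\<alpha>, x). cmod (D_multi \<alpha> f x)
        * exp (- lam * young_conj \<omega> (real (mi_length \<alpha>) / lam)) * exp (lam * \<omega> (norm x))))"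
proof -
  have fu: "f \<in> ultra" using f unfolding ultra_eq_S_space .
  obtain C where C: "0 < C" "\<And>w x. set w \<subseteq> Basis \<Longrightarrow> cmod (Dw w f x) \<le> C * moment lam (length w) * exp (- lam * \<omega> (norm x))"
    by (rule ultraD[OF fu lam]) blast
  show ?thesis
  proof (rule bdd_aboveI2)
    fix p :: "('a \<Rightarrow> nat) \<times> 'a"
    obtain \<alpha> x where p: "p = (\<alpha>, x)" by (cases p)
    let ?w = "mi_word \<alpha>"
    let ?m = "moment lam (mi_length \<alpha>)"
    have "cmod (D_multi \<alpha> f x) \<le> C * ?m * exp (- lam * \<omega> (norm x))"
      using C(2)[OF mi_word_Basis[of \<alpha>], of x] unfolding D_multi_Dw length_mi_word .
    moreover have "exp (- lam * young_conj \<omega> (real (mi_length \<alpha>) / lam)) = inverse ?m"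
      unfolding moment_def by (simp add: exp_minus)
    ultimately have "cmod (D_multi \<alpha> f x) * exp (- lam * young_conj \<omega> (real (mi_length \<alpha>) / lam)) * exp (lam * \<omega> (norm x)) \<le>
        (C * ?m * exp (- lam * \<omega> (norm x))) * inverse ?m * exp (lam * \<omega> (norm x))"
      by (simp only:) (intro mult_right_mono, auto)
    also have "\<dots> = C" by (simp add: exp_minus field_simps)
    finally show "(case p of (\<alpha>, x) \<Rightarrow> cmod (D_multi \<alpha> f x) * exp (- lam * young_conj \<omega> (real (mi_length \<alpha>) / lam)) * exp (lam * \<omega> (norm x))) \<le> C" unfolding p prod.case .
  qed
qed

text \<open>With \<open>S_seminorm_le\<close> it shows the seminorm to be the least constant in the
  bound over words, and later estimates speak of words only.\<close>

lemma S_seminorm_ge: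
  fixes f :: "'a::euclidean_space \<Rightarrow> complex"
  assumes f: "f \<in> S_space \<omega>" and lam: "0 < lam" and w: "set w \<subseteq> Basis"
  shows "cmod (Dw w f x) \<le> S_seminorm \<omega> lam f * moment lam (length w) * exp (- lam * \<omega> (norm x))"
proof -
  obtain \<alpha> where \<alpha>: "D_multi \<alpha> f = Dw w f" "mi_length \<alpha> = length w" by (rule Dw_D_multi[OF S_space_smooth[OF f] w])
  let ?F = "\<lambda>(\<alpha>, x). cmod (D_multi \<alpha> f x) * exp (- lam * young_conj \<omega> (real (mi_length \<alpha>) / lam)) * exp (lam * \<omega> (norm x))"
  have "?F (\<alpha>, x) \<le> S_seminorm \<omega> lam f"
    unfolding S_seminorm_def by (rule cSUP_upper[OF UNIV_I S_seminorm_bdd[OF f lam]])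
  then have "cmod (Dw w f x) * inverse (moment lam (length w)) * exp (lam * \<omega> (norm x)) \<le> S_seminorm \<omega> lam f"
    unfolding moment_def by (simp add: \<alpha> exp_minus)
  then have *: "cmod (Dw w f x) * inverse (moment lam (length w)) * exp (lam * \<omega> (norm x)) * (moment lam (length w) * exp (- lam * \<omega> (norm x)))
      \<le> S_seminorm \<omega> lam f * (moment lam (length w) * exp (- lam * \<omega> (norm x)))"
    by (rule mult_right_mono) simp
  have **: "cmod (Dw w f x) * inverse (moment lam (length w)) * exp (lam * \<omega> (norm x)) * (moment lam (length w) * exp (- lam * \<omega> (norm x)))
      = cmod (Dw w f x)"
    by (simp add: exp_minus field_simps)
  show ?thesis using *[unfolded **] by (simp only: mult.assoc)
qed

lemma S_seminorm_le:
  fixes f :: "'a::euclidean_space \<Rightarrow> complex"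
  assumes "\<And>w x. set w \<subseteq> Basis \<Longrightarrow> cmod (Dw w f x) \<le> M * moment lam (length w) * exp (- lam * \<omega> (norm x))"
  shows "S_seminorm \<omega> lam f \<le> M"
  unfolding S_seminorm_def
proof (rule cSUP_least, simp)
  fix p :: "('a \<Rightarrow> nat) \<times> 'a"
  obtain \<alpha> x where p: "p = (\<alpha>, x)" by (cases p)
  let ?m = "moment lam (mi_length \<alpha>)"
  have "cmod (D_multi \<alpha> f x) \<le> M * ?m * exp (- lam * \<omega> (norm x))"
    using assms[OF mi_word_Basis[of \<alpha>], of x] unfolding D_multi_Dw length_mi_word .
  moreover have "exp (- lam * young_conj \<omega> (real (mi_length \<alpha>) / lam)) = inverse ?m"
    unfolding moment_def by (simp add: exp_minus)
  ultimately have "cmod (D_multi \<alpha> f x) * exp (- lam * young_conj \<omega> (real (mi_length \<alpha>) / lam)) * exp (lam * \<omega> (norm x)) \<le>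
      (M * ?m * exp (- lam * \<omega> (norm x))) * inverse ?m * exp (lam * \<omega> (norm x))"
    by (simp only:) (intro mult_right_mono, auto)
  also have "\<dots> = M" by (simp add: exp_minus field_simps)
  finally show "(case p of (\<alpha>, x) \<Rightarrow> cmod (D_multi \<alpha> f x) * exp (- lam * young_conj \<omega> (real (mi_length \<alpha>) / lam)) * exp (lam * \<omega> (norm x))) \<le> M" unfolding p prod.case .
qed

lemma S_seminorm_nonneg:
  fixes f :: "'a::euclidean_space \<Rightarrow> complex"
  assumes "f \<in> S_space \<omega>" "0 < lam"
  shows "0 \<le> S_seminorm \<omega> lam f"
proof -
  have "0 \<le> cmod (Dw [] f 0)" by simp
  also have "\<dots> \<le> S_seminorm \<omega> lam f * moment lam (length ([]::'a list)) * exp (- lam * \<omega> (norm (0::'a)))" by (rule S_seminorm_ge[OF assms]) simp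
  also have "\<dots> = S_seminorm \<omega> lam f" using moment_0[OF assms(2)] om_zero[of 0] by simp
  finally show ?thesis .
qed

lemma S_seminorm_lin:
  fixes f g :: "'a::euclidean_space \<Rightarrow> complex"
  assumes f: "f \<in> S_space \<omega>" and g: "g \<in> S_space \<omega>" and lam: "0 < lam"
  shows "S_seminorm \<omega> lam (\<lambda>x. c * f x + d * g x) \<le> cmod c * S_seminorm \<omega> lam f + cmod d * S_seminorm \<omega> lam g"
proof (rule S_seminorm_le)
  fix w :: "'a list" and x :: 'a assume w: "set w \<subseteq> Basis"
  let ?M = "moment lam (length w) * exp (- lam * \<omega> (norm x))"
  have "cmod (Dw w (\<lambda>x. c * f x + d * g x) x) \<le> cmod c * cmod (Dw w f x) + cmod d * cmod (Dw w g x)"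
    unfolding Dw_lin[OF S_space_smooth[OF f] S_space_smooth[OF g] w] by (rule order_trans[OF norm_triangle_ineq]) (simp add: norm_mult)
  also have "\<dots> \<le> cmod c * (S_seminorm \<omega> lam f * ?M) + cmod d * (S_seminorm \<omega> lam g * ?M)"
    using S_seminorm_ge[OF f lam w, of x] S_seminorm_ge[OF g lam w, of x] 
    by (intro add_mono mult_left_mono) (auto simp: mult.assoc)
  finally show "cmod (Dw w (\<lambda>x. c * f x + d * g x) x) \<le> (cmod c * S_seminorm \<omega> lam f + cmod d * S_seminorm \<omega> lam g) * moment lam (length w) * exp (- lam * \<omega> (norm x))"
    by (simp add: algebra_simps)
qed

lemma S_seminorm_scale:
  fixes f :: "'a::euclidean_space \<Rightarrow> complex"
  assumes "f \<in> S_space \<omega>" "0 < lam"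
  shows "S_seminorm \<omega> lam (\<lambda>x. c * f x) \<le> cmod c * S_seminorm \<omega> lam f"
  using S_seminorm_lin[OF assms(1,1,2), of c 0] by simp

lemma S_seminorm_diff_triangle:
  fixes f g h :: "'a::euclidean_space \<Rightarrow> complex"
  assumes "f \<in> S_space \<omega>" "g \<in> S_space \<omega>" "h \<in> S_space \<omega>" "0 < lam"
  shows "S_seminorm \<omega> lam (\<lambda>x. g x - f x) \<le> S_seminorm \<omega> lam (\<lambda>x. g x - h x) + S_seminorm \<omega> lam (\<lambda>x. h x - f x)"
  using S_seminorm_lin[OF S_space_diff[OF assms(2,3)] S_space_diff[OF assms(3,1)] assms(4), of 1 1] by simp

lemma S_seminorm_zero: "S_seminorm \<omega> lam (\<lambda>_::'a::euclidean_space. 0) \<le> 0"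
  by (rule S_seminorm_le) (simp add: Dw_zero)

lemma S_seminorm_mono:
  fixes f :: "'a::euclidean_space \<Rightarrow> complex"
  assumes f: "f \<in> S_space \<omega>" and mu: "0 < mu" "mu \<le> lam"
  shows "S_seminorm \<omega> mu f \<le> S_seminorm \<omega> lam f"
proof (rule S_seminorm_le)
  fix w :: "'a list" and x :: 'a assume w: "set w \<subseteq> Basis"
  have lam: "0 < lam" using mu by simp
  have "cmod (Dw w f x) \<le> S_seminorm \<omega> lam f * moment lam (length w) * exp (- lam * \<omega> (norm x))"
    by (rule S_seminorm_ge[OF f lam w])
  also have "\<dots> \<le> S_seminorm \<omega> lam f * moment mu (length w) * exp (- mu * \<omega> (norm x))"
    using S_seminorm_nonneg[OF f lam] om_nonneg[of "norm x"] mu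
    by (intro mult_mono moment_antimono mult_left_mono) (auto intro: mult_right_mono)
  finally show "cmod (Dw w f x) \<le> S_seminorm \<omega> lam f * moment mu (length w) * exp (- mu * \<omega> (norm x))" .
qed

lemma topspace_S: "topspace (S_topology \<omega> :: ('a::euclidean_space \<Rightarrow> complex) topology) = S_space \<omega>"
  unfolding S_topology_def by (rule topspace_seminorm_topology) (auto intro: exI[of _ 1])

lemma S_bounded_zero: "S_bounded \<omega> {\<lambda>_::'a::euclidean_space. 0}"
  unfolding S_bounded_def using S_space_zero by simp

lemma topspace_S_dual: "topspace (S_dual_topology \<omega> :: (('a::euclidean_space \<Rightarrow> complex) \<Rightarrow> complex) topology) = S_dual \<omega>"
  unfolding S_dual_topology_def using S_bounded_zero by (intro topspace_seminorm_topology) blast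

lemma openin_SI:
  fixes W :: "('a::euclidean_space \<Rightarrow> complex) set"
  assumes "W \<subseteq> S_space \<omega>"
    and "\<And>g. g \<in> W \<Longrightarrow> \<exists>lam>0. \<exists>e>0. \<forall>h\<in>S_space \<omega>. S_seminorm \<omega> lam (\<lambda>x. h x - g x) < e \<longrightarrow> h \<in> W"
  shows "openin (S_topology \<omega>) W"
  unfolding S_topology_def
proof (rule openin_seminorm_topologyI[OF assms(1)])
  fix p :: "('a \<Rightarrow> complex) \<Rightarrow> real" and g :: "'a \<Rightarrow> complex" 
  assume "p \<in> {S_seminorm \<omega> lam |lam. 0 < lam}"
  then show "p (\<lambda>x. g x - g x) \<le> 0" using S_seminorm_zero by auto
next
  fix g assume "g \<in> W"
  from assms(2)[OF this] show "\<exists>p\<in>{S_seminorm \<omega> lam |lam. 0 < lam}. \<exists>e>0. \<forall>h\<in>S_space \<omega>. p (\<lambda>x. h x - g x) < e \<longrightarrow> h \<in> W"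
    by blast
qed

section \<open>Continuous functionals as functionals bounded by one seminorm\<close>

lemma S_dual_lin:
  assumes "u \<in> S_dual \<omega>" "f \<in> S_space \<omega>" "g \<in> S_space \<omega>"
  shows "u (\<lambda>x. c * f x + d * g x) = c * u f + d * u g"
proof -
  have "\<forall>f\<in>S_space \<omega>. \<forall>g\<in>S_space \<omega>. \<forall>c d. u (\<lambda>x. c * f x + d * g x) = c * u f + d * u g"
    using assms(1) unfolding S_dual_def by simp
  then show ?thesis using assms(2,3) by blast
qed

lemma S_dual_scale:
  assumes "u \<in> S_dual \<omega>" "f \<in> S_space \<omega>"
  shows "u (\<lambda>x. c * f x) = c * u f"
  using S_dual_lin[OF assms assms(2), of c 0] by simp

lemma S_dual_off:
  assumes "u \<in> S_dual \<omega>" "f \<notin> S_space \<omega>"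
  shows "u f = 0"
  using assms unfolding S_dual_def by simp

text \<open>Continuity at 0 involves finitely many seminorms; since they increase with
  \<open>lam\<close>, one of them dominates all. Scaling \<open>f\<close> into the neighbourhood
  then gives the linear bound.\<close>

lemma S_dual_bound:
  fixes u :: "('a::euclidean_space \<Rightarrow> complex) \<Rightarrow> complex"
  assumes u: "u \<in> S_dual \<omega>"
  shows "\<exists>lam>0. \<exists>C>0. \<forall>f\<in>S_space \<omega>. cmod (u f) \<le> C * S_seminorm \<omega> lam f"
proof -
  have cont: "continuous_map (S_topology \<omega>) euclidean u" using u unfolding S_dual_def by simp
  define W where "W = {f \<in> topspace (S_topology \<omega>). u f \<in> ball 0 1}"
  have W: "openin (seminorm_topology (S_space \<omega>) {S_seminorm \<omega> lam |lam. 0 < lam}) W"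
    unfolding W_def S_topology_def[symmetric] by (rule openin_continuous_map_preimage[OF cont]) simp
  have "u (\<lambda>x. 0) = 0" using S_dual_scale[OF u S_space_zero, of 0] by simp
  then have z: "(\<lambda>_. 0) \<in> W" unfolding W_def topspace_S using S_space_zero by simp
  have "\<exists>F e. finite F \<and> F \<subseteq> {S_seminorm \<omega> lam |lam. 0 < lam} \<and> 0 < e \<and> (\<forall>g\<in>S_space \<omega>. (\<forall>p\<in>F. p g < e) \<longrightarrow> g \<in> W)"
  proof (rule seminorm_topology_nhd[OF W z])
    fix p :: "('a \<Rightarrow> complex) \<Rightarrow> real" and f g :: "'a \<Rightarrow> complex"
    assume "p \<in> {S_seminorm \<omega> lam |lam. 0 < lam}" and f: "f \<in> S_space \<omega>" and g: "g \<in> S_space \<omega>"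
    then obtain lam where p: "p = S_seminorm \<omega> lam" "0 < lam" by blast
    show "p (\<lambda>x. g x - f x) \<le> p g + p (\<lambda>x. 0 - f x)"
      unfolding p(1) using S_seminorm_diff_triangle[OF f g S_space_zero p(2)] by simp
  qed
  then obtain F e where F: "finite F" "F \<subseteq> {S_seminorm \<omega> lam |lam. 0 < lam}" and e: "0 < e" 
    and FW: "\<forall>g\<in>S_space \<omega>. (\<forall>p\<in>F. p g < e) \<longrightarrow> g \<in> W" by (elim exE conjE)
  have "\<exists>lam>0. \<forall>p\<in>F. \<forall>f\<in>S_space \<omega>. p f \<le> S_seminorm \<omega> lam f"
    using F
  proof (induction F rule: finite_induct)
    case empty
    show ?case by (intro exI[of _ 1]) simp
  next
    case (insert q F)
    then obtain lam where lam: "0 < lam" "\<forall>p\<in>F. \<forall>f\<in>S_space \<omega>. p f \<le> S_seminorm \<omega> lam f" by auto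
    obtain mu where mu: "0 < mu" "q = S_seminorm \<omega> mu" using insert.prems by blast
    show ?case
    proof (intro exI[of _ "max lam mu"] conjI ballI)
      show "0 < max lam mu" using lam by simp
      fix p and f :: "'a \<Rightarrow> complex" assume "p \<in> insert q F" and f: "f \<in> S_space \<omega>"
      then consider "p = q" | "p \<in> F" by blast
      then show "p f \<le> S_seminorm \<omega> (max lam mu) f"
      proof cases
        case 1
        then show ?thesis using S_seminorm_mono[OF f mu(1), of "max lam mu"] mu(2) by simp
      next
        case 2
        then have "p f \<le> S_seminorm \<omega> lam f" using lam(2) f by simp
        then show ?thesis using S_seminorm_mono[OF f lam(1), of "max lam mu"] by simp
      qed
    qed
  qed
  then obtain lam where lam: "0 < lam" and le: "\<forall>p\<in>F. \<forall>f\<in>S_space \<omega>. p f \<le> S_seminorm \<omega> lam f" by (elim exE conjE)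
  have "cmod (u f) \<le> (1 / e) * S_seminorm \<omega> lam f" if f: "f \<in> S_space \<omega>" for f
  proof (rule field_le_epsilon)
    fix r :: real assume r: "0 < r"
    let ?s = "S_seminorm \<omega> lam f"
    \<comment> \<open>The added \<open>r * e\<close> keeps \<open>s\<close> positive when the
      seminorm of \<open>f\<close> vanishes; after division by \<open>e\<close> it is the error
      \<open>r\<close> that tends to 0.\<close>
    define s where "s = ?s + r * e"
    have s0: "0 \<le> ?s" by (rule S_seminorm_nonneg[OF f lam])
    have s: "0 < s" "?s < s" using s0 r e unfolding s_def by (auto simp: add_nonneg_pos)
    let ?g = "\<lambda>x. of_real (e / s) * f x"
    have g: "?g \<in> S_space \<omega>" by (rule S_space_scale[OF f])
    have "S_seminorm \<omega> lam ?g \<le> (e / s) * ?s" using S_seminorm_scale[OF f lam, of "of_real (e / s)"] e s(1) by (simp add: norm_divide)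
    also have "\<dots> < e" using e s by (simp add: field_simps)
    finally have lt: "S_seminorm \<omega> lam ?g < e" .
    have "\<forall>p\<in>F. p ?g < e"
    proof
      fix p assume "p \<in> F"
      then have "p ?g \<le> S_seminorm \<omega> lam ?g" using le g by blast
      then show "p ?g < e" using lt by simp
    qed
    then have "?g \<in> W" using FW g by blast
    then have "cmod (u ?g) < 1" unfolding W_def by simp
    then have "(e / s) * cmod (u f) < 1" unfolding S_dual_scale[OF u f] using e s(1) by (simp add: norm_mult norm_divide)
    then have "cmod (u f) < s / e" using e s(1) by (simp add: field_simps)
    also have "s / e = (1 / e) * ?s + r" unfolding s_def using e by (simp add: field_simps)
    finally show "cmod (u f) \<le> (1 / e) * ?s + r" by simp
  qed
  then have "\<exists>C>0. \<forall>f\<in>S_space \<omega>. cmod (u f) \<le> C * S_seminorm \<omega> lam f"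
    using e by (intro exI[of _ "1 / e"]) simp
  with lam show ?thesis by blast
qed

text \<open>The converse of \<open>S_dual_bound\<close>: membership in the dual becomes an estimate
  by a single seminorm.\<close>

lemma S_dualI:
  fixes u :: "('a::euclidean_space \<Rightarrow> complex) \<Rightarrow> complex"
  assumes lin: "\<And>f g c d. f \<in> S_space \<omega> \<Longrightarrow> g \<in> S_space \<omega> \<Longrightarrow> u (\<lambda>x. c * f x + d * g x) = c * u f + d * u g"
    and off: "\<And>f. f \<notin> S_space \<omega> \<Longrightarrow> u f = 0"
    and lam: "0 < lam" and bd: "\<And>f. f \<in> S_space \<omega> \<Longrightarrow> cmod (u f) \<le> C * S_seminorm \<omega> lam f"
  shows "u \<in> S_dual \<omega>"
proof -
  have "continuous_map (S_topology \<omega>) euclidean u"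
    unfolding continuous_map_def
  proof (intro conjI allI impI)
    show "u \<in> topspace (S_topology \<omega>) \<rightarrow> topspace euclidean" by simp
    fix U :: "complex set" assume "openin euclidean U"
    then have U: "open U" by simp
    show "openin (S_topology \<omega>) {x \<in> topspace (S_topology \<omega>). u x \<in> U}"
      unfolding topspace_S
    proof (rule openin_SI)
      fix g assume "g \<in> {x \<in> S_space \<omega>. u x \<in> U}"
      then have g: "g \<in> S_space \<omega>" "u g \<in> U" by auto
      obtain r where r: "0 < r" "\<forall>z. dist z (u g) < r \<longrightarrow> z \<in> U" using U g(2) unfolding open_dist by blast
      show "\<exists>lam>0. \<exists>e>0. \<forall>h\<in>S_space \<omega>. S_seminorm \<omega> lam (\<lambda>x. h x - g x) < e \<longrightarrow> h \<in> {x \<in> S_space \<omega>. u x \<in> U}"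
      proof (rule exI[of _ lam], rule conjI[OF lam], rule exI[of _ "r / (\<bar>C\<bar> + 1)"], intro conjI ballI impI)
        show "0 < r / (\<bar>C\<bar> + 1)" using r by simp
        fix h assume h: "h \<in> S_space \<omega>" and lt: "S_seminorm \<omega> lam (\<lambda>x. h x - g x) < r / (\<bar>C\<bar> + 1)"
        have d: "(\<lambda>x. h x - g x) \<in> S_space \<omega>" by (rule S_space_diff[OF h g(1)])
        have "cmod (u h - u g) = cmod (u (\<lambda>x. h x - g x))" using lin[OF h g(1), of 1 "-1"] by simp
        also have "\<dots> \<le> C * S_seminorm \<omega> lam (\<lambda>x. h x - g x)" by (rule bd[OF d])
        also have "\<dots> \<le> (\<bar>C\<bar> + 1) * S_seminorm \<omega> lam (\<lambda>x. h x - g x)"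
          using S_seminorm_nonneg[OF d lam] by (intro mult_right_mono) auto
        also have "\<dots> < r" using lt by (simp add: field_simps)
        finally show "h \<in> {x \<in> S_space \<omega>. u x \<in> U}" using h r(2) by (simp add: dist_norm)
      qed
    qed auto
  qed
  then show ?thesis unfolding S_dual_def using lin off by simp
qed

lemma S_dual_comb:
  fixes u v :: "('a::euclidean_space \<Rightarrow> complex) \<Rightarrow> complex"
  assumes u: "u \<in> S_dual \<omega>" and v: "v \<in> S_dual \<omega>"
  shows "(\<lambda>f. c * u f + d * v f) \<in> S_dual \<omega>"
proof -
  obtain lam C where 1: "0 < lam" "0 < C" "\<forall>f\<in>S_space \<omega>. cmod (u f) \<le> C * S_seminorm \<omega> lam f" using S_dual_bound[OF u] by (elim exE conjE)
  obtain mu D where 2: "0 < mu" "0 < D" "\<forall>f\<in>S_space \<omega>. cmod (v f) \<le> D * S_seminorm \<omega> mu f" using S_dual_bound[OF v] by (elim exE conjE)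
  let ?l = "max lam mu"
  show ?thesis
  proof (rule S_dualI[where lam="?l" and C="cmod c * C + cmod d * D"])
    show "c * u (\<lambda>x. c' * f x + d' * g x) + d * v (\<lambda>x. c' * f x + d' * g x) = c' * (c * u f + d * v f) + d' * (c * u g + d * v g)"
      if "f \<in> S_space \<omega>" "g \<in> S_space \<omega>" for f g c' d'
      unfolding S_dual_lin[OF u that] S_dual_lin[OF v that] by (simp add: algebra_simps)
    show "c * u f + d * v f = 0" if "f \<notin> S_space \<omega>" for f using S_dual_off[OF u that] S_dual_off[OF v that] by simp
    show "0 < ?l" using 1(1) by simp
    fix f :: "'a \<Rightarrow> complex" assume f: "f \<in> S_space \<omega>"
    have "cmod (u f) \<le> C * S_seminorm \<omega> ?l f"
      by (rule order_trans[OF 1(3)[rule_format, OF f]]) (use 1(2) in \<open>auto intro!: mult_left_mono S_seminorm_mono[OF f 1(1)]\<close>)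
    moreover have "cmod (v f) \<le> D * S_seminorm \<omega> ?l f"
      by (rule order_trans[OF 2(3)[rule_format, OF f]]) (use 2(2) in \<open>auto intro!: mult_left_mono S_seminorm_mono[OF f 2(1)]\<close>)
    ultimately have "cmod c * cmod (u f) + cmod d * cmod (v f) \<le> cmod c * (C * S_seminorm \<omega> ?l f) + cmod d * (D * S_seminorm \<omega> ?l f)"
      by (intro add_mono mult_left_mono) auto
    moreover have "cmod (c * u f + d * v f) \<le> cmod c * cmod (u f) + cmod d * cmod (v f)"
      by (rule order_trans[OF norm_triangle_ineq]) (simp add: norm_mult)
    ultimately show "cmod (c * u f + d * v f) \<le> (cmod c * C + cmod d * D) * S_seminorm \<omega> ?l f" by (simp add: algebra_simps)
  qed
qed

lemma S_dual_zero: "(\<lambda>_. 0) \<in> (S_dual \<omega> :: (('a::euclidean_space \<Rightarrow> complex) \<Rightarrow> complex) set)"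
  by (rule S_dualI[where lam=1 and C=0]) auto

text \<open>Makes the suprema that define the strong topology genuine.\<close>

lemma S_dual_bdd:
  fixes u :: "('a::euclidean_space \<Rightarrow> complex) \<Rightarrow> complex"
  assumes u: "u \<in> S_dual \<omega>" and B: "S_bounded \<omega> B"
  shows "bdd_above ((\<lambda>f. cmod (u f)) ` B)"
proof -
  obtain lam C where 1: "0 < lam" "0 < C" "\<forall>f\<in>S_space \<omega>. cmod (u f) \<le> C * S_seminorm \<omega> lam f" using S_dual_bound[OF u] by (elim exE conjE)
  have "bdd_above (S_seminorm \<omega> lam ` B)" using B 1(1) unfolding S_bounded_def by simp
  then obtain M where M: "\<forall>y\<in>S_seminorm \<omega> lam ` B. y \<le> M" unfolding bdd_above_def by (elim exE)
  show ?thesis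
  proof (rule bdd_aboveI2)
    fix f assume f: "f \<in> B"
    then have "f \<in> S_space \<omega>" using B unfolding S_bounded_def by blast
    then have "cmod (u f) \<le> C * S_seminorm \<omega> lam f" using 1(3) by blast
    also have "\<dots> \<le> C * M" using M f 1(2) by (intro mult_left_mono) auto
    finally show "cmod (u f) \<le> C * M" .
  qed
qed

end

section \<open>From the extension to the kernel\<close>

lemma simple_function_lborel:
  fixes s :: "'a::euclidean_space \<Rightarrow> 'a"
  assumes "simple_function lborel s"
  shows "finite (range s)" "s \<in> borel_measurable borel"
proof -
  show "finite (range s)" using assms unfolding simple_function_def by simp
  show "s \<in> borel_measurable borel" using borel_measurable_simple_function[OF assms] by simp
qed

text \<open>Splitting over the level sets of \<open>s\<close> turns the integral into a finite
  combination of values of \<open>h\<close>. It is applied with \<open>h\<close> a test function and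
  with \<open>h\<close> a row of the kernel, always with the same coefficients.\<close>

lemma integral_simple_compose:
  fixes s :: "'a::euclidean_space \<Rightarrow> 'a" and \<phi> h :: "'a \<Rightarrow> complex"
  assumes s: "simple_function lborel s" and \<phi>: "integrable lborel \<phi>"
  shows "(LINT y|lborel. \<phi> y * h (s y)) = (\<Sum>v\<in>range s. (LINT y|lborel. \<phi> y * indicator (s -` {v}) y) * h v)"
proof -
  note [measurable] = simple_function_lborel(2)[OF s]
  have m: "s -` {v} \<in> sets lborel" for v
    using measurable_sets[OF simple_function_lborel(2)[OF s], of "{v}"] by simp
  have i: "integrable lborel (\<lambda>y. \<phi> y * indicator (s -` {v}) y)" for v
    by (rule integrable_mult_bounded[OF \<phi>, where B=1]) (use m[of v] in \<open>auto simp: indicator_def\<close>)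
  have "\<phi> y * h (s y) = (\<Sum>v\<in>range s. (\<phi> y * indicator (s -` {v}) y) * h v)" for y
  proof -
    have "(\<Sum>v\<in>range s. (\<phi> y * indicator (s -` {v}) y) * h v) = (\<Sum>v\<in>range s. if v = s y then \<phi> y * h (s y) else 0)"
      by (intro sum.cong refl) (auto simp: indicator_def)
    also have "\<dots> = \<phi> y * h (s y)" using simple_function_lborel(1)[OF s] by (subst sum.delta) auto
    finally show ?thesis ..
  qed
  then have "(LINT y|lborel. \<phi> y * h (s y)) = (LINT y|lborel. (\<Sum>v\<in>range s. (\<phi> y * indicator (s -` {v}) y) * h v))" by simp
  also have "\<dots> = (\<Sum>v\<in>range s. (LINT y|lborel. (\<phi> y * indicator (s -` {v}) y) * h v))"
    by (intro Bochner_Integration.integral_sum integrable_mult_left i)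
  also have "\<dots> = (\<Sum>v\<in>range s. (LINT y|lborel. \<phi> y * indicator (s -` {v}) y) * h v)" by simp
  finally show ?thesis .
qed

context weight begin

text \<open>Derivatives of the point mass without the sign of the distributional derivative, so that
  differentiating \<open>dirac v y\<close> in \<open>y\<close> along \<open>b\<close> gives
  \<open>dirac (b # v) y\<close>.\<close>

definition dirac :: "'a::euclidean_space list \<Rightarrow> 'a \<Rightarrow> ('a \<Rightarrow> complex) \<Rightarrow> complex" where
  "dirac v y = (\<lambda>f. if f \<in> S_space \<omega> then Dw v f y else 0)"

lemma dirac_S_dual:
  fixes v :: "'a::euclidean_space list"
  assumes v: "set v \<subseteq> Basis"
  shows "dirac v y \<in> S_dual \<omega>"
proof (rule S_dualI[where lam=1 and C="moment 1 (length v)"])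
  show "dirac v y (\<lambda>x. c * f x + d * g x) = c * dirac v y f + d * dirac v y g" if "f \<in> S_space \<omega>" "g \<in> S_space \<omega>" for f g c d
    unfolding dirac_def using S_space_lin[OF that] that Dw_lin[OF S_space_smooth[OF that(1)] S_space_smooth[OF that(2)] v] by simp
  show "dirac v y f = 0" if "f \<notin> S_space \<omega>" for f using that unfolding dirac_def by simp
  fix f :: "'a \<Rightarrow> complex" assume f: "f \<in> S_space \<omega>"
  have one: "0 < (1::real)" by simp
  have "cmod (Dw v f y) \<le> (S_seminorm \<omega> 1 f * moment 1 (length v)) * exp (- 1 * \<omega> (norm y))" by (rule S_seminorm_ge[OF f one v])
  also have "\<dots> \<le> (S_seminorm \<omega> 1 f * moment 1 (length v)) * 1"
    using om_nonneg[of "norm y"] S_seminorm_nonneg[OF f one] by (intro mult_left_mono) auto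
  finally show "cmod (dirac v y f) \<le> moment 1 (length v) * S_seminorm \<omega> 1 f" unfolding dirac_def using f by (simp add: mult.commute)
qed simp

text \<open>Continuity at 0 yields finitely many bounded sets, whose union is again bounded. The
  estimate is phrased with an arbitrary majorant \<open>M\<close> of \<open>u\<close> on
  \<open>B\<close>, so applications need no supremum over \<open>B\<close>.\<close>

lemma operator_bound:
  fixes T' :: "(('a::euclidean_space \<Rightarrow> complex) \<Rightarrow> complex) \<Rightarrow> 'b::euclidean_space \<Rightarrow> complex"
  assumes lin: "linear_op_on (S_dual \<omega>) T'" and cont: "continuous_map (S_dual_topology \<omega>) (S_topology \<omega>) T'" and lam: "0 < lam"
  shows "\<exists>B C. S_bounded \<omega> B \<and> 0 < C \<and> (\<forall>u\<in>S_dual \<omega>. \<forall>M\<ge>0. (\<forall>f\<in>B. cmod (u f) \<le> M) \<longrightarrow> S_seminorm \<omega> lam (T' u) \<le> C * M)"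
proof -
  let ?P = "{\<lambda>u::('a \<Rightarrow> complex) \<Rightarrow> complex. SUP f\<in>B. cmod (u f) | B. S_bounded \<omega> B \<and> B \<noteq> {}}"
  define z where "z = (\<lambda>_::'a \<Rightarrow> complex. 0::complex)"
  have z: "z \<in> S_dual \<omega>" unfolding z_def by (rule S_dual_zero)
  have T'S: "T' u \<in> S_space \<omega>" if "u \<in> S_dual \<omega>" for u
    using cont that unfolding continuous_map_def topspace_S topspace_S_dual by blast
  have T'lin: "T' (\<lambda>f. c * u f + d * v f) = (\<lambda>x. c * T' u x + d * T' v x)" if "u \<in> S_dual \<omega>" "v \<in> S_dual \<omega>" for u v c d
    using lin that unfolding linear_op_on_def by blast
  have T'scale: "T' (\<lambda>f. c * u f) = (\<lambda>x. c * T' u x)" if "u \<in> S_dual \<omega>" for u c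
    using T'lin[OF that that, of c 0] by simp
  define W where "W = {g \<in> S_space \<omega>. S_seminorm \<omega> lam (\<lambda>x. g x - (\<lambda>_::'b. 0) x) < 1}"
  have W: "openin (S_topology \<omega>) W"
    unfolding S_topology_def seminorm_topology_def openin_topology_generated_by_iff W_def
    by (rule generate_topology_on.Basis) (use lam S_space_zero in \<open>force intro: exI[of _ "S_seminorm \<omega> lam"]\<close>)
  define W' where "W' = {u \<in> topspace (S_dual_topology \<omega>). T' u \<in> W}"
  have W': "openin (seminorm_topology (S_dual \<omega>) ?P) W'"
    unfolding W'_def S_dual_topology_def[symmetric] by (rule openin_continuous_map_preimage[OF cont W])
  have zW: "z \<in> W'"
  proof -
    have "T' z = (\<lambda>_. 0)" using T'scale[OF z, of 0] unfolding z_def by simp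
    then show ?thesis unfolding W'_def W_def topspace_S_dual using z S_space_zero S_seminorm_zero[of lam, where 'a='b] by simp
  qed
  have "\<exists>F e. finite F \<and> F \<subseteq> ?P \<and> 0 < e \<and> (\<forall>u\<in>S_dual \<omega>. (\<forall>p\<in>F. p u < e) \<longrightarrow> u \<in> W')"
  proof (rule seminorm_topology_nhd[OF W' zW])
    fix p and f g :: "('a \<Rightarrow> complex) \<Rightarrow> complex"
    assume "p \<in> ?P" and f: "f \<in> S_dual \<omega>" and g: "g \<in> S_dual \<omega>"
    then obtain B where p: "p = (\<lambda>u. SUP f\<in>B. cmod (u f))" and B: "S_bounded \<omega> B" "B \<noteq> {}" by blast
    have zf: "(\<lambda>x. z x - f x) \<in> S_dual \<omega>" using S_dual_comb[OF z f, of 1 "-1"] by simp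
    show "p (\<lambda>x. g x - f x) \<le> p g + p (\<lambda>x. z x - f x)"
      unfolding p
    proof (rule cSUP_least[OF B(2)])
      fix h assume h: "h \<in> B"
      have "cmod (g h - f h) \<le> cmod (g h) + cmod (z h - f h)" unfolding z_def using norm_triangle_ineq4[of "g h" "f h"] by simp
      also have "\<dots> \<le> (SUP f\<in>B. cmod (g f)) + (SUP x\<in>B. cmod (z x - f x))"
        by (intro add_mono cSUP_upper h S_dual_bdd[OF g B(1)] S_dual_bdd[OF zf B(1)])
      finally show "cmod (g h - f h) \<le> (SUP f\<in>B. cmod (g f)) + (SUP x\<in>B. cmod (z x - f x))" .
    qed
  qed
  then obtain F e where F: "finite F" "F \<subseteq> ?P" and e: "0 < e" and FW: "\<forall>u\<in>S_dual \<omega>. (\<forall>p\<in>F. p u < e) \<longrightarrow> u \<in> W'"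
    by (elim exE conjE)
  have "\<exists>B. S_bounded \<omega> B \<and> (\<forall>p\<in>F. \<forall>u M. (\<forall>f\<in>B. cmod (u f) \<le> M) \<longrightarrow> p u \<le> M)"
    using F
  proof (induction F rule: finite_induct)
    case empty
    show ?case using S_bounded_zero by (intro exI[of _ "{\<lambda>_. 0}"]) simp
  next
    case (insert q F)
    then obtain B where B: "S_bounded \<omega> B" "\<forall>p\<in>F. \<forall>u M. (\<forall>f\<in>B. cmod (u f) \<le> M) \<longrightarrow> p u \<le> M" by auto
    obtain B' where B': "S_bounded \<omega> B'" "B' \<noteq> {}" "q = (\<lambda>u. SUP f\<in>B'. cmod (u f))" using insert.prems by blast
    have "S_bounded \<omega> (B \<union> B')" using B(1) B'(1) unfolding S_bounded_def by (simp add: image_Un)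
    moreover have "p u \<le> M" if "p \<in> insert q F" and M: "\<forall>f\<in>B \<union> B'. cmod (u f) \<le> M" for p u M
    proof (cases "p = q")
      case True
      then show ?thesis unfolding True B'(3) using M by (intro cSUP_least B'(2)) simp
    next
      case False
      then show ?thesis using that B(2) by simp
    qed
    ultimately show ?case by (intro exI[of _ "B \<union> B'"]) blast
  qed
  then obtain B where B: "S_bounded \<omega> B" and BF: "\<forall>p\<in>F. \<forall>u M. (\<forall>f\<in>B. cmod (u f) \<le> M) \<longrightarrow> p u \<le> M" by (elim exE conjE)
  have "S_seminorm \<omega> lam (T' u) \<le> (2 / e) * M" if u: "u \<in> S_dual \<omega>" and M: "0 \<le> M" and bd: "\<forall>f\<in>B. cmod (u f) \<le> M" for u M
  proof (rule field_le_epsilon)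
    fix r :: real assume r: "0 < r"
    \<comment> \<open>The slack keeps \<open>s\<close> positive for \<open>M = 0\<close> and ends as
      the error \<open>r\<close>. The 2 in \<open>c = e / (2 * s)\<close> puts the scaled functional
      strictly inside the neighbourhood.\<close>
    define s where "s = M + r * e / 2"
    have s: "0 < s" "M \<le> s" unfolding s_def using M r e by (auto simp: add_nonneg_pos)
    define c where "c = e / (2 * s)"
    have c: "0 < c" unfolding c_def using e s by simp
    let ?v = "\<lambda>f. of_real c * u f"
    have v: "?v \<in> S_dual \<omega>" using S_dual_comb[OF u u, of "of_real c" 0] by simp
    have vB: "\<forall>f\<in>B. cmod (?v f) \<le> c * M" using bd c by (simp add: norm_mult mult_left_mono)
    have cM: "c * M < e"
    proof -
      have "c * M \<le> c * s" using c s by (intro mult_left_mono) auto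
      also have "\<dots> = e / 2" unfolding c_def using s by simp
      finally show ?thesis using e by simp
    qed
    have "\<forall>p\<in>F. p ?v < e"
    proof
      fix p assume p: "p \<in> F"
      show "p ?v < e" by (rule le_less_trans[OF BF[THEN bspec, OF p, THEN spec, THEN spec, THEN mp, OF vB] cM])
    qed
    then have "?v \<in> W'" using FW v by blast
    then have lt: "S_seminorm \<omega> lam (T' ?v) < 1" unfolding W'_def W_def by simp
    have "T' u = (\<lambda>x. of_real (1 / c) * T' ?v x)" unfolding T'scale[OF u] using c by simp
    then have "S_seminorm \<omega> lam (T' u) \<le> (1 / c) * S_seminorm \<omega> lam (T' ?v)"
      using S_seminorm_scale[OF T'S[OF v] lam, of "of_real (1 / c)"] c by (simp add: norm_divide)
    also have "\<dots> \<le> (1 / c) * 1" using lt c by (intro mult_left_mono) auto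
    also have "\<dots> = (2 / e) * M + r" unfolding c_def s_def using e by (simp add: field_simps)
    finally show "S_seminorm \<omega> lam (T' u) \<le> (2 / e) * M + r" .
  qed
  then show ?thesis using B e by (intro exI[of _ B] exI[of _ "2 / e"]) simp
qed

end

locale extended_operator = weight +
  fixes T' :: "(('a::euclidean_space \<Rightarrow> complex) \<Rightarrow> complex) \<Rightarrow> 'a \<Rightarrow> complex"
  assumes lin: "linear_op_on (S_dual \<omega>) T'" and cont: "continuous_map (S_dual_topology \<omega>) (S_topology \<omega>) T'"
begin

section \<open>The extended operator on point masses\<close>

lemma T'_S: "u \<in> S_dual \<omega> \<Longrightarrow> T' u \<in> S_space \<omega>"
  using cont unfolding continuous_map_def topspace_S topspace_S_dual by blast

lemma T'_lin: "u \<in> S_dual \<omega> \<Longrightarrow> v \<in> S_dual \<omega> \<Longrightarrow> T' (\<lambda>f. c * u f + d * v f) = (\<lambda>x. c * T' u x + d * T' v x)"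
  using lin unfolding linear_op_on_def by blast

lemma T'_scale: "u \<in> S_dual \<omega> \<Longrightarrow> T' (\<lambda>f. c * u f) = (\<lambda>x. c * T' u x)"
  using T'_lin[of u u c 0] by simp

lemma T'_sum:
  assumes "finite R" "\<And>v. v \<in> R \<Longrightarrow> u v \<in> S_dual \<omega>"
  shows "(\<lambda>f. \<Sum>v\<in>R. c v * u v f) \<in> S_dual \<omega> \<and> T' (\<lambda>f. \<Sum>v\<in>R. c v * u v f) = (\<lambda>x. \<Sum>v\<in>R. c v * T' (u v) x)"
  using assms
proof (induction R rule: finite_induct)
  case empty
  show ?case using S_dual_zero T'_scale[OF S_dual_zero, of 0] by simp
next
  case (insert r R)
  let ?s = "\<lambda>f. \<Sum>v\<in>R. c v * u v f"
  have IH: "?s \<in> S_dual \<omega>" "T' ?s = (\<lambda>x. \<Sum>v\<in>R. c v * T' (u v) x)" using insert by auto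
  have r: "u r \<in> S_dual \<omega>" using insert.prems by simp
  have e: "(\<lambda>f. \<Sum>v\<in>insert r R. c v * u v f) = (\<lambda>f. c r * u r f + 1 * ?s f)" using insert.hyps by simp
  show ?case unfolding e using S_dual_comb[OF r IH(1), of "c r" 1] T'_lin[OF r IH(1), of "c r" 1] IH(2) insert.hyps by simp
qed

text \<open>The candidate for the kernel differentiated along \<open>w\<close> in x and along
  \<open>v\<close> in y, available before any differentiability in y is known.\<close>

definition kern :: "'a list \<Rightarrow> 'a list \<Rightarrow> 'a \<Rightarrow> 'a \<Rightarrow> complex" where
  "kern w v x y = Dw w (T' (dirac v y)) x"

text \<open>On a bounded set the functional \<open>dirac v y\<close> is at most a constant times the
  moment and decay factors in \<open>v\<close> and \<open>y\<close>; \<open>operator_bound\<close>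
  keeps these and adds those in \<open>w\<close> and \<open>x\<close>.\<close>

lemma kern_bound:
  assumes lam: "0 < lam"
  shows "\<exists>C>0. \<forall>w v x y. set w \<subseteq> Basis \<longrightarrow> set v \<subseteq> Basis \<longrightarrow> cmod (kern w v x y) \<le>
    C * (moment lam (length w) * exp (- lam * \<omega> (norm x))) * (moment lam (length v) * exp (- lam * \<omega> (norm y)))"
proof -
  obtain B C where B: "S_bounded \<omega> B" and C: "0 < C" 
    and BC: "\<forall>u\<in>S_dual \<omega>. \<forall>M\<ge>0. (\<forall>f\<in>B. cmod (u f) \<le> M) \<longrightarrow> S_seminorm \<omega> lam (T' u) \<le> C * M"
    using operator_bound[OF lin cont lam] by (elim exE conjE)
  have "bdd_above (S_seminorm \<omega> lam ` B)" using B lam unfolding S_bounded_def by simp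
  then obtain D0 where D0: "\<forall>y\<in>S_seminorm \<omega> lam ` B. y \<le> D0" unfolding bdd_above_def by (elim exE)
  define D where "D = \<bar>D0\<bar> + 1"
  have D: "0 < D" "\<And>f. f \<in> B \<Longrightarrow> S_seminorm \<omega> lam f \<le> D" using D0 unfolding D_def by force+
  have "cmod (kern w v x y) \<le> (C * D) * (moment lam (length w) * exp (- lam * \<omega> (norm x))) * (moment lam (length v) * exp (- lam * \<omega> (norm y)))"
    if w: "set w \<subseteq> Basis" and v: "set v \<subseteq> Basis" for w v x y
  proof -
    let ?M = "D * (moment lam (length v) * exp (- lam * \<omega> (norm y)))"
    have bd: "\<forall>f\<in>B. cmod (dirac v y f) \<le> ?M"
    proof
      fix f assume f: "f \<in> B"
      then have fS: "f \<in> S_space \<omega>" using B unfolding S_bounded_def by blast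
      have "cmod (Dw v f y) \<le> S_seminorm \<omega> lam f * (moment lam (length v) * exp (- lam * \<omega> (norm y)))"
        using S_seminorm_ge[OF fS lam v, of y] by (simp only: mult.assoc)
      also have "\<dots> \<le> ?M" by (rule mult_right_mono[OF D(2)[OF f]]) simp
      finally show "cmod (dirac v y f) \<le> ?M" unfolding dirac_def using fS by simp
    qed
    have dS: "dirac v y \<in> S_dual \<omega>" by (rule dirac_S_dual[OF v])
    have S: "S_seminorm \<omega> lam (T' (dirac v y)) \<le> C * ?M" using BC[rule_format, OF dS _ bd[rule_format]] D(1) by simp
    have "cmod (kern w v x y) \<le> S_seminorm \<omega> lam (T' (dirac v y)) * (moment lam (length w) * exp (- lam * \<omega> (norm x)))"
      unfolding kern_def using S_seminorm_ge[OF T'_S[OF dS] lam w, of x] by (simp only: mult.assoc)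
    also have "\<dots> \<le> (C * ?M) * (moment lam (length w) * exp (- lam * \<omega> (norm x)))" by (rule mult_right_mono[OF S]) simp
    finally show ?thesis by (simp only: ac_simps)
  qed
  then show ?thesis using C D(1) by (intro exI[of _ "C * D"]) simp
qed

lemma kern_has_D_fst:
  assumes "set w \<subseteq> Basis" "set v \<subseteq> Basis" "b \<in> Basis"
  shows "has_D b (\<lambda>x. kern w v x y) (\<lambda>x. kern (b # w) v x y)"
  using smooth_has_D[OF smooth_Dw[OF S_space_smooth[OF T'_S[OF dirac_S_dual[OF assms(2)]]] assms(1)] assms(3), of y]
  unfolding kern_def by simp

text \<open>The Taylor remainder of the point mass is a functional \<open>u\<close> which on
  \<open>B\<close> is O(t^2), since second derivatives are uniformly bounded there.
  \<open>operator_bound\<close> carries this to \<open>T' u\<close> and all its derivatives in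
  x.\<close>

lemma kern_has_D_snd:
  assumes w: "set w \<subseteq> Basis" and v: "set v \<subseteq> Basis" and b: "b \<in> Basis"
  shows "has_D b (\<lambda>y. kern w v x y) (\<lambda>y. kern w (b # v) x y)"
  unfolding has_D_def
proof
  fix y
  have one: "0 < (1::real)" by simp
  have bv: "set (b # v) \<subseteq> Basis" and bbv: "set (b # b # v) \<subseteq> Basis" using b v by auto
  obtain B C where B: "S_bounded \<omega> B" and C: "0 < C" 
    and BC: "\<forall>u\<in>S_dual \<omega>. \<forall>M\<ge>0. (\<forall>f\<in>B. cmod (u f) \<le> M) \<longrightarrow> S_seminorm \<omega> 1 (T' u) \<le> C * M"
    using operator_bound[OF lin cont one] by (elim exE conjE)
  have "bdd_above (S_seminorm \<omega> 1 ` B)" using B unfolding S_bounded_def by simp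
  then obtain D0 where D0: "\<forall>y\<in>S_seminorm \<omega> 1 ` B. y \<le> D0" unfolding bdd_above_def by (elim exE)
  define D where "D = (\<bar>D0\<bar> + 1) * moment 1 (length (b # b # v))"
  have D: "0 < D" unfolding D_def by simp
  have Dbd: "cmod (Dw (b # b # v) f z) \<le> D" if f: "f \<in> B" for f z
  proof -
    have fS: "f \<in> S_space \<omega>" using B f unfolding S_bounded_def by blast
    have "cmod (Dw (b # b # v) f z) \<le> S_seminorm \<omega> 1 f * moment 1 (length (b # b # v)) * exp (- 1 * \<omega> (norm z))"
      by (rule S_seminorm_ge[OF fS one bbv])
    also have "\<dots> \<le> (S_seminorm \<omega> 1 f * moment 1 (length (b # b # v))) * 1"
      using om_nonneg[of "norm z"] S_seminorm_nonneg[OF fS one] by (intro mult_left_mono) auto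
    also have "\<dots> \<le> D" unfolding D_def mult_1_right using D0 f by (intro mult_right_mono) force+
    finally show ?thesis .
  qed
  show "((\<lambda>t. kern w v x (y + t *\<^sub>R b)) has_vector_derivative \<i> * kern w (b # v) x y) (at 0)"
  proof (rule has_vector_derivative_quadratic_error[where M="C * D * (moment 1 (length w) * exp (- 1 * \<omega> (norm x)))"])
    fix t :: real
    let ?da = "dirac v (y + t *\<^sub>R b)" and ?db = "dirac v y" and ?dc = "dirac (b # v) y"
    have d: "?da \<in> S_dual \<omega>" "?db \<in> S_dual \<omega>" "?dc \<in> S_dual \<omega>" by (intro dirac_S_dual v bv)+
    define u1 where "u1 = (\<lambda>f. 1 * ?da f + (-1) * ?db f)"
    define u where "u = (\<lambda>f. 1 * u1 f + (- (of_real t * \<i>)) * ?dc f)"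
    have u1: "u1 \<in> S_dual \<omega>" unfolding u1_def by (rule S_dual_comb[OF d(1,2)])
    have u: "u \<in> S_dual \<omega>" unfolding u_def by (rule S_dual_comb[OF u1 d(3)])
    have "T' u1 = (\<lambda>x. 1 * T' ?da x + (-1) * T' ?db x)" unfolding u1_def by (rule T'_lin[OF d(1,2)])
    note a1 = this
    have e1: "Dw w (T' u1) = (\<lambda>x. 1 * Dw w (T' ?da) x + (-1) * Dw w (T' ?db) x)"
      unfolding a1 by (rule Dw_lin[OF S_space_smooth[OF T'_S[OF d(1)]] S_space_smooth[OF T'_S[OF d(2)]] w])
    have "T' u = (\<lambda>x. 1 * T' u1 x + (- (of_real t * \<i>)) * T' ?dc x)" unfolding u_def by (rule T'_lin[OF u1 d(3)])
    note a2 = this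
    have e2: "Dw w (T' u) = (\<lambda>x. 1 * Dw w (T' u1) x + (- (of_real t * \<i>)) * Dw w (T' ?dc) x)"
      unfolding a2 by (rule Dw_lin[OF S_space_smooth[OF T'_S[OF u1]] S_space_smooth[OF T'_S[OF d(3)]] w])
    have e: "kern w v x (y + t *\<^sub>R b) - kern w v x (y + 0 *\<^sub>R b) - t *\<^sub>R (\<i> * kern w (b # v) x y) = Dw w (T' u) x"
      unfolding kern_def e2 e1 by (simp add: scaleR_conv_of_real algebra_simps)
    have bd: "\<forall>f\<in>B. cmod (u f) \<le> D * t\<^sup>2"
    proof
      fix f assume f: "f \<in> B"
      have fS: "f \<in> S_space \<omega>" using B f unfolding S_bounded_def by blast
      note sm = S_space_smooth[OF fS]
      have h1: "has_D b (Dw v f) (Dw (b # v) f)" using smooth_has_D[OF smooth_Dw[OF sm v] b] by simp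
      have h2: "has_D b (Dw (b # v) f) (Dw (b # b # v) f)" using smooth_has_D[OF smooth_Dw[OF sm bv] b] by simp
      have "cmod (Dw v f (y + t *\<^sub>R b) - Dw v f y - t *\<^sub>R (\<i> * Dw (b # v) f y)) \<le> D * t\<^sup>2"
        by (rule D_dir_Taylor2[OF h1 h2 Dbd[OF f]])
      moreover have "u f = Dw v f (y + t *\<^sub>R b) - Dw v f y - t *\<^sub>R (\<i> * Dw (b # v) f y)"
        unfolding u_def u1_def dirac_def using fS by (simp add: scaleR_conv_of_real algebra_simps)
      ultimately show "cmod (u f) \<le> D * t\<^sup>2" by simp
    qed
    have S: "S_seminorm \<omega> 1 (T' u) \<le> C * (D * t\<^sup>2)" using BC[rule_format, OF u _ bd[rule_format]] D by simp
    have "cmod (Dw w (T' u) x) \<le> S_seminorm \<omega> 1 (T' u) * (moment 1 (length w) * exp (- 1 * \<omega> (norm x)))"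
      using S_seminorm_ge[OF T'_S[OF u] one w, of x] by (simp only: mult.assoc)
    also have "\<dots> \<le> (C * (D * t\<^sup>2)) * (moment 1 (length w) * exp (- 1 * \<omega> (norm x)))" by (rule mult_right_mono[OF S]) simp
    finally show "cmod (kern w v x (y + t *\<^sub>R b) - kern w v x (y + 0 *\<^sub>R b) - t *\<^sub>R (\<i> * kern w (b # v) x y)) \<le>
        C * D * (moment 1 (length w) * exp (- 1 * \<omega> (norm x))) * t\<^sup>2"
      unfolding e by (simp only: ac_simps)
  qed
qed

lemma kern_bounded:
  "\<exists>M. (\<forall>j k. 0 \<le> M j k) \<and>
    (\<forall>w v x y. set w \<subseteq> Basis \<longrightarrow> set v \<subseteq> Basis \<longrightarrow> cmod (kern w v x y) \<le> M (length w) (length v))"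
proof -
  obtain C where C: "0 < C" and bd: "\<forall>w v x y. set w \<subseteq> Basis \<longrightarrow> set v \<subseteq> Basis \<longrightarrow> cmod (kern w v x y) \<le>
    C * (moment 1 (length w) * exp (- 1 * \<omega> (norm x))) * (moment 1 (length v) * exp (- 1 * \<omega> (norm y)))"
    using kern_bound[of 1] by auto
  show ?thesis
  proof (rule exI[of _ "\<lambda>j k. C * (moment 1 j * 1) * (moment 1 k * 1)"], intro conjI allI impI)
    show "0 \<le> C * (moment 1 j * 1) * (moment 1 k * 1)" for j k using C by simp
    fix w v :: "'a list" and x y :: 'a assume "set w \<subseteq> Basis" "set v \<subseteq> Basis"
    then have "cmod (kern w v x y) \<le> C * (moment 1 (length w) * exp (- 1 * \<omega> (norm x))) * (moment 1 (length v) * exp (- 1 * \<omega> (norm y)))"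
      by (rule bd[rule_format])
    also have "\<dots> \<le> C * (moment 1 (length w) * 1) * (moment 1 (length v) * 1)"
      using C om_nonneg[of "norm x"] om_nonneg[of "norm y"] by (intro mult_mono) auto
    finally show "cmod (kern w v x y) \<le> C * (moment 1 (length w) * 1) * (moment 1 (length v) * 1)" .
  qed
qed

text \<open>Bounds on the partial derivatives in each variable separately give joint continuity,
  which \<open>smooth_coinduct\<close> asks for on the product.\<close>

lemma kern_Lipschitz:
  assumes w: "set w \<subseteq> Basis" and v: "set v \<subseteq> Basis"
  shows "\<exists>L\<ge>0. \<forall>x x' y y'. cmod (kern w v x y - kern w v x' y') \<le> L * (norm (x - x') + norm (y - y'))"
proof -
  obtain N where N0: "\<forall>j k. 0 \<le> N j k"
    "\<forall>w v x y. set w \<subseteq> Basis \<longrightarrow> set v \<subseteq> Basis \<longrightarrow> cmod (kern w v x y) \<le> N (length w) (length v)"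
    using kern_bounded by (elim exE conjE)
  note N = N0[rule_format]
  define M where "M = N (Suc (length w)) (length v) + N (length w) (Suc (length v))"
  have M: "0 \<le> M" "\<forall>b\<in>Basis. \<forall>x y. cmod (kern (b # w) v x y) \<le> M \<and> cmod (kern w (b # v) x y) \<le> M"
  proof -
    show "0 \<le> M" unfolding M_def by (intro add_nonneg_nonneg N(1))
    have "cmod (kern (b # w) v x y) \<le> M" "cmod (kern w (b # v) x y) \<le> M" if b: "b \<in> Basis" for b x y
      using N(2)[of "b # w" v x y] N(2)[of w "b # v" x y] b w v
        N(1)[of "Suc (length w)" "length v"] N(1)[of "length w" "Suc (length v)"] unfolding M_def by simp_all
    then show "\<forall>b\<in>Basis. \<forall>x y. cmod (kern (b # w) v x y) \<le> M \<and> cmod (kern w (b # v) x y) \<le> M" by simp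
  qed
  have "cmod (kern w v x y - kern w v x' y') \<le> (M * real DIM('a)) * (norm (x - x') + norm (y - y'))" for x x' y y'
  proof -
    have 1: "cmod (kern w v x y - kern w v x' y) \<le> M * real DIM('a) * norm (x - x')"
      by (rule D_dir_Lipschitz[OF kern_has_D_fst[OF w v]]) (use M(2) in auto)
    have 2: "cmod (kern w v x' y - kern w v x' y') \<le> M * real DIM('a) * norm (y - y')"
      by (rule D_dir_Lipschitz[OF kern_has_D_snd[OF w v]]) (use M(2) in auto)
    have "cmod (kern w v x y - kern w v x' y') \<le> cmod (kern w v x y - kern w v x' y) + cmod (kern w v x' y - kern w v x' y')"
      using norm_triangle_ineq[of "kern w v x y - kern w v x' y" "kern w v x' y - kern w v x' y'"] by simp
    then show ?thesis using 1 2 by (simp add: algebra_simps)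
  qed
  then show ?thesis using M(1) by (intro exI[of _ "M * real DIM('a)"]) simp
qed

lemma kern_continuous:
  assumes w: "set w \<subseteq> Basis" and v: "set v \<subseteq> Basis"
  shows "continuous_on UNIV (\<lambda>p. kern w v (fst p) (snd p))"
proof -
  obtain L where L: "0 \<le> L" "\<forall>x x' y y'. cmod (kern w v x y - kern w v x' y') \<le> L * (norm (x - x') + norm (y - y'))"
    using kern_Lipschitz[OF w v] by (elim exE conjE)
  have "cmod (kern w v (fst p) (snd p) - kern w v (fst q) (snd q)) \<le> (L * 2) * norm (p - q)" for p q
  proof -
    have "norm (fst p - fst q) \<le> norm (p - q)" "norm (snd p - snd q) \<le> norm (p - q)"
      using norm_fst_le[of "fst (p - q)" "snd (p - q)"] norm_snd_le[where x="fst (p - q)" and y="snd (p - q)"] by (auto simp del: fst_diff snd_diff simp: fst_diff[symmetric] snd_diff[symmetric])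
    then have "L * (norm (fst p - fst q) + norm (snd p - snd q)) \<le> L * (norm (p - q) + norm (p - q))"
      using L(1) by (intro mult_left_mono add_mono) auto
    then show ?thesis using L(2)[rule_format, of "fst p" "snd p" "fst q" "snd q"] by simp
  qed
  then have "(L * 2)-lipschitz_on UNIV (\<lambda>p. kern w v (fst p) (snd p))"
    using L(1) by (auto simp: lipschitz_on_def dist_norm)
  then show ?thesis by (rule lipschitz_on_continuous_on)
qed

lemma kern_has_D_pair:
  assumes w: "set w \<subseteq> Basis" and v: "set v \<subseteq> Basis" and b: "b \<in> (Basis :: ('a \<times> 'a) set)"
  shows "\<exists>w' v'. set w' \<subseteq> Basis \<and> set v' \<subseteq> Basis \<and> length w' + length v' = Suc (length w + length v) \<and>
    has_D b (\<lambda>p. kern w v (fst p) (snd p)) (\<lambda>p. kern w' v' (fst p) (snd p))"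
proof -
  from b consider c where "c \<in> Basis" "b = (c, 0)" | c where "c \<in> Basis" "b = (0, c)"
    unfolding Basis_prod_def by blast
  then show ?thesis
  proof cases
    case 1
    have "has_D b (\<lambda>p. kern w v (fst p) (snd p)) (\<lambda>p. kern (c # w) v (fst p) (snd p))"
      using kern_has_D_fst[OF w v 1(1)] unfolding has_D_def 1(2) by simp
    then show ?thesis using w v 1(1) by (rule_tac exI[of _ "c # w"], rule_tac exI[of _ v]) simp
  next
    case 2
    have "has_D b (\<lambda>p. kern w v (fst p) (snd p)) (\<lambda>p. kern w (c # v) (fst p) (snd p))"
      using kern_has_D_snd[OF w v 2(1)] unfolding has_D_def 2(2) by simp
    then show ?thesis using w v 2(1) by (rule_tac exI[of _ w], rule_tac exI[of _ "c # v"]) simp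
  qed
qed

section \<open>The kernel as a function on the product space\<close>

definition kernel :: "'a \<times> 'a \<Rightarrow> complex" where
  "kernel p = kern [] [] (fst p) (snd p)"

lemma smooth_kernel: "smooth kernel"
proof (rule smooth_coinduct[where P="\<lambda>h. \<exists>w v. set w \<subseteq> Basis \<and> set v \<subseteq> Basis \<and> h = (\<lambda>p. kern w v (fst p) (snd p))"])
  show "\<exists>w v. set w \<subseteq> Basis \<and> set v \<subseteq> Basis \<and> kernel = (\<lambda>p. kern w v (fst p) (snd p))"
    by (intro exI[of _ "[]"]) (auto simp: kernel_def)
  fix h :: "'a \<times> 'a \<Rightarrow> complex"
  assume "\<exists>w v. set w \<subseteq> Basis \<and> set v \<subseteq> Basis \<and> h = (\<lambda>p. kern w v (fst p) (snd p))"
  then obtain w v where h: "set w \<subseteq> Basis" "set v \<subseteq> Basis" "h = (\<lambda>p. kern w v (fst p) (snd p))" by (elim exE conjE)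
  show "continuous_on UNIV h \<and> (\<forall>b\<in>Basis. \<exists>g. has_D b h g \<and> (\<exists>w v. set w \<subseteq> Basis \<and> set v \<subseteq> Basis \<and> g = (\<lambda>p. kern w v (fst p) (snd p))))"
  proof (intro conjI ballI)
    show "continuous_on UNIV h" unfolding h(3) by (rule kern_continuous[OF h(1,2)])
    fix b :: "'a \<times> 'a" assume b: "b \<in> Basis"
    obtain w' v' where *: "set w' \<subseteq> Basis" "set v' \<subseteq> Basis" "has_D b h (\<lambda>p. kern w' v' (fst p) (snd p))"
      unfolding h(3) using kern_has_D_pair[OF h(1,2) b] by (elim exE conjE)
    show "\<exists>g. has_D b h g \<and> (\<exists>w v. set w \<subseteq> Basis \<and> set v \<subseteq> Basis \<and> g = (\<lambda>p. kern w v (fst p) (snd p)))"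
      by (rule exI[of _ "\<lambda>p. kern w' v' (fst p) (snd p)"], rule conjI[OF *(3)], rule exI[of _ w'], rule exI[of _ v'], intro conjI * refl)
  qed
qed

lemma Dw_kernel:
  assumes "set W \<subseteq> (Basis :: ('a \<times> 'a) set)"
  shows "\<exists>w v. set w \<subseteq> Basis \<and> set v \<subseteq> Basis \<and> length w + length v = length W \<and> Dw W kernel = (\<lambda>p. kern w v (fst p) (snd p))"
  using assms
proof (induction W)
  case Nil
  show ?case by (intro exI[of _ "[]"]) (auto simp: kernel_def)
next
  case (Cons b W)
  then have b: "b \<in> Basis" and W: "set W \<subseteq> Basis" by auto
  obtain w v where *: "set w \<subseteq> Basis" "set v \<subseteq> Basis" "length w + length v = length W" "Dw W kernel = (\<lambda>p. kern w v (fst p) (snd p))"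
    using Cons.IH[OF W] by (elim exE conjE)
  obtain w' v' where **: "set w' \<subseteq> Basis" "set v' \<subseteq> Basis" "length w' + length v' = Suc (length w + length v)"
    "has_D b (\<lambda>p. kern w v (fst p) (snd p)) (\<lambda>p. kern w' v' (fst p) (snd p))"
    using kern_has_D_pair[OF *(1,2) b] by (elim exE conjE)
  show ?case using ** *(3) has_D_D_dir[OF **(4)] by (rule_tac exI[of _ w'], rule_tac exI[of _ v']) (simp add: *(4))
qed

lemma kernel_S_space: "kernel \<in> S_space \<omega>"
proof -
  have "kernel \<in> ultra"
  proof (rule ultraI[OF smooth_kernel])
    fix mu :: real assume mu: "0 < mu"
    obtain L where L: "1 \<le> L" "\<forall>t\<ge>0. \<omega> (2 * t) \<le> L * (\<omega> t + 1)" using om_double by (elim exE conjE)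
    \<comment> \<open>The norm of (x, y) is at most twice the larger of the two norms; the doubling
      constant \<open>L\<close> is the price for merging separate decay in x and y into joint
      decay.\<close>
    define lam where "lam = mu * L"
    have lam: "0 < lam" "mu \<le> lam" unfolding lam_def using mu L(1) by simp_all
    obtain C where C: "0 < C" and bd: "\<forall>w v x y. set w \<subseteq> Basis \<longrightarrow> set v \<subseteq> Basis \<longrightarrow> cmod (kern w v x y) \<le>
      C * (moment lam (length w) * exp (- lam * \<omega> (norm x))) * (moment lam (length v) * exp (- lam * \<omega> (norm y)))"
      using kern_bound[OF lam(1)] by (elim exE conjE)
    have "cmod (Dw W kernel p) \<le> (C * exp lam) * moment mu (length W) * exp (- mu * \<omega> (norm p))"
      if W: "set W \<subseteq> Basis" for W p
    proof -
      obtain w v where *: "set w \<subseteq> Basis" "set v \<subseteq> Basis" "length w + length v = length W" "Dw W kernel = (\<lambda>p. kern w v (fst p) (snd p))"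
        using Dw_kernel[OF W] by (elim exE conjE)
      obtain x y where p: "p = (x, y)" by (cases p)
      have "norm p \<le> 2 * max (norm x) (norm y)" using norm_Pair_le[of x y] unfolding p by simp
      then have "\<omega> (norm p) \<le> \<omega> (2 * max (norm x) (norm y))" by (intro om_mono) auto
      also have "\<dots> \<le> L * (\<omega> (max (norm x) (norm y)) + 1)" using L(2) by (simp add: le_max_iff_disj)
      also have "\<dots> \<le> L * (\<omega> (norm x) + \<omega> (norm y) + 1)"
        using L(1) om_nonneg[of "norm x"] om_nonneg[of "norm y"] by (intro mult_left_mono) (auto simp: max_def)
      finally have "mu * \<omega> (norm p) \<le> mu * (L * (\<omega> (norm x) + \<omega> (norm y) + 1))" using mu by (intro mult_left_mono) auto
      then have "- lam * \<omega> (norm x) + - lam * \<omega> (norm y) \<le> lam + - mu * \<omega> (norm p)" unfolding lam_def by (simp add: algebra_simps)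
      then have E: "exp (- lam * \<omega> (norm x)) * exp (- lam * \<omega> (norm y)) \<le> exp lam * exp (- mu * \<omega> (norm p))"
        unfolding exp_add[symmetric] by simp
      have "moment lam (length w) * moment lam (length v) \<le> moment lam (length W)" unfolding *(3)[symmetric] by (rule moment_mult_le[OF lam(1)])
      also have "\<dots> \<le> moment mu (length W)" by (rule moment_antimono[OF mu lam(2)])
      finally have M: "moment lam (length w) * moment lam (length v) \<le> moment mu (length W)" .
      have "cmod (Dw W kernel p) \<le> C * (moment lam (length w) * exp (- lam * \<omega> (norm x))) * (moment lam (length v) * exp (- lam * \<omega> (norm y)))"
        unfolding *(4) p using bd[rule_format, OF *(1,2), of x y] by simp
      also have "\<dots> = C * ((moment lam (length w) * moment lam (length v)) * (exp (- lam * \<omega> (norm x)) * exp (- lam * \<omega> (norm y))))" by simp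
      also have "\<dots> \<le> C * (moment mu (length W) * (exp lam * exp (- mu * \<omega> (norm p))))"
        using C by (intro mult_left_mono mult_mono[OF M E]) auto
      finally show ?thesis by (simp only: ac_simps)
    qed
    then show "\<exists>C. \<forall>w x. set w \<subseteq> Basis \<longrightarrow> cmod (Dw w kernel x) \<le> C * moment mu (length w) * exp (- mu * \<omega> (norm x))"
      by (intro exI[of _ "C * exp lam"] allI impI)
  qed
  then show ?thesis unfolding ultra_eq_S_space .
qed

text \<open>The functional \<open>S_embed \<omega> \<phi>\<close> is the strong limit of finite combinations of point evaluations, obtained from
  simple functions \<open>s n\<close> converging to the identity.\<close>

lemma kernel_represents:
  assumes \<phi>: "\<phi> \<in> S_space \<omega>"
  shows "T' (S_embed \<omega> \<phi>) x = (LINT y|lborel. kernel (x, y) * \<phi> y)"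
proof -
  have one: "0 < (1::real)" by simp
  have nil: "set ([] :: 'a list) \<subseteq> Basis" by simp
  have \<phi>i: "integrable lborel \<phi>" using S_space_Dw(2)[OF \<phi> nil] by simp
  have [measurable]: "\<phi> \<in> borel_measurable borel" using borel_measurable_integrable[OF \<phi>i] by simp
  have "(\<lambda>y::'a. y) \<in> borel_measurable lborel" by simp
  from borel_measurable_implies_sequence_metric[OF this, of 0]
  obtain s :: "nat \<Rightarrow> 'a \<Rightarrow> 'a" where s: "\<forall>n. simple_function lborel (s n)" "\<forall>y\<in>space lborel. (\<lambda>n. s n y) \<longlonglongrightarrow> y"
    by (elim exE conjE)
  have sm [measurable]: "s n \<in> borel_measurable borel" for n using simple_function_lborel(2) s(1) by blast
  define c where "c = (\<lambda>n v. LINT y|lborel. \<phi> y * indicator (s n -` {v}) y)"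
  define u where "u = (\<lambda>n f. \<Sum>v\<in>range (s n). c n v * dirac [] v f)"
  have u: "u n \<in> S_dual \<omega>" "T' (u n) = (\<lambda>x. \<Sum>v\<in>range (s n). c n v * T' (dirac [] v) x)" for n
    using T'_sum[of "range (s n)" "dirac []" "c n"] simple_function_lborel(1) s(1) dirac_S_dual[OF nil] unfolding u_def by auto
  have uf: "u n f = (LINT y|lborel. \<phi> y * f (s n y))" if "f \<in> S_space \<omega>" for n f
    unfolding integral_simple_compose[OF s(1)[rule_format] \<phi>i] u_def c_def dirac_def using that by simp
  have Tu: "T' (u n) x = (LINT y|lborel. \<phi> y * kernel (x, s n y))" for n
    using integral_simple_compose[OF s(1)[rule_format, of n] \<phi>i, of "\<lambda>v. kernel (x, v)"]
    unfolding u(2) c_def by (simp add: kernel_def kern_def)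
  obtain B C where B: "S_bounded \<omega> B" and C: "0 < C" 
    and BC: "\<forall>u\<in>S_dual \<omega>. \<forall>M\<ge>0. (\<forall>f\<in>B. cmod (u f) \<le> M) \<longrightarrow> S_seminorm \<omega> 1 (T' u) \<le> C * M"
    using operator_bound[OF lin cont one] by (elim exE conjE)
  have BS: "f \<in> S_space \<omega>" if "f \<in> B" for f using B that unfolding S_bounded_def by blast
  have "bdd_above (S_seminorm \<omega> 1 ` B)" using B unfolding S_bounded_def by simp
  then obtain D0 where D0: "\<forall>y\<in>S_seminorm \<omega> 1 ` B. y \<le> D0" unfolding bdd_above_def by (elim exE)
  define D where "D = \<bar>D0\<bar> + 1"
  have D: "0 < D" unfolding D_def by simp
  have Dbd: "cmod (Dw w f z) \<le> D * moment 1 (length w)" if f: "f \<in> B" and w: "set w \<subseteq> Basis" for f z w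
  proof -
    have "cmod (Dw w f z) \<le> S_seminorm \<omega> 1 f * moment 1 (length w) * exp (- 1 * \<omega> (norm z))"
      by (rule S_seminorm_ge[OF BS[OF f] one w])
    also have "\<dots> \<le> (S_seminorm \<omega> 1 f * moment 1 (length w)) * 1"
      using om_nonneg[of "norm z"] S_seminorm_nonneg[OF BS[OF f] one] by (intro mult_left_mono) auto
    also have "\<dots> \<le> D * moment 1 (length w)" unfolding D_def mult_1_right using D0 f by (intro mult_right_mono) force+
    finally show ?thesis .
  qed
  define L where "L = D * moment 1 1 * real DIM('a)"
  have L: "0 \<le> L" unfolding L_def using D by simp
  \<comment> \<open>A bound for |f(s n y) - f(y)| common to all f in \<open>B\<close>. The Lipschitz
    part makes it tend to 0 pointwise, and the cap 2 D supplies a dominating function, as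
    \<open>s n y\<close> need not be uniformly close to y.\<close>
  define q where "q = (\<lambda>n y. min (2 * D) (L * norm (s n y - y)))"
  have q0: "0 \<le> q n y" "q n y \<le> 2 * D" for n y unfolding q_def using D L by auto
  have qf: "cmod (f (s n y) - f y) \<le> q n y" if f: "f \<in> B" for f n y
  proof -
    have "cmod (f (s n y) - f y) \<le> L * norm (s n y - y)"
      unfolding L_def
    proof (rule D_dir_Lipschitz)
      fix b :: 'a assume b: "b \<in> Basis"
      show "has_D b f (D_dir b f)" by (rule smooth_has_D[OF S_space_smooth[OF BS[OF f]] b])
      show "cmod (D_dir b f z) \<le> D * moment 1 1" for z using Dbd[OF f, of "[b]" z] b by simp
    qed
    moreover have "cmod (f (s n y) - f y) \<le> 2 * D"
      using norm_triangle_ineq4[of "f (s n y)" "f y"] Dbd[OF f nil, of "s n y"] Dbd[OF f nil, of y] moment_0[OF one] by simp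
    ultimately show ?thesis unfolding q_def by simp
  qed
  have qm [measurable]: "q n \<in> borel_measurable borel" for n unfolding q_def by measurable
  have qi: "integrable lborel (\<lambda>y. cmod (\<phi> y) * q n y)" for n
  proof (rule Bochner_Integration.integrable_bound)
    show "integrable lborel (\<lambda>y. cmod (\<phi> y) * (2 * D))" using \<phi>i by simp
    show "(\<lambda>y. cmod (\<phi> y) * q n y) \<in> borel_measurable lborel" by simp
    show "AE y in lborel. norm (cmod (\<phi> y) * q n y) \<le> norm (cmod (\<phi> y) * (2 * D))"
      using q0 D by (auto simp: abs_mult intro!: AE_I2 mult_left_mono)
  qed
  define e where "e = (\<lambda>n. LINT y|lborel. cmod (\<phi> y) * q n y)"
  have e0: "0 \<le> e n" for n unfolding e_def using q0 by (intro integral_nonneg_AE AE_I2 mult_nonneg_nonneg) auto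
  have elim: "e \<longlonglongrightarrow> (LINT y|(lborel :: 'a measure). 0)"
    unfolding e_def
  proof (rule integral_dominated_convergence[where w="\<lambda>y. cmod (\<phi> y) * (2 * D)"])
    show "integrable lborel (\<lambda>y. cmod (\<phi> y) * (2 * D))" using \<phi>i by simp
    show "AE y in lborel. norm (cmod (\<phi> y) * q n y) \<le> cmod (\<phi> y) * (2 * D)" for n
      using q0 by (auto simp: abs_mult intro!: AE_I2 mult_left_mono)
    show "AE y in lborel. (\<lambda>n. cmod (\<phi> y) * q n y) \<longlonglongrightarrow> 0"
    proof (rule AE_I2)
      fix y :: 'a
      have "(\<lambda>n. s n y) \<longlonglongrightarrow> y" using s(2) by simp
      then have "(\<lambda>n. norm (s n y - y)) \<longlonglongrightarrow> 0" by (simp add: LIM_zero_iff tendsto_norm_zero_iff)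
      then have "(\<lambda>n. cmod (\<phi> y) * (L * norm (s n y - y))) \<longlonglongrightarrow> 0" by (intro tendsto_mult_right_zero)
      then show "(\<lambda>n. cmod (\<phi> y) * q n y) \<longlonglongrightarrow> 0"
        by (rule tendsto_sandwich[OF _ _ tendsto_const, rotated 2])
           (use q0 in \<open>auto intro!: always_eventually mult_left_mono mult_nonneg_nonneg simp: q_def\<close>)
    qed
  qed simp_all
  have emb: "S_embed \<omega> \<phi> \<in> S_dual \<omega>"
  proof (rule S_dualI[where lam=1 and C="LINT y|lborel. cmod (\<phi> y)"])
    have fi: "integrable lborel (\<lambda>y. \<phi> y * f y)" "cmod (f y) \<le> S_seminorm \<omega> 1 f" if f: "f \<in> S_space \<omega>" for f y
    proof -
      have b: "cmod (f y) \<le> S_seminorm \<omega> 1 f" for y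
      proof -
        have "cmod (Dw [] f y) \<le> S_seminorm \<omega> 1 f * moment 1 (length ([]::'a list)) * exp (- 1 * \<omega> (norm y))" by (rule S_seminorm_ge[OF f one nil])
        also have "\<dots> \<le> S_seminorm \<omega> 1 f * 1 * 1" using om_nonneg[of "norm y"] S_seminorm_nonneg[OF f one] moment_0[OF one] by (intro mult_mono) auto
        finally show ?thesis by simp
      qed
      then show "cmod (f y) \<le> S_seminorm \<omega> 1 f" .
      show "integrable lborel (\<lambda>y. \<phi> y * f y)"
        by (rule integrable_mult_bounded[OF \<phi>i continuous_imp_borel[OF smooth_continuous[OF S_space_smooth[OF f]]] b])
    qed
    show "S_embed \<omega> \<phi> (\<lambda>x. c * f x + d * g x) = c * S_embed \<omega> \<phi> f + d * S_embed \<omega> \<phi> g" if f: "f \<in> S_space \<omega>" and g: "g \<in> S_space \<omega>" for f g c d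
    proof -
      have "(LINT y|lborel. \<phi> y * (c * f y + d * g y)) = (LINT y|lborel. c * (\<phi> y * f y) + d * (\<phi> y * g y))"
        by (intro Bochner_Integration.integral_cong refl) (simp add: algebra_simps)
      also have "\<dots> = c * (LINT y|lborel. \<phi> y * f y) + d * (LINT y|lborel. \<phi> y * g y)"
        by (subst Bochner_Integration.integral_add) (intro integrable_mult_right fi f g, intro integrable_mult_right fi f g, simp)
      finally show ?thesis unfolding S_embed_def using f g S_space_lin[OF f g] by simp
    qed
    show "S_embed \<omega> \<phi> f = 0" if "f \<notin> S_space \<omega>" for f using that unfolding S_embed_def by simp
    fix f :: "'a \<Rightarrow> complex" assume f: "f \<in> S_space \<omega>"
    have "cmod (LINT y|lborel. \<phi> y * f y) \<le> (LINT y|lborel. cmod (\<phi> y) * S_seminorm \<omega> 1 f)"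
      by (rule norm_LINT_le[OF fi(1)[OF f]]) (use \<phi>i fi(2)[OF f] in \<open>auto simp: norm_mult intro!: mult_left_mono\<close>)
    then show "cmod (S_embed \<omega> \<phi> f) \<le> (LINT y|lborel. cmod (\<phi> y)) * S_seminorm \<omega> 1 f" unfolding S_embed_def using f by simp
  qed simp
  have bound: "cmod (T' (u n) x - T' (S_embed \<omega> \<phi>) x) \<le> C * e n" for n
  proof -
    \<comment> \<open>The error functional is at most \<open>e n\<close> throughout
      \<open>B\<close>, and this uniformity is what \<open>operator_bound\<close> converts into
      convergence at \<open>x\<close>.\<close>
    define r where "r = (\<lambda>f. 1 * u n f + (-1) * S_embed \<omega> \<phi> f)"
    have r: "r \<in> S_dual \<omega>" unfolding r_def by (rule S_dual_comb[OF u(1) emb])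
    have Tr: "T' r = (\<lambda>x. 1 * T' (u n) x + (-1) * T' (S_embed \<omega> \<phi>) x)" unfolding r_def by (rule T'_lin[OF u(1) emb])
    have bd: "\<forall>f\<in>B. cmod (r f) \<le> e n"
    proof
      fix f assume f: "f \<in> B"
      have fm: "f \<in> borel_measurable borel" using continuous_imp_borel[OF smooth_continuous[OF S_space_smooth[OF BS[OF f]]]] by simp
      note [measurable] = fm
      have fb: "cmod (f y) \<le> D" for y using Dbd[OF f nil, of y] moment_0[OF one] by simp
      have i1: "integrable lborel (\<lambda>y. \<phi> y * f (s n y))" by (rule integrable_mult_bounded[OF \<phi>i _ fb]) simp
      have i2: "integrable lborel (\<lambda>y. \<phi> y * f y)" by (rule integrable_mult_bounded[OF \<phi>i _ fb]) simp
      have "r f = (LINT y|lborel. \<phi> y * f (s n y)) - (LINT y|lborel. \<phi> y * f y)"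
        unfolding r_def uf[OF BS[OF f]] S_embed_def using BS[OF f] by simp
      also have "\<dots> = (LINT y|lborel. \<phi> y * f (s n y) - \<phi> y * f y)" by (rule Bochner_Integration.integral_diff[OF i1 i2, symmetric])
      also have "cmod \<dots> \<le> e n" unfolding e_def
      proof (rule norm_LINT_le[OF Bochner_Integration.integrable_diff[OF i1 i2] qi])
        fix y
        have "cmod (\<phi> y * f (s n y) - \<phi> y * f y) = cmod (\<phi> y) * cmod (f (s n y) - f y)" by (simp add: norm_mult[symmetric] right_diff_distrib)
        also have "\<dots> \<le> cmod (\<phi> y) * q n y" by (rule mult_left_mono[OF qf[OF f]]) simp
        finally show "cmod (\<phi> y * f (s n y) - \<phi> y * f y) \<le> cmod (\<phi> y) * q n y" .
      qed
      finally show "cmod (r f) \<le> e n" .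
    qed
    have S: "S_seminorm \<omega> 1 (T' r) \<le> C * e n" using BC[rule_format, OF r e0 bd[rule_format]] .
    have "cmod (Dw [] (T' r) x) \<le> S_seminorm \<omega> 1 (T' r) * moment 1 (length ([]::'a list)) * exp (- 1 * \<omega> (norm x))"
      by (rule S_seminorm_ge[OF T'_S[OF r] one nil])
    also have "\<dots> \<le> S_seminorm \<omega> 1 (T' r) * 1 * 1"
      using om_nonneg[of "norm x"] S_seminorm_nonneg[OF T'_S[OF r] one] moment_0[OF one] by (intro mult_mono) auto
    finally show ?thesis using S unfolding Tr by simp
  qed
  have "(\<lambda>n. T' (u n) x) \<longlonglongrightarrow> T' (S_embed \<omega> \<phi>) x"
  proof (rule LIM_zero_cancel)
    show "(\<lambda>n. T' (u n) x - T' (S_embed \<omega> \<phi>) x) \<longlonglongrightarrow> 0"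
    proof (rule Lim_null_comparison)
      show "\<forall>\<^sub>F n in sequentially. norm (T' (u n) x - T' (S_embed \<omega> \<phi>) x) \<le> C * e n" using bound by simp
      show "(\<lambda>n. C * e n) \<longlonglongrightarrow> 0" using elim by (intro tendsto_mult_right_zero) simp
    qed
  qed
  \<comment> \<open>By linearity \<open>T' (u n) x\<close> is the integral of \<open>\<phi>\<close>
    against kernel values at \<open>s n y\<close>; dominated convergence gives a second expression
    for the limit.\<close>
  moreover have "(\<lambda>n. T' (u n) x) \<longlonglongrightarrow> (LINT y|lborel. \<phi> y * kernel (x, y))"
    unfolding Tu
  proof -
    obtain N where N0: "\<forall>j k. 0 \<le> N j k"
      "\<forall>w v x y. set w \<subseteq> Basis \<longrightarrow> set v \<subseteq> Basis \<longrightarrow> cmod (kern w v x y) \<le> N (length w) (length v)"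
      using kern_bounded by (elim exE conjE)
    note N = N0[rule_format]
    have M: "cmod (kern [] [] x y) \<le> N 0 0" for y using N(2)[OF nil nil, of x y] by simp
    have kc: "continuous_on UNIV kernel" by (rule smooth_continuous[OF smooth_kernel])
    have kx: "continuous_on UNIV (\<lambda>y. kernel (x, y))" by (rule continuous_on_compose2[OF kc]) (auto intro!: continuous_intros)
    have km [measurable]: "(\<lambda>y. kernel (x, y)) \<in> borel_measurable borel" using continuous_imp_borel[OF kx] by simp
    show "(\<lambda>n. LINT y|lborel. \<phi> y * kernel (x, s n y)) \<longlonglongrightarrow> (LINT y|lborel. \<phi> y * kernel (x, y))"
    proof (rule integral_dominated_convergence[where w="\<lambda>y. cmod (\<phi> y) * N 0 0"])
      show "integrable lborel (\<lambda>y. cmod (\<phi> y) * N 0 0)" using \<phi>i by simp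
      show "(\<lambda>y. \<phi> y * kernel (x, y)) \<in> borel_measurable lborel" by simp
      show "(\<lambda>y. \<phi> y * kernel (x, s n y)) \<in> borel_measurable lborel" for n
        using measurable_compose[OF sm km, of n] by simp
      show "AE y in lborel. norm (\<phi> y * kernel (x, s n y)) \<le> cmod (\<phi> y) * N 0 0" for n
        using M by (auto simp: norm_mult kernel_def intro!: AE_I2 mult_left_mono)
      show "AE y in lborel. (\<lambda>n. \<phi> y * kernel (x, s n y)) \<longlonglongrightarrow> \<phi> y * kernel (x, y)"
      proof (intro AE_I2 tendsto_mult tendsto_const)
        fix y :: 'a
        have "(\<lambda>n. s n y) \<longlonglongrightarrow> y" using s(2) by simp
        then show "(\<lambda>n. kernel (x, s n y)) \<longlonglongrightarrow> kernel (x, y)"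
          by (rule continuous_on_tendsto_compose[OF kx]) auto
      qed
    qed
  qed
  ultimately have "T' (S_embed \<omega> \<phi>) x = (LINT y|lborel. \<phi> y * kernel (x, y))" by (rule LIMSEQ_unique)
  then show ?thesis by (simp add: mult.commute)
qed

end

section \<open>From the kernel to the extension\<close>

locale kernel_operator = weight +
  fixes K :: "'a::euclidean_space \<times> 'a \<Rightarrow> complex"
  assumes K: "K \<in> S_space \<omega>"
begin

text \<open>\<open>v\<close> differentiates in y and \<open>w\<close> in x. The y-letters stand in
  front, so a further y-derivative is a \<open>Cons\<close>, whereas a further x-derivative has to
  be commuted past them.\<close>

definition slice :: "'a list \<Rightarrow> 'a list \<Rightarrow> 'a \<Rightarrow> 'a \<Rightarrow> complex" where
  "slice v w x y = Dw (map (Pair 0) v @ map (\<lambda>b. (b, 0)) w) K (x, y)"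

lemma slice_word:
  assumes "set v \<subseteq> Basis" "set w \<subseteq> (Basis :: 'a set)"
  shows "set (map (Pair 0) v @ map (\<lambda>b. (b, 0)) w) \<subseteq> (Basis :: ('a \<times> 'a) set)"
  using assms unfolding Basis_prod_def by auto

lemma slice_bound:
  assumes lam: "0 < lam"
  shows "\<exists>C>0. \<forall>v w x y. set v \<subseteq> Basis \<longrightarrow> set w \<subseteq> Basis \<longrightarrow> cmod (slice v w x y) \<le>
    C * (moment lam (length w) * exp (- lam * \<omega> (norm x))) * (moment lam (length v) * exp (- lam * \<omega> (norm y)))"
proof -
  \<comment> \<open>One half of the parameter goes to each variable: \<open>moment_split\<close>
    divides the moment, and the norm of (x, y) dominates both norms in the exponential.\<close>
  define Lam where "Lam = 2 * lam"
  have Lam: "0 < Lam" "Lam / 2 = lam" unfolding Lam_def using lam by simp_all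
  have Ku: "K \<in> ultra" using K unfolding ultra_eq_S_space .
  obtain C where C: "0 < C" "\<And>W p. set W \<subseteq> Basis \<Longrightarrow> cmod (Dw W K p) \<le> C * moment Lam (length W) * exp (- Lam * \<omega> (norm p))"
    by (rule ultraD[OF Ku Lam(1)]) blast
  have "cmod (slice v w x y) \<le> C * (moment lam (length w) * exp (- lam * \<omega> (norm x))) * (moment lam (length v) * exp (- lam * \<omega> (norm y)))"
    if v: "set v \<subseteq> Basis" and w: "set w \<subseteq> Basis" for v w x y
  proof -
    have "cmod (slice v w x y) \<le> C * moment Lam (length (map (Pair 0) v @ map (\<lambda>b. (b, 0)) w)) * exp (- Lam * \<omega> (norm (x, y)))"
      unfolding slice_def by (rule C(2)[OF slice_word[OF v w]])
    also have "\<dots> = C * (moment Lam (length v + length w) * exp (- Lam * \<omega> (norm (x, y))))" by (simp add: mult.assoc)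
    also have "\<dots> \<le> C * ((moment lam (length v) * moment lam (length w)) * (exp (- lam * \<omega> (norm x)) * exp (- lam * \<omega> (norm y))))"
    proof (intro mult_left_mono mult_mono)
      show "moment Lam (length v + length w) \<le> moment lam (length v) * moment lam (length w)"
        using moment_split[OF Lam(1)] unfolding Lam(2) .
      have "\<omega> (norm x) \<le> \<omega> (norm (x, y))" "\<omega> (norm y) \<le> \<omega> (norm (x, y))"
        by (intro om_mono norm_fst_le norm_snd_le norm_ge_zero)+
      then have "lam * (\<omega> (norm x) + \<omega> (norm y)) \<le> lam * (\<omega> (norm (x, y)) + \<omega> (norm (x, y)))" using lam by (intro mult_left_mono add_mono) auto
      then show "exp (- Lam * \<omega> (norm (x, y))) \<le> exp (- lam * \<omega> (norm x)) * exp (- lam * \<omega> (norm y))"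
        unfolding exp_add[symmetric] Lam_def by (simp add: algebra_simps)
    qed (use C(1) in auto)
    finally show ?thesis by (simp only: ac_simps)
  qed
  then show ?thesis using C(1) by (intro exI[of _ C]) simp
qed

lemma slice_has_D_snd:
  assumes v: "set v \<subseteq> Basis" and w: "set w \<subseteq> Basis" and b: "b \<in> Basis"
  shows "has_D b (slice v w x) (slice (b # v) w x)"
proof -
  have b0: "(0, b) \<in> (Basis :: ('a \<times> 'a) set)" using b unfolding Basis_prod_def by simp
  have h: "has_D (0, b) (Dw (map (Pair 0) v @ map (\<lambda>b. (b, 0)) w) K) (D_dir (0, b) (Dw (map (Pair 0) v @ map (\<lambda>b. (b, 0)) w) K))"
    by (rule smooth_has_D[OF smooth_Dw[OF S_space_smooth[OF K] slice_word[OF v w]] b0])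
  show ?thesis
    unfolding has_D_def
  proof
    fix y
    show "((\<lambda>t. slice v w x (y + t *\<^sub>R b)) has_vector_derivative \<i> * slice (b # v) w x y) (at 0)"
      using h[unfolded has_D_def, rule_format, of "(x, y)"] unfolding slice_def by simp
  qed
qed

lemma slice_has_D_fst:
  assumes v: "set v \<subseteq> Basis" and w: "set w \<subseteq> Basis" and b: "b \<in> Basis"
  shows "has_D b (\<lambda>x. slice v w x y) (\<lambda>x. slice v (b # w) x y)"
proof -
  have b0: "(b, 0) \<in> (Basis :: ('a \<times> 'a) set)" using b unfolding Basis_prod_def by simp
  have nil: "set [] \<subseteq> (Basis :: 'a set)" by simp
  have h: "has_D (b, 0) (Dw (map (Pair 0) v @ map (\<lambda>b. (b, 0)) w) K) (D_dir (b, 0) (Dw (map (Pair 0) v @ map (\<lambda>b. (b, 0)) w) K))"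
    by (rule smooth_has_D[OF smooth_Dw[OF S_space_smooth[OF K] slice_word[OF v w]] b0])
  \<comment> \<open>The new x-letter arrives in front of the y-letters and is moved behind them, by
    symmetry of mixed derivatives.\<close>
  have e: "D_dir (b, 0) (Dw (map (Pair 0) v @ map (\<lambda>b. (b, 0)) w) K) = Dw (map (Pair 0) v @ map (\<lambda>b. (b, 0)) (b # w)) K"
    using Dw_move[OF S_space_smooth[OF K], of "map (Pair 0) v" "(b, 0)" "map (\<lambda>b. (b, 0)) w"] b0 slice_word[OF v nil] slice_word[OF nil w] by simp
  show ?thesis
    unfolding has_D_def
  proof
    fix x
    show "((\<lambda>t. slice v w (x + t *\<^sub>R b) y) has_vector_derivative \<i> * slice v (b # w) x y) (at 0)"
      using h[unfolded has_D_def, rule_format, of "(x, y)"] unfolding e slice_def by simp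
  qed
qed

lemma smooth_slice:
  assumes v: "set v \<subseteq> Basis" and w: "set w \<subseteq> Basis"
  shows "smooth (slice v w x)"
proof (rule smooth_coinduct[where P="\<lambda>h. \<exists>v. set v \<subseteq> Basis \<and> h = slice v w x"])
  show "\<exists>v'. set v' \<subseteq> Basis \<and> slice v w x = slice v' w x" using v by (intro exI[of _ v]) simp
  fix h assume "\<exists>v. set v \<subseteq> Basis \<and> h = slice v w x"
  then obtain v where h: "set v \<subseteq> Basis" "h = slice v w x" by (elim exE conjE)
  show "continuous_on UNIV h \<and> (\<forall>b\<in>Basis. \<exists>g. has_D b h g \<and> (\<exists>v. set v \<subseteq> Basis \<and> g = slice v w x))"
  proof (intro conjI ballI)
    have "continuous_on UNIV (Dw (map (Pair 0) v @ map (\<lambda>b. (b, 0)) w) K)" by (rule S_space_Dw(1)[OF K slice_word[OF h(1) w]])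
    then have "continuous_on UNIV (\<lambda>y. Dw (map (Pair 0) v @ map (\<lambda>b. (b, 0)) w) K (x, y))"
      by (rule continuous_on_compose2) (auto intro!: continuous_intros)
    then show "continuous_on UNIV h" unfolding h(2) slice_def[abs_def] .
    fix b :: 'a assume b: "b \<in> Basis"
    have "set (b # v) \<subseteq> Basis" using h(1) b by simp
    then show "\<exists>g. has_D b h g \<and> (\<exists>v. set v \<subseteq> Basis \<and> g = slice v w x)" unfolding h(2)
      by (rule_tac exI[of _ "slice (b # v) w x"], rule_tac conjI[OF slice_has_D_snd[OF h(1) w b]], rule_tac exI[of _ "b # v"]) simp
  qed
qed

lemma Dw_slice:
  assumes w: "set w \<subseteq> Basis" and v: "set v \<subseteq> Basis"
  shows "Dw v (slice [] w x) = slice v w x"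
  using v
proof (induction v)
  case (Cons b v)
  then have "has_D b (slice v w x) (slice (b # v) w x)" by (intro slice_has_D_snd w) auto
  from has_D_D_dir[OF this] show ?case using Cons by simp
qed simp

lemma slice_seminorm:
  assumes lam: "0 < lam"
  shows "\<exists>C>0. \<forall>w x. set w \<subseteq> Basis \<longrightarrow> S_seminorm \<omega> lam (slice [] w x) \<le> C * (moment lam (length w) * exp (- lam * \<omega> (norm x)))"
proof -
  obtain C where C: "0 < C" "\<forall>v w x y. set v \<subseteq> Basis \<longrightarrow> set w \<subseteq> Basis \<longrightarrow> cmod (slice v w x y) \<le>
    C * (moment lam (length w) * exp (- lam * \<omega> (norm x))) * (moment lam (length v) * exp (- lam * \<omega> (norm y)))"
    using slice_bound[OF lam] by (elim exE conjE)
  have "S_seminorm \<omega> lam (slice [] w x) \<le> C * (moment lam (length w) * exp (- lam * \<omega> (norm x)))" if w: "set w \<subseteq> Basis" for w x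
  proof (rule S_seminorm_le)
    fix v :: "'a list" and y :: 'a assume v: "set v \<subseteq> Basis"
    show "cmod (Dw v (slice [] w x) y) \<le> C * (moment lam (length w) * exp (- lam * \<omega> (norm x))) * moment lam (length v) * exp (- lam * \<omega> (norm y))"
      unfolding Dw_slice[OF w v] using C(2)[rule_format, OF v w, of x y] by (simp only: mult.assoc)
  qed
  then show ?thesis using C(1) by (intro exI[of _ C]) simp
qed

lemma slice_S_space:
  assumes w: "set w \<subseteq> Basis"
  shows "slice [] w x \<in> S_space \<omega>"
proof -
  have nil: "set [] \<subseteq> (Basis :: 'a set)" by simp
  have "slice [] w x \<in> ultra"
  proof (rule ultraI[OF smooth_slice[OF nil w]])
    fix lam :: real assume lam: "0 < lam"
    obtain C where C: "0 < C" "\<forall>v w x y. set v \<subseteq> Basis \<longrightarrow> set w \<subseteq> Basis \<longrightarrow> cmod (slice v w x y) \<le>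
      C * (moment lam (length w) * exp (- lam * \<omega> (norm x))) * (moment lam (length v) * exp (- lam * \<omega> (norm y)))"
      using slice_bound[OF lam] by (elim exE conjE)
    show "\<exists>C. \<forall>v y. set v \<subseteq> Basis \<longrightarrow> cmod (Dw v (slice [] w x) y) \<le> C * moment lam (length v) * exp (- lam * \<omega> (norm y))"
    proof (intro exI allI impI)
      fix v :: "'a list" and y :: 'a assume v: "set v \<subseteq> Basis"
      show "cmod (Dw v (slice [] w x) y) \<le> (C * (moment lam (length w) * exp (- lam * \<omega> (norm x)))) * moment lam (length v) * exp (- lam * \<omega> (norm y))"
        unfolding Dw_slice[OF w v] using C(2)[rule_format, OF v w, of x y] by (simp only: mult.assoc)
    qed
  qed
  then show ?thesis unfolding ultra_eq_S_space .
qed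

section \<open>The operator that a kernel defines on functionals\<close>

definition ext :: "(('a \<Rightarrow> complex) \<Rightarrow> complex) \<Rightarrow> 'a \<Rightarrow> complex" where
  "ext u x = u (slice [] [] x)"

text \<open>\<open>u\<close> is applied to the Taylor remainder of the slices in x. All
  y-derivatives of that remainder are estimated at once by \<open>slice_bound\<close> with two
  further x-letters, so the seminorm that controls \<open>u\<close> is O(t^2) on it.\<close>

lemma ext_has_D:
  assumes u: "u \<in> S_dual \<omega>" and w: "set w \<subseteq> Basis" and b: "b \<in> Basis"
  shows "has_D b (\<lambda>x. u (slice [] w x)) (\<lambda>x. u (slice [] (b # w) x))"
  unfolding has_D_def
proof
  fix x
  have bw: "set (b # w) \<subseteq> Basis" and bbw: "set (b # b # w) \<subseteq> Basis" using w b by auto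
  obtain lam D where lam: "0 < lam" and D: "0 < D" and uD: "\<forall>f\<in>S_space \<omega>. cmod (u f) \<le> D * S_seminorm \<omega> lam f"
    using S_dual_bound[OF u] by (elim exE conjE)
  obtain C where C: "0 < C" "\<forall>v w x y. set v \<subseteq> Basis \<longrightarrow> set w \<subseteq> Basis \<longrightarrow> cmod (slice v w x y) \<le>
      C * (moment lam (length w) * exp (- lam * \<omega> (norm x))) * (moment lam (length v) * exp (- lam * \<omega> (norm y)))"
    using slice_bound[OF lam] by (elim exE conjE)
  define M where "M = C * moment lam (length (b # b # w))"
  show "((\<lambda>t. u (slice [] w (x + t *\<^sub>R b))) has_vector_derivative \<i> * u (slice [] (b # w) x)) (at 0)"
  proof (rule has_vector_derivative_quadratic_error[where M="D * M"])
    fix t :: real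
    let ?fa = "slice [] w (x + t *\<^sub>R b)" and ?fb = "slice [] w x" and ?fc = "slice [] (b # w) x"
    define g where "g = (\<lambda>y. 1 * ?fa y + (-1) * ?fb y)"
    define f where "f = (\<lambda>y. 1 * g y + (- (of_real t * \<i>)) * ?fc y)"
    note S = slice_S_space[OF w, of "x + t *\<^sub>R b"] slice_S_space[OF w, of x] slice_S_space[OF bw, of x]
    have g: "g \<in> S_space \<omega>" unfolding g_def by (rule S_space_lin[OF S(1,2)])
    have f: "f \<in> S_space \<omega>" unfolding f_def by (rule S_space_lin[OF g S(3)])
    have "u f = 1 * u g + (- (of_real t * \<i>)) * u ?fc" unfolding f_def by (rule S_dual_lin[OF u g S(3)])
    also have "u g = 1 * u ?fa + (-1) * u ?fb" unfolding g_def by (rule S_dual_lin[OF u S(1,2)])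
    finally have uf: "u ?fa - u (slice [] w (x + 0 *\<^sub>R b)) - t *\<^sub>R (\<i> * u ?fc) = u f" by (simp add: scaleR_conv_of_real algebra_simps)
    have "S_seminorm \<omega> lam f \<le> M * t\<^sup>2"
    proof (rule S_seminorm_le)
      fix v :: "'a list" and y :: 'a assume v: "set v \<subseteq> Basis"
      have "Dw v f = (\<lambda>y. 1 * Dw v g y + (- (of_real t * \<i>)) * Dw v ?fc y)"
        unfolding f_def by (rule Dw_lin[OF S_space_smooth[OF g] S_space_smooth[OF S(3)] v])
      moreover have "Dw v g = (\<lambda>y. 1 * Dw v ?fa y + (-1) * Dw v ?fb y)"
        unfolding g_def by (rule Dw_lin[OF S_space_smooth[OF S(1)] S_space_smooth[OF S(2)] v])
      ultimately have "Dw v f y = slice v w (x + t *\<^sub>R b) y - slice v w x y - t *\<^sub>R (\<i> * slice v (b # w) x y)"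
        unfolding Dw_slice[OF w v] Dw_slice[OF bw v] by (simp add: scaleR_conv_of_real algebra_simps)
      also have "cmod \<dots> \<le> (M * (moment lam (length v) * exp (- lam * \<omega> (norm y)))) * t\<^sup>2"
      proof (rule D_dir_Taylor2[OF slice_has_D_fst[OF v w b] slice_has_D_fst[OF v bw b]])
        fix s
        have "cmod (slice v (b # b # w) (x + s *\<^sub>R b) y) \<le> C * (moment lam (length (b # b # w)) * exp (- lam * \<omega> (norm (x + s *\<^sub>R b)))) * (moment lam (length v) * exp (- lam * \<omega> (norm y)))"
          by (rule C(2)[rule_format, OF v bbw])
        also have "\<dots> \<le> C * (moment lam (length (b # b # w)) * 1) * (moment lam (length v) * exp (- lam * \<omega> (norm y)))"
          using C(1) lam om_nonneg[of "norm (x + s *\<^sub>R b)"] by (intro mult_right_mono mult_left_mono) auto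
        finally show "cmod (slice v (b # b # w) (x + s *\<^sub>R b) y) \<le> M * (moment lam (length v) * exp (- lam * \<omega> (norm y)))" unfolding M_def by simp
      qed
      finally show "cmod (Dw v f y) \<le> (M * t\<^sup>2) * moment lam (length v) * exp (- lam * \<omega> (norm y))" by (simp only: ac_simps)
    qed
    then have "D * S_seminorm \<omega> lam f \<le> D * (M * t\<^sup>2)" using D by (intro mult_left_mono) auto
    then show "cmod (u ?fa - u (slice [] w (x + 0 *\<^sub>R b)) - t *\<^sub>R (\<i> * u ?fc)) \<le> D * M * t\<^sup>2"
      unfolding uf using uD[rule_format, OF f] by simp
  qed
qed

lemma ext_bound:
  assumes u: "u \<in> S_dual \<omega>" and mu: "0 < mu"
  shows "\<exists>C. \<forall>w x. set w \<subseteq> Basis \<longrightarrow> cmod (u (slice [] w x)) \<le> C * moment mu (length w) * exp (- mu * \<omega> (norm x))"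
proof -
  obtain lam0 D where lam0: "0 < lam0" and D: "0 < D" and uD: "\<forall>f\<in>S_space \<omega>. cmod (u f) \<le> D * S_seminorm \<omega> lam0 f"
    using S_dual_bound[OF u] by (elim exE conjE)
  \<comment> \<open>One parameter that controls both the functional, through \<open>lam0\<close>,
    and the decay asked for, through \<open>mu\<close>.\<close>
  define lam where "lam = max lam0 mu"
  have lam: "0 < lam" "lam0 \<le> lam" "mu \<le> lam" unfolding lam_def using lam0 by auto
  obtain C where C: "0 < C" "\<forall>w x. set w \<subseteq> Basis \<longrightarrow> S_seminorm \<omega> lam (slice [] w x) \<le> C * (moment lam (length w) * exp (- lam * \<omega> (norm x)))"
    using slice_seminorm[OF lam(1)] by (elim exE conjE)
  show ?thesis
  proof (intro exI allI impI)
    fix w :: "'a list" and x :: 'a assume w: "set w \<subseteq> Basis"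
    have S: "slice [] w x \<in> S_space \<omega>" by (rule slice_S_space[OF w])
    have "cmod (u (slice [] w x)) \<le> D * S_seminorm \<omega> lam0 (slice [] w x)" using uD S by blast
    also have "\<dots> \<le> D * S_seminorm \<omega> lam (slice [] w x)" using D S_seminorm_mono[OF S lam0 lam(2)] by (intro mult_left_mono) auto
    also have "\<dots> \<le> D * (C * (moment lam (length w) * exp (- lam * \<omega> (norm x))))" using D C(2)[rule_format, OF w] by (intro mult_left_mono) auto
    also have "\<dots> \<le> D * (C * (moment mu (length w) * exp (- mu * \<omega> (norm x))))"
      using D C(1) mu lam(3) om_nonneg[of "norm x"] by (intro mult_left_mono mult_mono moment_antimono) (auto intro: mult_right_mono)
    finally show "cmod (u (slice [] w x)) \<le> (D * C) * moment mu (length w) * exp (- mu * \<omega> (norm x))" by (simp only: mult.assoc)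
  qed
qed

lemma smooth_ext:
  assumes u: "u \<in> S_dual \<omega>"
  shows "smooth (ext u)"
proof (rule smooth_coinduct[where P="\<lambda>h. \<exists>w. set w \<subseteq> Basis \<and> h = (\<lambda>x. u (slice [] w x))"])
  show "\<exists>w. set w \<subseteq> Basis \<and> ext u = (\<lambda>x. u (slice [] w x))" by (intro exI[of _ "[]"]) (auto simp: ext_def)
  fix h assume "\<exists>w. set w \<subseteq> Basis \<and> h = (\<lambda>x. u (slice [] w x))"
  then obtain w where h: "set w \<subseteq> Basis" "h = (\<lambda>x. u (slice [] w x))" by (elim exE conjE)
  show "continuous_on UNIV h \<and> (\<forall>b\<in>Basis. \<exists>g. has_D b h g \<and> (\<exists>w. set w \<subseteq> Basis \<and> g = (\<lambda>x. u (slice [] w x))))"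
  proof (intro conjI ballI)
    obtain C where C: "\<forall>w x. set w \<subseteq> Basis \<longrightarrow> cmod (u (slice [] w x)) \<le> C * moment 1 (length w) * exp (- 1 * \<omega> (norm x))"
      using ext_bound[OF u, of 1] by auto
    define M where "M = \<bar>C\<bar> * moment 1 (Suc (length w))"
    have M: "0 \<le> M" unfolding M_def by simp
    have "cmod (h y - h x) \<le> M * DIM('a) * norm (y - x)" for x y
      unfolding h(2)
    proof (rule D_dir_Lipschitz[OF ext_has_D[OF u h(1)]])
      fix b x :: 'a assume b: "b \<in> Basis"
      have "set (b # w) \<subseteq> Basis" using b h(1) by simp
      then have "cmod (u (slice [] (b # w) x)) \<le> C * moment 1 (length (b # w)) * exp (- 1 * \<omega> (norm x))" by (rule C[rule_format])
      also have "\<dots> \<le> \<bar>C\<bar> * moment 1 (length (b # w)) * 1" using om_nonneg[of "norm x"] by (intro mult_mono) auto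
      finally show "cmod (u (slice [] (b # w) x)) \<le> M" unfolding M_def by simp
    qed
    then have "(M * DIM('a))-lipschitz_on UNIV h" using M by (auto simp: lipschitz_on_def dist_norm)
    then show "continuous_on UNIV h" by (rule lipschitz_on_continuous_on)
    fix b :: 'a assume b: "b \<in> Basis"
    then have "set (b # w) \<subseteq> Basis" using h(1) by simp
    then show "\<exists>g. has_D b h g \<and> (\<exists>w. set w \<subseteq> Basis \<and> g = (\<lambda>x. u (slice [] w x)))"
      unfolding h(2)
      by (rule_tac exI[of _ "\<lambda>x. u (slice [] (b # w) x)"], rule_tac conjI[OF ext_has_D[OF u h(1) b]], rule_tac exI[of _ "b # w"]) simp
  qed
qed

lemma Dw_ext:
  assumes u: "u \<in> S_dual \<omega>" and w: "set w \<subseteq> Basis"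
  shows "Dw w (ext u) = (\<lambda>x. u (slice [] w x))"
  using w
proof (induction w)
  case Nil
  show ?case by (auto simp: ext_def)
next
  case (Cons b w)
  then have "has_D b (\<lambda>x. u (slice [] w x)) (\<lambda>x. u (slice [] (b # w) x))" by (intro ext_has_D u) auto
  from has_D_D_dir[OF this] show ?case using Cons by simp
qed

lemma ext_S_space:
  assumes u: "u \<in> S_dual \<omega>"
  shows "ext u \<in> S_space \<omega>"
proof -
  have "ext u \<in> ultra"
  proof (rule ultraI[OF smooth_ext[OF u]])
    fix mu :: real assume mu: "0 < mu"
    obtain C where C: "\<forall>w x. set w \<subseteq> Basis \<longrightarrow> cmod (u (slice [] w x)) \<le> C * moment mu (length w) * exp (- mu * \<omega> (norm x))"
      using ext_bound[OF u mu] by (elim exE)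
    show "\<exists>C. \<forall>w x. set w \<subseteq> Basis \<longrightarrow> cmod (Dw w (ext u) x) \<le> C * moment mu (length w) * exp (- mu * \<omega> (norm x))"
    proof (intro exI allI impI)
      fix w :: "'a list" and x :: 'a assume w: "set w \<subseteq> Basis"
      show "cmod (Dw w (ext u) x) \<le> C * moment mu (length w) * exp (- mu * \<omega> (norm x))"
        unfolding Dw_ext[OF u w] by (rule C[rule_format, OF w])
    qed
  qed
  then show ?thesis unfolding ultra_eq_S_space .
qed

text \<open>\<open>B\<close> consists of the slices divided by the moment and decay factors of the
  seminorm with parameter \<open>lam\<close>. A bound for u - v on \<open>B\<close> is then
  literally a bound for the seminorm of the image.\<close>

lemma ext_seminorm:
  assumes lam: "0 < lam"
  shows "\<exists>B. S_bounded \<omega> B \<and> B \<noteq> {} \<and> (\<forall>u\<in>S_dual \<omega>. \<forall>v\<in>S_dual \<omega>.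
    S_seminorm \<omega> lam (\<lambda>x. ext u x - ext v x) \<le> (SUP f\<in>B. cmod (u f - v f)))"
proof -
  define c where "c = (\<lambda>(w::'a list) x. inverse (moment lam (length w) * exp (- lam * \<omega> (norm (x::'a)))))"
  have c: "0 < c w x" for w :: "'a list" and x unfolding c_def by simp
  define B where "B = {\<lambda>y. of_real (c w x) * slice [] w x y | w x. set w \<subseteq> Basis}"
  have BS: "B \<subseteq> S_space \<omega>" unfolding B_def using S_space_scale[OF slice_S_space] by blast
  have ne: "B \<noteq> {}"
  proof -
    have "(\<lambda>y. of_real (c [] 0) * slice [] [] 0 y) \<in> B" unfolding B_def by (intro CollectI exI[of _ "[]"] exI[of _ 0]) simp
    then show ?thesis by blast
  qed
  have "bdd_above (S_seminorm \<omega> mu ` B)" if mu: "0 < mu" for mu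
  proof -
    define Lam where "Lam = max lam mu"
    have Lam: "0 < Lam" "lam \<le> Lam" "mu \<le> Lam" unfolding Lam_def using lam by auto
    obtain C where C: "0 < C" "\<forall>w x. set w \<subseteq> Basis \<longrightarrow> S_seminorm \<omega> Lam (slice [] w x) \<le> C * (moment Lam (length w) * exp (- Lam * \<omega> (norm x)))"
      using slice_seminorm[OF Lam(1)] by (elim exE conjE)
    show ?thesis
    proof (rule bdd_aboveI2)
      fix f assume "f \<in> B"
      then obtain w x where f: "f = (\<lambda>y. of_real (c w x) * slice [] w x y)" and w: "set w \<subseteq> Basis" unfolding B_def by blast
      have S: "slice [] w x \<in> S_space \<omega>" by (rule slice_S_space[OF w])
      have fS: "f \<in> S_space \<omega>" unfolding f by (rule S_space_scale[OF S])
      have "S_seminorm \<omega> mu f \<le> S_seminorm \<omega> Lam f" by (rule S_seminorm_mono[OF fS mu Lam(3)])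
      also have "\<dots> \<le> c w x * S_seminorm \<omega> Lam (slice [] w x)"
        unfolding f using S_seminorm_scale[OF S Lam(1), of "of_real (c w x)"] c[of w x] by simp
      also have "\<dots> \<le> c w x * (C * (moment Lam (length w) * exp (- Lam * \<omega> (norm x))))"
        using c[of w x] C(2)[rule_format, OF w] by (intro mult_left_mono) auto
      \<comment> \<open>Since \<open>lam \<le> Lam\<close>, the factors at \<open>Lam\<close> are
        below those at \<open>lam\<close>, which the normalisation cancels. A single normalisation
        thus makes \<open>B\<close> bounded in every seminorm.\<close>
      also have "\<dots> \<le> c w x * (C * (moment lam (length w) * exp (- lam * \<omega> (norm x))))"
        using c[of w x] C(1) Lam lam om_nonneg[of "norm x"] by (intro mult_left_mono mult_mono moment_antimono) (auto intro: mult_right_mono)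
      also have "\<dots> = C" unfolding c_def by (simp add: field_simps)
      finally show "S_seminorm \<omega> mu f \<le> C" .
    qed
  qed
  then have B: "S_bounded \<omega> B" unfolding S_bounded_def using BS by simp
  have "S_seminorm \<omega> lam (\<lambda>x. ext u x - ext v x) \<le> (SUP f\<in>B. cmod (u f - v f))" if u: "u \<in> S_dual \<omega>" and v: "v \<in> S_dual \<omega>" for u v
  proof (rule S_seminorm_le)
    fix w :: "'a list" and x :: 'a assume w: "set w \<subseteq> Basis"
    have S: "slice [] w x \<in> S_space \<omega>" by (rule slice_S_space[OF w])
    have uv: "(\<lambda>f. u f - v f) \<in> S_dual \<omega>" using S_dual_comb[OF u v, of 1 "-1"] by simp
    let ?f = "\<lambda>y. of_real (c w x) * slice [] w x y"
    have "?f \<in> B" unfolding B_def using w by blast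
    then have "cmod (u ?f - v ?f) \<le> (SUP f\<in>B. cmod (u f - v f))" by (rule cSUP_upper[OF _ S_dual_bdd[OF uv B]])
    moreover have "u ?f - v ?f = of_real (c w x) * (u (slice [] w x) - v (slice [] w x))"
      unfolding S_dual_scale[OF u S] S_dual_scale[OF v S] by (simp add: right_diff_distrib)
    ultimately have "c w x * cmod (u (slice [] w x) - v (slice [] w x)) \<le> (SUP f\<in>B. cmod (u f - v f))"
      using c[of w x] by (simp add: norm_mult)
    then have le: "cmod (u (slice [] w x) - v (slice [] w x)) \<le> (SUP f\<in>B. cmod (u f - v f)) * (moment lam (length w) * exp (- lam * \<omega> (norm x)))"
      unfolding c_def by (simp add: field_simps)
    have "Dw w (\<lambda>x. 1 * ext u x + (-1) * ext v x) = (\<lambda>x. 1 * Dw w (ext u) x + (-1) * Dw w (ext v) x)"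
      by (rule Dw_lin[OF smooth_ext[OF u] smooth_ext[OF v] w])
    then have "Dw w (\<lambda>x. ext u x - ext v x) x = u (slice [] w x) - v (slice [] w x)" unfolding Dw_ext[OF u w] Dw_ext[OF v w] by simp
    then show "cmod (Dw w (\<lambda>x. ext u x - ext v x) x) \<le> (SUP f\<in>B. cmod (u f - v f)) * moment lam (length w) * exp (- lam * \<omega> (norm x))"
      using le by (simp only: mult.assoc)
  qed
  then show ?thesis using B ne by blast
qed

lemma linear_ext: "linear_op_on (S_dual \<omega>) ext"
  unfolding linear_op_on_def ext_def by simp

text \<open>It suffices to pull back the generating balls, and the supremum over the set from
  \<open>ext_seminorm\<close> is one of the seminorms of the strong dual.\<close>

lemma continuous_ext: "continuous_map (S_dual_topology \<omega>) (S_topology \<omega>) ext"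
  unfolding S_topology_def seminorm_topology_def
proof (rule continuous_on_generated_topo)
  let ?G = "{{g \<in> (S_space \<omega> :: ('a \<Rightarrow> complex) set). p (\<lambda>x. g x - f x) < e} |p f e. p \<in> {S_seminorm \<omega> lam |lam. 0 < lam} \<and> f \<in> S_space \<omega> \<and> 0 < e}"
  have "topspace (seminorm_topology (S_space \<omega>) {S_seminorm \<omega> lam |lam. 0 < lam}) = (S_space \<omega> :: ('a \<Rightarrow> complex) set)"
    using topspace_S[where 'a='a] unfolding S_topology_def .
  then have G: "\<Union>?G = (S_space \<omega> :: ('a \<Rightarrow> complex) set)" unfolding seminorm_topology_def topology_generated_by_topspace .
  show "ext ` topspace (S_dual_topology \<omega>) \<subseteq> \<Union>?G"
    unfolding G topspace_S_dual by (intro image_subsetI ext_S_space)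
  fix U :: "('a \<Rightarrow> complex) set" assume "U \<in> ?G"
  then obtain p f e where U0: "U = {g \<in> S_space \<omega>. p (\<lambda>x. g x - f x) < e}" and p: "\<exists>lam. p = S_seminorm \<omega> lam \<and> 0 < lam" and f: "f \<in> S_space \<omega>"
    unfolding mem_Collect_eq by (elim exE conjE) (rule that, assumption, intro exI conjI, assumption+)
  from p obtain lam where p': "p = S_seminorm \<omega> lam" and lam: "0 < lam" by (elim exE conjE)
  note U = U0[unfolded p']
  obtain B where B: "S_bounded \<omega> B" "B \<noteq> {}" and Bext: "\<forall>u\<in>S_dual \<omega>. \<forall>v\<in>S_dual \<omega>.
    S_seminorm \<omega> lam (\<lambda>x. ext u x - ext v x) \<le> (SUP f\<in>B. cmod (u f - v f))"
    using ext_seminorm[OF lam] by (elim exE conjE)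
  let ?P = "{\<lambda>u::('a \<Rightarrow> complex) \<Rightarrow> complex. SUP f\<in>B. cmod (u f) | B. S_bounded \<omega> B \<and> B \<noteq> {}}"
  show "openin (S_dual_topology \<omega>) (ext -` U \<inter> topspace (S_dual_topology \<omega>))"
    unfolding topspace_S_dual unfolding S_dual_topology_def
  proof (rule openin_seminorm_topologyI)
    show "ext -` U \<inter> S_dual \<omega> \<subseteq> S_dual \<omega>" by simp
    fix p and g :: "('a \<Rightarrow> complex) \<Rightarrow> complex" assume "p \<in> ?P"
    then obtain B' where "p = (\<lambda>u. SUP f\<in>B'. cmod (u f))" "B' \<noteq> {}" by blast
    then show "p (\<lambda>x. g x - g x) \<le> 0" by simp
  next
    fix v assume "v \<in> ext -` U \<inter> S_dual \<omega>"
    then have v: "v \<in> S_dual \<omega>" and vU: "S_seminorm \<omega> lam (\<lambda>x. ext v x - f x) < e" unfolding U by auto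
    let ?p = "\<lambda>u::('a \<Rightarrow> complex) \<Rightarrow> complex. SUP f\<in>B. cmod (u f)"
    \<comment> \<open>The room left between the image of \<open>v\<close> and the boundary of the
      ball; the triangle inequality shows that it can serve as the radius around
      \<open>v\<close>.\<close>
    define r where "r = e - S_seminorm \<omega> lam (\<lambda>x. ext v x - f x)"
    have "u \<in> ext -` U \<inter> S_dual \<omega>" if u: "u \<in> S_dual \<omega>" and lt: "?p (\<lambda>x. u x - v x) < r" for u
    proof -
      have "S_seminorm \<omega> lam (\<lambda>x. ext u x - f x) \<le> S_seminorm \<omega> lam (\<lambda>x. ext u x - ext v x) + S_seminorm \<omega> lam (\<lambda>x. ext v x - f x)"
        by (rule S_seminorm_diff_triangle[OF f ext_S_space[OF u] ext_S_space[OF v] lam])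
      also have "\<dots> < e" using Bext[rule_format, OF u v] lt unfolding r_def by simp
      finally show ?thesis using u ext_S_space[OF u] unfolding U by simp
    qed
    moreover have "0 < r" unfolding r_def using vU by simp
    moreover have "?p \<in> ?P" by (intro CollectI exI[of _ B] conjI refl B)
    ultimately show "\<exists>p\<in>?P. \<exists>e>0. \<forall>h\<in>S_dual \<omega>. p (\<lambda>x. h x - v x) < e \<longrightarrow> h \<in> ext -` U \<inter> S_dual \<omega>"
      by (intro bexI[of _ ?p] exI[of _ r] conjI ballI impI)
  qed
qed

lemma ext_embed: "ext (S_embed \<omega> f) x = (LINT y|lborel. K (x, y) * f y)"
proof -
  have "slice [] [] x \<in> S_space \<omega>" by (rule slice_S_space) simp
  then show ?thesis unfolding ext_def S_embed_def by (simp add: slice_def mult.commute)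
qed

end

theorem proposition3p11:
  fixes \<omega> :: "real \<Rightarrow> real" and m \<rho> :: real
    and a :: "(real^'d) \<times> (real^'d) \<times> (real^'d) \<Rightarrow> complex"
    and T :: "(real^'d \<Rightarrow> complex) \<Rightarrow> (real^'d \<Rightarrow> complex)"
  assumes "weight_function \<omega>"
    and "0 < \<rho>" and "\<rho> \<le> 1"
    and "a \<in> GA m \<omega> \<rho>"
    and "T \<in> S_space \<omega> \<rightarrow> S_space \<omega>"
    and "\<And>f. f \<in> S_space \<omega> \<Longrightarrow> T f = pseudo_op a f"
  shows
    "(\<exists>T' :: ((real^'d \<Rightarrow> complex) \<Rightarrow> complex) \<Rightarrow> real^'d \<Rightarrow> complex.
        linear_op_on (S_dual \<omega>) T' \<and>
        continuous_map (S_dual_topology \<omega>) (S_topology \<omega>) T' \<and>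
        (\<forall>f\<in>S_space \<omega>. T' (S_embed \<omega> f) = T f))
     \<longleftrightarrow>
     (\<exists>K :: (real^'d) \<times> (real^'d) \<Rightarrow> complex. K \<in> S_space \<omega> \<and>
        (\<forall>\<phi>\<in>S_space \<omega>. \<forall>x. T \<phi> x = (LINT y|lborel. K (x, y) * \<phi> y)))"
    (is "?extension \<longleftrightarrow> ?representation")
proof
  assume ?extension
  then obtain T' where T': "linear_op_on (S_dual \<omega>) T'" "continuous_map (S_dual_topology \<omega>) (S_topology \<omega>) T'"
    and ext: "\<forall>f\<in>S_space \<omega>. T' (S_embed \<omega> f) = T f" by (elim exE conjE)
  interpret extended_operator \<omega> T' by unfold_locales (fact assms(1) T')+
  have "\<forall>\<phi>\<in>S_space \<omega>. \<forall>x. T \<phi> x = (LINT y|lborel. kernel (x, y) * \<phi> y)"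
    using kernel_represents ext by simp
  then show ?representation using kernel_S_space by (intro exI[of _ kernel] conjI)
next
  assume ?representation
  then obtain K where K: "K \<in> S_space \<omega>" and rep: "\<forall>\<phi>\<in>S_space \<omega>. \<forall>x. T \<phi> x = (LINT y|lborel. K (x, y) * \<phi> y)"
    by (elim exE conjE)
  interpret kernel_operator \<omega> K by unfold_locales (fact assms(1) K)+
  have "\<forall>f\<in>S_space \<omega>. ext (S_embed \<omega> f) = T f" using ext_embed rep by auto
  then show ?extension using linear_ext continuous_ext by (intro exI[of _ ext] conjI)
qed

end
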